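(* Let $V$ be a complex vector space of finite dimension $N$ with a nondegenerate symmetric bilinear form $\Phi_V$, let $n=\lfloor N/2\rfloor$, $\sigma_N=(-1)^{\binom n2+nN}$, $\kappa_N=(-1)^{nN}$. There is a unique ($\mathbb C$-linear) monoidal functor $$\mathbf F\colon \mathcal{SB}(N,\sigma_N2^n;\kappa_N)\to \mathrm G(V)\text{-mod}$$ given on objects by $\mathsf S\mapsto S$, $\mathsf V\mapsto V$, and on morphisms by $$\cap_{\mathsf S}\mapsto\Phi_S,\quad \cap_{\mathsf V}\mapsto\Phi_V,\quad \mu\mapsto\tau,\quad s_{\mathsf S,\mathsf S}\mapsto\sigma_N\,\mathrm{flip}_{S,S},\quad s_{\mathsf S,\mathsf V}\mapsto\mathrm{flip}_{S,V},\quad s_{\mathsf V,\mathsf S}\mapsto\mathrm{flip}_{V,S},\quad s_{\mathsf V,\mathsf V}\mapsto\mathrm{flip}_{V,V}.$$ Furthermore, $\mathbf F(\cup_{\mathsf S})=\Phi_S^\vee$ and $\mathbf F(\cup_{\mathsf V})=\Phi_V^\vee$.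
   Context: **Representation theory.** Work over $\mathbb C$. $[n]=\{1,\dots,n\}$. $\mathrm{Cl}=T(V)/(vw+wv-2\Phi_V(v,w):v,w\in V)$ is the Clifford algebra, $\mathbb Z/2$-graded with $V$ odd; $\iota$ is the antiautomorphism of $\mathrm{Cl}$ that is the identity on $V$. $\mathrm{Pin}(V)$ is the group of homogeneous invertible $g\in\mathrm{Cl}$ with $gVg^{-1}=V$ and $g\iota(g)=1$; $\mathrm{Spin}(V)=\mathrm{Pin}(V)\cap\mathrm{Cl}_{\bar0}$. $\mathrm G(V)=\mathrm{Pin}(V)$ if $N$ is even and $\mathrm G(V)=\mathrm{Spin}(V)$ if $N$ is odd. $\mathrm G(V)$-mod is the monoidal category of finite-dimensional modules of the algebraic group $\mathrm G(V)$. The vector module is $V$ with $g\cdot v=gvg^{-1}$. Fix an orthonormal basis $e_1,\dots,e_N$ of $V$ and put $\psi_j=\frac12(e_{2j-1}+\sqrt{-1}e_{2j})$, $\psi_j^\dagger=\frac12(e_{2j-1}-\sqrt{-1}e_{2j})$, $1\le j\le n$. The spin module is $S=\Lambda(\mathrm{span}\{\psi_1^\dagger,\dots,\psi_n^\dagger\})$, with basis $x_I=\psi_{i_1}^\dagger\wedge\dots\wedge\psi_{i_k}^\dagger$ for $I=\{i_1<\dots<i_k\}\subseteq[n]$; $\mathrm{Cl}$ acts by $\psi_i^\dagger x_I=\psi_i^\dagger\wedge x_I$, $\psi_ix_I=(-1)^{|\{j\in I:j<i\}|}x_{I\setminus\{i\}}$ if $i\in I$ and $0$ otherwise, and, if $N$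 is odd, $e_Nx_I=\varepsilon(-1)^{|I|}x_I$ for a fixed choice $\varepsilon\in\{\pm1\}$; $\mathrm G(V)\subseteq\mathrm{Cl}^\times$ acts on $S$ by restriction. $\Phi_S$ is the bilinear form on $S$ with $\Phi_S(x_I,x_J)=(-1)^{\binom{|I|}2+nN|I|+|\{(i,j)\in I\times J:\,i>j\}|}$ if $J=[n]\setminus I$ and $0$ otherwise. For $U\in\{S,V\}$ with basis $B_U$, the left dual basis $\{x^\vee\}$ is defined by $\Phi_U(x^\vee,y)=\delta_{x,y}$, and $\Phi_U^\vee\colon\mathbb C\to U\otimes U$, $1\mapsto\sum_{x\in B_U}x\otimes x^\vee$. $\mathrm{flip}_{U,W}(u\otimes w)=w\otimes u$, and $\tau\colon V\otimes S\to S$, $v\otimes x\mapsto vx$. **Spin Brauer category.** For a commutative ring $\Bbbk$ (here $\mathbb C$), $d,D\in\Bbbk$, $\kappa\in\{\pm1\}$, $\mathcal{SB}(d,D;\kappa)$ is the strict $\Bbbk$-linear monoidal category (unit object $\mathbf 1$) with generating objects $\mathsf S,\mathsf V$; generating morphisms, for $\mathsf X,\mathsf Y\in\{\mathsf S,\mathsf V\}$, $\cap_{\mathsf X}\colon\mathsf X\otimes\mathsf X\to\mathbf 1$, $\cup_{\mathsf X}\colon\mathbf 1\to\mathsf X\otimes\mathsf X$, $s_{\mathsf X,\mathsf Y}\colon\mathsf X\otimes\mathsf Y\to\mathsf Y\otimes\mathsf X$, and $\mu\colon\mathsf V\otimes\mathsf S\to\mathsf S$; and relations, for all $\mathsf X,\mathsf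 Y,\mathsf Z\in\{\mathsf S,\mathsf V\}$: (1) $s_{\mathsf Y,\mathsf X}s_{\mathsf X,\mathsf Y}=1$; $(s_{\mathsf Y,\mathsf Z}\otimes1_{\mathsf X})(1_{\mathsf Y}\otimes s_{\mathsf X,\mathsf Z})(s_{\mathsf X,\mathsf Y}\otimes1_{\mathsf Z})=(1_{\mathsf Z}\otimes s_{\mathsf X,\mathsf Y})(s_{\mathsf X,\mathsf Z}\otimes1_{\mathsf Y})(1_{\mathsf X}\otimes s_{\mathsf Y,\mathsf Z})$; $(1_{\mathsf X}\otimes\cap_{\mathsf X})(\cup_{\mathsf X}\otimes1_{\mathsf X})=1_{\mathsf X}=(\cap_{\mathsf X}\otimes1_{\mathsf X})(1_{\mathsf X}\otimes\cup_{\mathsf X})$; $\cap_{\mathsf X}s_{\mathsf X,\mathsf X}=\cap_{\mathsf X}$; $(1_{\mathsf Y}\otimes\cap_{\mathsf X})(s_{\mathsf X,\mathsf Y}\otimes1_{\mathsf X})=(\cap_{\mathsf X}\otimes1_{\mathsf Y})(1_{\mathsf X}\otimes s_{\mathsf Y,\mathsf X})$; (2) $s_{\mathsf S,\mathsf X}(\mu\otimes1_{\mathsf X})=(1_{\mathsf X}\otimes\mu)(s_{\mathsf V,\mathsf X}\otimes1_{\mathsf S})(1_{\mathsf V}\otimes s_{\mathsf S,\mathsf X})$; (3) $(\cap_{\mathsf S}\otimes1_{\mathsf S\otimes\mathsf V})(1_{\mathsf S}\otimes\mu\otimes1_{\mathsf S\otimes\mathsf V})(1_{\mathsf S\otimes\mathsf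 V}\otimes\cup_{\mathsf S}\otimes1_{\mathsf V})(1_{\mathsf S}\otimes\cup_{\mathsf V})=(1_{\mathsf S\otimes\mathsf V}\otimes\cap_{\mathsf S})(1_{\mathsf S\otimes\mathsf V}\otimes\mu\otimes1_{\mathsf S})(1_{\mathsf S}\otimes\cup_{\mathsf V}\otimes1_{\mathsf S\otimes\mathsf S})(\cup_{\mathsf S}\otimes1_{\mathsf S})$ as morphisms $\mathsf S\to\mathsf S\otimes\mathsf V$; (4) $\mu\, s_{\mathsf S,\mathsf V}=\kappa\,(\cap_{\mathsf S}\otimes1_{\mathsf S})(1_{\mathsf S}\otimes\mu\otimes1_{\mathsf S})(1_{\mathsf S\otimes\mathsf V}\otimes\cup_{\mathsf S})$; (5) $\mu(1_{\mathsf V}\otimes\mu)+\mu(1_{\mathsf V}\otimes\mu)(s_{\mathsf V,\mathsf V}\otimes1_{\mathsf S})=2\,\cap_{\mathsf V}\otimes1_{\mathsf S}$; (6) $\cap_{\mathsf V}\cup_{\mathsf V}=d\,1_{\mathbf 1}$, $\cap_{\mathsf S}\cup_{\mathsf S}=D\,1_{\mathbf 1}$. *)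

theory Defs
  imports Complex_Main
    "HOL-Library.FuncSet"
    "HOL-Library.Function_Algebras"
    "HOL-Library.Poly_Mapping"
    "HOL-Algebra.QuotRing"
begin

section \<open>Strict linear monoidal categories and their functors\<close>

text \<open>An arrow records its source and target in addition to the underlying datum, so that arrows between
  different objects are different. In \<open>cmp g f\<close> the arrow \<open>f\<close> comes first.\<close>

record ('o, 'f) arrow =
  src :: 'o
  tgt :: 'o
  amap :: 'f

record ('k, 'o, 'f) lmcat =
  obj :: "'o set"
  arr :: "('o, 'f) arrow set"
  ide :: "'o \<Rightarrow> ('o, 'f) arrow"
  cmp :: "('o, 'f) arrow \<Rightarrow> ('o, 'f) arrow \<Rightarrow> ('o, 'f) arrow"
  unt :: 'o
  tenO :: "'o \<Rightarrow> 'o \<Rightarrow> 'o"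
  tenA :: "('o, 'f) arrow \<Rightarrow> ('o, 'f) arrow \<Rightarrow> ('o, 'f) arrow"
  addA :: "('o, 'f) arrow \<Rightarrow> ('o, 'f) arrow \<Rightarrow> ('o, 'f) arrow"
  sclA :: "'k \<Rightarrow> ('o, 'f) arrow \<Rightarrow> ('o, 'f) arrow"

record ('o, 'f, 'p, 'h) functor_data =
  fobj :: "'o \<Rightarrow> 'p"
  fmor :: "('o, 'f) arrow \<Rightarrow> ('p, 'h) arrow"

text \<open>Both maps of a functor are extensional, i.e. \<open>undefined\<close> off the objects and arrows, so that
  equality of functors is equality of records.\<close>

definition lm_functor ::
    "('k, 'o, 'f) lmcat \<Rightarrow> ('k, 'p, 'h) lmcat \<Rightarrow> ('o, 'f, 'p, 'h) functor_data \<Rightarrow> bool" where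
  "lm_functor C D F \<longleftrightarrow>
     fobj F \<in> obj C \<rightarrow>\<^sub>E obj D \<and> fmor F \<in> arr C \<rightarrow>\<^sub>E arr D \<and>
     (\<forall>f\<in>arr C. src (fmor F f) = fobj F (src f) \<and> tgt (fmor F f) = fobj F (tgt f)) \<and>
     (\<forall>a\<in>obj C. fmor F (ide C a) = ide D (fobj F a)) \<and>
     (\<forall>f\<in>arr C. \<forall>g\<in>arr C. tgt f = src g \<longrightarrow> fmor F (cmp C g f) = cmp D (fmor F g) (fmor F f)) \<and>
     fobj F (unt C) = unt D \<and>
     (\<forall>a\<in>obj C. \<forall>b\<in>obj C. fobj F (tenO C a b) = tenO D (fobj F a) (fobj F b)) \<and>
     (\<forall>f\<in>arr C. \<forall>g\<in>arr C. fmor F (tenA C f g) = tenA D (fmor F f) (fmor F g)) \<and>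
     (\<forall>f\<in>arr C. \<forall>g\<in>arr C. src f = src g \<longrightarrow> tgt f = tgt g \<longrightarrow>
        fmor F (addA C f g) = addA D (fmor F f) (fmor F g)) \<and>
     (\<forall>c. \<forall>f\<in>arr C. fmor F (sclA C c f) = sclA D c (fmor F f))"


section \<open>The spin Brauer category\<close>

text \<open>Objects are words in the two generating objects. Morphisms are formal terms in the generating
  morphisms modulo the least congruence containing the axioms of a strict linear monoidal category
  and the defining relations.\<close>

datatype sb_ob = \<S> | \<V>

datatype 'k sb_term =
    Id "sb_ob list"
  | Zero "sb_ob list" "sb_ob list"
  | Cap sb_ob
  | Cup sb_ob
  | Swap sb_ob sb_ob
  | Mu
  | Comp "'k sb_term" "'k sb_term" (infixr "\<cdot>" 70)
  | Tens "'k sb_term" "'k sb_term" (infixr "\<boxtimes>" 75)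
  | Plus "'k sb_term" "'k sb_term" (infixl "\<boxplus>" 65)
  | Scale 'k "'k sb_term"

inductive sb_typ :: "'k sb_term \<Rightarrow> sb_ob list \<Rightarrow> sb_ob list \<Rightarrow> bool" where
  "sb_typ (Id a) a a"
| "sb_typ (Zero a b) a b"
| "sb_typ (Cap X) [X, X] []"
| "sb_typ (Cup X) [] [X, X]"
| "sb_typ (Swap X Y) [X, Y] [Y, X]"
| "sb_typ Mu [\<V>, \<S>] [\<S>]"
| "sb_typ f a b \<Longrightarrow> sb_typ g b c \<Longrightarrow> sb_typ (g \<cdot> f) a c"
| "sb_typ f a b \<Longrightarrow> sb_typ g c d \<Longrightarrow> sb_typ (f \<boxtimes> g) (a @ c) (b @ d)"
| "sb_typ f a b \<Longrightarrow> sb_typ g a b \<Longrightarrow> sb_typ (f \<boxplus> g) a b"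
| "sb_typ f a b \<Longrightarrow> sb_typ (Scale r f) a b"

inductive sb_rel :: "'k::comm_ring_1 \<Rightarrow> 'k \<Rightarrow> 'k \<Rightarrow>
    sb_ob list \<Rightarrow> sb_ob list \<Rightarrow> 'k sb_term \<Rightarrow> 'k sb_term \<Rightarrow> bool"
  for d D \<kappa> :: 'k where
  swap_swap: "sb_rel d D \<kappa> [X, Y] [X, Y] (Swap Y X \<cdot> Swap X Y) (Id [X, Y])"
| braid: "sb_rel d D \<kappa> [X, Y, Z] [Z, Y, X]
    ((Swap Y Z \<boxtimes> Id [X]) \<cdot> (Id [Y] \<boxtimes> Swap X Z) \<cdot> (Swap X Y \<boxtimes> Id [Z]))
    ((Id [Z] \<boxtimes> Swap X Y) \<cdot> (Swap X Z \<boxtimes> Id [Y]) \<cdot> (Id [X] \<boxtimes> Swap Y Z))"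
| zigzag1: "sb_rel d D \<kappa> [X] [X] ((Id [X] \<boxtimes> Cap X) \<cdot> (Cup X \<boxtimes> Id [X])) (Id [X])"
| zigzag2: "sb_rel d D \<kappa> [X] [X] ((Cap X \<boxtimes> Id [X]) \<cdot> (Id [X] \<boxtimes> Cup X)) (Id [X])"
| cap_swap: "sb_rel d D \<kappa> [X, X] [] (Cap X \<cdot> Swap X X) (Cap X)"
| cap_slide: "sb_rel d D \<kappa> [X, Y, X] [Y]
    ((Id [Y] \<boxtimes> Cap X) \<cdot> (Swap X Y \<boxtimes> Id [X]))
    ((Cap X \<boxtimes> Id [Y]) \<cdot> (Id [X] \<boxtimes> Swap Y X))"
| mu_slide: "sb_rel d D \<kappa> [\<V>, \<S>, X] [X, \<S>]
    (Swap \<S> X \<cdot> (Mu \<boxtimes> Id [X]))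
    ((Id [X] \<boxtimes> Mu) \<cdot> (Swap \<V> X \<boxtimes> Id [\<S>]) \<cdot> (Id [\<V>] \<boxtimes> Swap \<S> X))"
| mu_rotate: "sb_rel d D \<kappa> [\<S>] [\<S>, \<V>]
    ((Cap \<S> \<boxtimes> Id [\<S>, \<V>]) \<cdot> (Id [\<S>] \<boxtimes> Mu \<boxtimes> Id [\<S>, \<V>]) \<cdot>
      (Id [\<S>, \<V>] \<boxtimes> Cup \<S> \<boxtimes> Id [\<V>]) \<cdot> (Id [\<S>] \<boxtimes> Cup \<V>))
    ((Id [\<S>, \<V>] \<boxtimes> Cap \<S>) \<cdot> (Id [\<S>, \<V>] \<boxtimes> Mu \<boxtimes> Id [\<S>]) \<cdot>
      (Id [\<S>] \<boxtimes> Cup \<V> \<boxtimes> Id [\<S>, \<S>]) \<cdot> (Cup \<S> \<boxtimes> Id [\<S>]))"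
| mu_swap: "sb_rel d D \<kappa> [\<S>, \<V>] [\<S>]
    (Mu \<cdot> Swap \<S> \<V>)
    (Scale \<kappa> ((Cap \<S> \<boxtimes> Id [\<S>]) \<cdot> (Id [\<S>] \<boxtimes> Mu \<boxtimes> Id [\<S>]) \<cdot> (Id [\<S>, \<V>] \<boxtimes> Cup \<S>)))"
| clifford: "sb_rel d D \<kappa> [\<V>, \<V>, \<S>] [\<S>]
    (Mu \<cdot> (Id [\<V>] \<boxtimes> Mu) \<boxplus> Mu \<cdot> (Id [\<V>] \<boxtimes> Mu) \<cdot> (Swap \<V> \<V> \<boxtimes> Id [\<S>]))
    (Scale 2 (Cap \<V> \<boxtimes> Id [\<S>]))"
| loop_V: "sb_rel d D \<kappa> [] [] (Cap \<V> \<cdot> Cup \<V>) (Scale d (Id []))"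
| loop_S: "sb_rel d D \<kappa> [] [] (Cap \<S> \<cdot> Cup \<S>) (Scale D (Id []))"

inductive sb_eq :: "'k::comm_ring_1 \<Rightarrow> 'k \<Rightarrow> 'k \<Rightarrow>
    sb_ob list \<Rightarrow> sb_ob list \<Rightarrow> 'k sb_term \<Rightarrow> 'k sb_term \<Rightarrow> bool"
  for d D \<kappa> :: 'k where
  rel: "sb_rel d D \<kappa> a b f g \<Longrightarrow> sb_eq d D \<kappa> a b f g"
| refl: "sb_typ f a b \<Longrightarrow> sb_eq d D \<kappa> a b f f"
| sym: "sb_eq d D \<kappa> a b f g \<Longrightarrow> sb_eq d D \<kappa> a b g f"
| trans: "sb_eq d D \<kappa> a b f g \<Longrightarrow> sb_eq d D \<kappa> a b g h \<Longrightarrow> sb_eq d D \<kappa> a b f h"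
| cong_comp: "sb_eq d D \<kappa> a b f f' \<Longrightarrow> sb_eq d D \<kappa> b c g g' \<Longrightarrow> sb_eq d D \<kappa> a c (g \<cdot> f) (g' \<cdot> f')"
| cong_tens: "sb_eq d D \<kappa> a b f f' \<Longrightarrow> sb_eq d D \<kappa> a' b' g g' \<Longrightarrow>
    sb_eq d D \<kappa> (a @ a') (b @ b') (f \<boxtimes> g) (f' \<boxtimes> g')"
| cong_plus: "sb_eq d D \<kappa> a b f f' \<Longrightarrow> sb_eq d D \<kappa> a b g g' \<Longrightarrow> sb_eq d D \<kappa> a b (f \<boxplus> g) (f' \<boxplus> g')"
| cong_scale: "sb_eq d D \<kappa> a b f f' \<Longrightarrow> sb_eq d D \<kappa> a b (Scale r f) (Scale r f')"
| id_comp: "sb_typ f a b \<Longrightarrow> sb_eq d D \<kappa> a b (Id b \<cdot> f) f"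
| comp_id: "sb_typ f a b \<Longrightarrow> sb_eq d D \<kappa> a b (f \<cdot> Id a) f"
| comp_assoc: "sb_typ f a b \<Longrightarrow> sb_typ g b c \<Longrightarrow> sb_typ h c x \<Longrightarrow>
    sb_eq d D \<kappa> a x ((h \<cdot> g) \<cdot> f) (h \<cdot> (g \<cdot> f))"
| unit_tens: "sb_typ f a b \<Longrightarrow> sb_eq d D \<kappa> a b (Id [] \<boxtimes> f) f"
| tens_unit: "sb_typ f a b \<Longrightarrow> sb_eq d D \<kappa> a b (f \<boxtimes> Id []) f"
| tens_assoc: "sb_typ f a b \<Longrightarrow> sb_typ g a' b' \<Longrightarrow> sb_typ h a'' b'' \<Longrightarrow>
    sb_eq d D \<kappa> (a @ a' @ a'') (b @ b' @ b'') ((f \<boxtimes> g) \<boxtimes> h) (f \<boxtimes> (g \<boxtimes> h))"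
| tens_id: "sb_eq d D \<kappa> (a @ b) (a @ b) (Id a \<boxtimes> Id b) (Id (a @ b))"
| interchange: "sb_typ f a b \<Longrightarrow> sb_typ g b c \<Longrightarrow> sb_typ f' a' b' \<Longrightarrow> sb_typ g' b' c' \<Longrightarrow>
    sb_eq d D \<kappa> (a @ a') (c @ c') ((g \<boxtimes> g') \<cdot> (f \<boxtimes> f')) ((g \<cdot> f) \<boxtimes> (g' \<cdot> f'))"
| plus_assoc: "sb_typ f a b \<Longrightarrow> sb_typ g a b \<Longrightarrow> sb_typ h a b \<Longrightarrow>
    sb_eq d D \<kappa> a b ((f \<boxplus> g) \<boxplus> h) (f \<boxplus> (g \<boxplus> h))"
| plus_comm: "sb_typ f a b \<Longrightarrow> sb_typ g a b \<Longrightarrow> sb_eq d D \<kappa> a b (f \<boxplus> g) (g \<boxplus> f)"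
| plus_zero: "sb_typ f a b \<Longrightarrow> sb_eq d D \<kappa> a b (f \<boxplus> Zero a b) f"
| plus_neg: "sb_typ f a b \<Longrightarrow> sb_eq d D \<kappa> a b (f \<boxplus> Scale (- 1) f) (Zero a b)"
| scale_one: "sb_typ f a b \<Longrightarrow> sb_eq d D \<kappa> a b (Scale 1 f) f"
| scale_scale: "sb_typ f a b \<Longrightarrow> sb_eq d D \<kappa> a b (Scale r (Scale s f)) (Scale (r * s) f)"
| scale_add: "sb_typ f a b \<Longrightarrow> sb_eq d D \<kappa> a b (Scale (r + s) f) (Scale r f \<boxplus> Scale s f)"
| scale_plus: "sb_typ f a b \<Longrightarrow> sb_typ g a b \<Longrightarrow>
    sb_eq d D \<kappa> a b (Scale r (f \<boxplus> g)) (Scale r f \<boxplus> Scale r g)"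
| plus_comp: "sb_typ f a b \<Longrightarrow> sb_typ g b c \<Longrightarrow> sb_typ h b c \<Longrightarrow>
    sb_eq d D \<kappa> a c ((g \<boxplus> h) \<cdot> f) (g \<cdot> f \<boxplus> h \<cdot> f)"
| comp_plus: "sb_typ f a b \<Longrightarrow> sb_typ g a b \<Longrightarrow> sb_typ h b c \<Longrightarrow>
    sb_eq d D \<kappa> a c (h \<cdot> (f \<boxplus> g)) (h \<cdot> f \<boxplus> h \<cdot> g)"
| scale_comp: "sb_typ f a b \<Longrightarrow> sb_typ g b c \<Longrightarrow> sb_eq d D \<kappa> a c (Scale r g \<cdot> f) (Scale r (g \<cdot> f))"
| comp_scale: "sb_typ f a b \<Longrightarrow> sb_typ g b c \<Longrightarrow> sb_eq d D \<kappa> a c (g \<cdot> Scale r f) (Scale r (g \<cdot> f))"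
| plus_tens: "sb_typ f a b \<Longrightarrow> sb_typ g a b \<Longrightarrow> sb_typ h a' b' \<Longrightarrow>
    sb_eq d D \<kappa> (a @ a') (b @ b') ((f \<boxplus> g) \<boxtimes> h) (f \<boxtimes> h \<boxplus> g \<boxtimes> h)"
| tens_plus: "sb_typ h a b \<Longrightarrow> sb_typ f a' b' \<Longrightarrow> sb_typ g a' b' \<Longrightarrow>
    sb_eq d D \<kappa> (a @ a') (b @ b') (h \<boxtimes> (f \<boxplus> g)) (h \<boxtimes> f \<boxplus> h \<boxtimes> g)"
| scale_tens: "sb_typ f a b \<Longrightarrow> sb_typ g a' b' \<Longrightarrow>
    sb_eq d D \<kappa> (a @ a') (b @ b') (Scale r f \<boxtimes> g) (Scale r (f \<boxtimes> g))"
| tens_scale: "sb_typ f a b \<Longrightarrow> sb_typ g a' b' \<Longrightarrow>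
    sb_eq d D \<kappa> (a @ a') (b @ b') (f \<boxtimes> Scale r g) (Scale r (f \<boxtimes> g))"

definition sb_arrow :: "'k::comm_ring_1 \<Rightarrow> 'k \<Rightarrow> 'k \<Rightarrow>
    sb_ob list \<Rightarrow> sb_ob list \<Rightarrow> 'k sb_term \<Rightarrow> (sb_ob list, 'k sb_term set) arrow" where
  "sb_arrow d D \<kappa> a b f = \<lparr>src = a, tgt = b, amap = {g. sb_eq d D \<kappa> a b f g}\<rparr>"

definition spin_brauer :: "'k::comm_ring_1 \<Rightarrow> 'k \<Rightarrow> 'k \<Rightarrow> ('k, sb_ob list, 'k sb_term set) lmcat" where
  "spin_brauer d D \<kappa> =
    \<lparr>obj = UNIV,
     arr = {sb_arrow d D \<kappa> a b f | a b f. sb_typ f a b},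
     ide = (\<lambda>a. sb_arrow d D \<kappa> a a (Id a)),
     cmp = (\<lambda>g f. \<lparr>src = src f, tgt = tgt g,
       amap = {h. \<exists>u\<in>amap g. \<exists>t\<in>amap f. sb_eq d D \<kappa> (src f) (tgt g) (u \<cdot> t) h}\<rparr>),
     unt = [],
     tenO = (@),
     tenA = (\<lambda>f g. \<lparr>src = src f @ src g, tgt = tgt f @ tgt g,
       amap = {h. \<exists>t\<in>amap f. \<exists>u\<in>amap g. sb_eq d D \<kappa> (src f @ src g) (tgt f @ tgt g) (t \<boxtimes> u) h}\<rparr>),
     addA = (\<lambda>f g. \<lparr>src = src f, tgt = tgt f,
       amap = {h. \<exists>t\<in>amap f. \<exists>u\<in>amap g. sb_eq d D \<kappa> (src f) (tgt f) (t \<boxplus> u) h}\<rparr>),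
     sclA = (\<lambda>r f. \<lparr>src = src f, tgt = tgt f,
       amap = {h. \<exists>t\<in>amap f. sb_eq d D \<kappa> (src f) (tgt f) (Scale r t) h}\<rparr>)\<rparr>"


section \<open>Quadratic spaces and Clifford algebras\<close>

record 'v quad_space =
  vscale :: "complex \<Rightarrow> 'v \<Rightarrow> 'v"
  vform :: "'v \<Rightarrow> 'v \<Rightarrow> complex"

definition quadratic_space :: "'v::ab_group_add quad_space \<Rightarrow> bool" where
  "quadratic_space Q \<longleftrightarrow>
     vector_space (vscale Q) \<and>
     (\<exists>B. finite B \<and> module.span (vscale Q) B = UNIV) \<and>
     (\<forall>v. Vector_Spaces.linear (vscale Q) (*) (vform Q v)) \<and>
     (\<forall>v w. vform Q v w = vform Q w v) \<and>
     (\<forall>v. (\<forall>w. vform Q v w = 0) \<longrightarrow> v = 0)"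

definition qdim :: "'v::ab_group_add quad_space \<Rightarrow> nat" where
  "qdim Q = vector_space.dim (vscale Q) UNIV"

definition orthonormal_basis :: "'v::ab_group_add quad_space \<Rightarrow> (nat \<Rightarrow> 'v) \<Rightarrow> bool" where
  "orthonormal_basis Q e \<longleftrightarrow>
     module.span (vscale Q) (e ` {1..qdim Q}) = UNIV \<and>
     (\<forall>i\<in>{1..qdim Q}. \<forall>j\<in>{1..qdim Q}. vform Q (e i) (e j) = (if i = j then 1 else 0))"

text \<open>The free monoid on a set, as the index monoid of the free algebra.\<close>

instantiation list :: (type) monoid_add
begin
definition zero_list :: "'a list" where "zero_list = []"
definition plus_list :: "'a list \<Rightarrow> 'a list \<Rightarrow> 'a list" where "plus_list = (@)"
instance by standard (simp_all add: zero_list_def plus_list_def)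
end

text \<open>\<open>free_alg\<close> is the free algebra on the underlying \<^emph>\<open>set\<close> of \<open>V\<close>. Its quotient by the first two
  families of relations in \<open>cl_rels\<close> is the tensor algebra \<open>T(V)\<close>; the third family consists of the
  Clifford relations.\<close>

definition free_alg :: "('v list \<Rightarrow>\<^sub>0 complex) ring" where
  "free_alg = \<lparr>carrier = UNIV, mult = (*), one = 1, zero = 0, add = (+)\<rparr>"

definition cl_rels :: "'v::ab_group_add quad_space \<Rightarrow> ('v list \<Rightarrow>\<^sub>0 complex) set" where
  "cl_rels Q =
     {Poly_Mapping.single [v + w] 1 - Poly_Mapping.single [v] 1 - Poly_Mapping.single [w] 1 | v w. True} \<union>
     {Poly_Mapping.single [vscale Q c v] 1 - Poly_Mapping.single [v] c | c v. True} \<union>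
     {Poly_Mapping.single [v, w] 1 + Poly_Mapping.single [w, v] 1
        - Poly_Mapping.single [] (2 * vform Q v w) | v w. True}"

type_synonym 'v cl = "('v list \<Rightarrow>\<^sub>0 complex) set"

definition Cl :: "'v::ab_group_add quad_space \<Rightarrow> 'v cl ring" where
  "Cl Q = free_alg Quot (Idl\<^bsub>free_alg\<^esub> (cl_rels Q))"

definition cl_class :: "'v::ab_group_add quad_space \<Rightarrow> ('v list \<Rightarrow>\<^sub>0 complex) \<Rightarrow> 'v cl" where
  "cl_class Q a = (Idl\<^bsub>free_alg\<^esub> (cl_rels Q)) +>\<^bsub>free_alg\<^esub> a"

definition cl_vec :: "'v::ab_group_add quad_space \<Rightarrow> 'v \<Rightarrow> 'v cl" where
  "cl_vec Q v = cl_class Q (Poly_Mapping.single [v] 1)"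

definition cl_scale :: "'v::ab_group_add quad_space \<Rightarrow> complex \<Rightarrow> 'v cl \<Rightarrow> 'v cl" where
  "cl_scale Q c x = cl_class Q (Poly_Mapping.single [] c) \<otimes>\<^bsub>Cl Q\<^esub> x"

definition cl_even :: "'v::ab_group_add quad_space \<Rightarrow> 'v cl set" where
  "cl_even Q = cl_class Q ` {a. \<forall>w\<in>Poly_Mapping.keys a. even (length w)}"

definition cl_odd :: "'v::ab_group_add quad_space \<Rightarrow> 'v cl set" where
  "cl_odd Q = cl_class Q ` {a. \<forall>w\<in>Poly_Mapping.keys a. odd (length w)}"

definition cl_iota :: "'v::ab_group_add quad_space \<Rightarrow> 'v cl \<Rightarrow> 'v cl" where
  "cl_iota Q = (THE f. f \<in> carrier (Cl Q) \<rightarrow>\<^sub>E carrier (Cl Q) \<and>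
     bij_betw f (carrier (Cl Q)) (carrier (Cl Q)) \<and>
     (\<forall>x\<in>carrier (Cl Q). \<forall>y\<in>carrier (Cl Q).
        f (x \<oplus>\<^bsub>Cl Q\<^esub> y) = f x \<oplus>\<^bsub>Cl Q\<^esub> f y \<and> f (x \<otimes>\<^bsub>Cl Q\<^esub> y) = f y \<otimes>\<^bsub>Cl Q\<^esub> f x) \<and>
     (\<forall>c. \<forall>x\<in>carrier (Cl Q). f (cl_scale Q c x) = cl_scale Q c (f x)) \<and>
     f \<one>\<^bsub>Cl Q\<^esub> = \<one>\<^bsub>Cl Q\<^esub> \<and>
     (\<forall>v. f (cl_vec Q v) = cl_vec Q v))"

definition Pin :: "'v::ab_group_add quad_space \<Rightarrow> 'v cl set" where
  "Pin Q = {g \<in> Units (Cl Q). g \<in> cl_even Q \<union> cl_odd Q \<and>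
     (\<lambda>x. g \<otimes>\<^bsub>Cl Q\<^esub> x \<otimes>\<^bsub>Cl Q\<^esub> inv\<^bsub>Cl Q\<^esub> g) ` range (cl_vec Q) = range (cl_vec Q) \<and>
     g \<otimes>\<^bsub>Cl Q\<^esub> cl_iota Q g = \<one>\<^bsub>Cl Q\<^esub>}"

definition Spin :: "'v::ab_group_add quad_space \<Rightarrow> 'v cl set" where
  "Spin Q = Pin Q \<inter> cl_even Q"

definition GV :: "'v::ab_group_add quad_space \<Rightarrow> 'v cl set" where
  "GV Q = (if even (qdim Q) then Pin Q else Spin Q)"


section \<open>Modules of the algebraic group\<close>

definition fscale :: "complex \<Rightarrow> ('a \<Rightarrow> complex) \<Rightarrow> 'a \<Rightarrow> complex" where
  "fscale c f = (\<lambda>x. c * f x)"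

definition lin_maps :: "(complex \<Rightarrow> 'a::ab_group_add \<Rightarrow> 'a) \<Rightarrow> (complex \<Rightarrow> 'b::ab_group_add \<Rightarrow> 'b) \<Rightarrow>
    'a set \<Rightarrow> 'b set \<Rightarrow> ('a \<Rightarrow> 'b) set" where
  "lin_maps s t A B = {f \<in> A \<rightarrow>\<^sub>E B.
     (\<forall>x\<in>A. \<forall>y\<in>A. f (x + y) = f x + f y) \<and> (\<forall>c. \<forall>x\<in>A. f (s c x) = t c (f x))}"

text \<open>\<open>GV Q\<close> is Zariski closed in the finite-dimensional vector space \<open>Cl Q\<close>: on it \<open>inv g\<close> equals
  \<open>cl_iota Q g\<close>, so all its defining conditions are polynomial. Its regular functions are therefore
  the restrictions of the polynomial functions on \<open>Cl Q\<close>.\<close>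

inductive_set cl_poly :: "'v::ab_group_add quad_space \<Rightarrow> ('v cl \<Rightarrow> complex) set"
  for Q :: "'v quad_space" where
  const: "(\<lambda>_. c) \<in> cl_poly Q"
| functional: "(\<And>x y. x \<in> carrier (Cl Q) \<Longrightarrow> y \<in> carrier (Cl Q) \<Longrightarrow> l (x \<oplus>\<^bsub>Cl Q\<^esub> y) = l x + l y) \<Longrightarrow>
    (\<And>c x. x \<in> carrier (Cl Q) \<Longrightarrow> l (cl_scale Q c x) = c * l x) \<Longrightarrow> l \<in> cl_poly Q"
| plus: "p \<in> cl_poly Q \<Longrightarrow> q \<in> cl_poly Q \<Longrightarrow> (\<lambda>x. p x + q x) \<in> cl_poly Q"
| times: "p \<in> cl_poly Q \<Longrightarrow> q \<in> cl_poly Q \<Longrightarrow> (\<lambda>x. p x * q x) \<in> cl_poly Q"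

definition regular_on_GV :: "'v::ab_group_add quad_space \<Rightarrow> ('v cl \<Rightarrow> complex) \<Rightarrow> bool" where
  "regular_on_GV Q f \<longleftrightarrow> (\<exists>p\<in>cl_poly Q. \<forall>g\<in>GV Q. f g = p g)"

text \<open>To have a strictly associative tensor product, the underlying space of a module is taken inside
  the space of arrays of some fixed rank \<open>k\<close>, i.e. of functions on the words of length \<open>k\<close> in an
  infinite index set. The product \<open>\<star>\<close> is concatenation of arrays (the product of the completed free
  algebra): \<open>(s \<star> t) (u @ w) = s u * t w\<close> if \<open>s\<close> and \<open>t\<close> have ranks \<open>length u\<close> and \<open>length w\<close>. For
  spaces \<open>A\<close> and \<open>B\<close> of arrays of fixed ranks, the span of all \<open>s \<star> t\<close> is a tensor product of \<open>A\<close>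
  and \<open>B\<close>. Every finite-dimensional space is isomorphic to a space of arrays (of rank 1, say), so up
  to isomorphism no module is left out. \<open>IV i\<close> will index the i-th coordinate of \<open>V\<close>, and \<open>IS I\<close> the
  coordinate of \<open>S\<close> at \<open>x\<^sub>I\<close>.\<close>

datatype ix = IV nat | IS "nat set"

type_synonym array = "ix list \<Rightarrow> complex"

definition aprod :: "array \<Rightarrow> array \<Rightarrow> array" (infixr "\<star>" 70) where
  "s \<star> t = (\<lambda>w. \<Sum>i\<le>length w. s (take i w) * t (drop i w))"

definition aone :: array where
  "aone = (\<lambda>w. if w = [] then 1 else 0)"

definition aten :: "array set \<Rightarrow> array set \<Rightarrow> array set" where
  "aten A B = module.span fscale {s \<star> t | s t. s \<in> A \<and> t \<in> B}"

definition map_tensor :: "array set \<Rightarrow> array set \<Rightarrow> (array \<Rightarrow> array) \<Rightarrow> (array \<Rightarrow> array) \<Rightarrow> array \<Rightarrow> array"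
  where "map_tensor A B f g = (THE h. h \<in> lin_maps fscale fscale (aten A B) UNIV \<and>
    (\<forall>s\<in>A. \<forall>t\<in>B. h (s \<star> t) = f s \<star> g t))"

record 'g gmod =
  rank :: nat
  car :: "array set"
  act :: "'g \<Rightarrow> array \<Rightarrow> array"

definition is_GV_module :: "'v::ab_group_add quad_space \<Rightarrow> 'v cl gmod \<Rightarrow> bool" where
  "is_GV_module Q M \<longleftrightarrow>
     (\<forall>t\<in>car M. \<forall>w. t w \<noteq> 0 \<longrightarrow> length w = rank M) \<and>
     (\<exists>B. finite B \<and> car M = module.span fscale B) \<and>
     act M \<in> GV Q \<rightarrow>\<^sub>E lin_maps fscale fscale (car M) (car M) \<and>
     (\<forall>t\<in>car M. act M \<one>\<^bsub>Cl Q\<^esub> t = t) \<and>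
     (\<forall>g\<in>GV Q. \<forall>h\<in>GV Q. \<forall>t\<in>car M. act M (g \<otimes>\<^bsub>Cl Q\<^esub> h) t = act M g (act M h t)) \<and>
     (\<forall>l\<in>lin_maps fscale (*) (car M) UNIV. \<forall>t\<in>car M. regular_on_GV Q (\<lambda>g. l (act M g t)))"

definition unit_module :: "'v::ab_group_add quad_space \<Rightarrow> 'v cl gmod" where
  "unit_module Q = \<lparr>rank = 0, car = range (\<lambda>c. fscale c aone),
     act = (\<lambda>g\<in>GV Q. \<lambda>t\<in>range (\<lambda>c. fscale c aone). t)\<rparr>"

definition tensor_module :: "'v::ab_group_add quad_space \<Rightarrow> 'v cl gmod \<Rightarrow> 'v cl gmod \<Rightarrow> 'v cl gmod" where
  "tensor_module Q M L = \<lparr>rank = rank M + rank L, car = aten (car M) (car L),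
     act = (\<lambda>g\<in>GV Q. map_tensor (car M) (car L) (act M g) (act L g))\<rparr>"

definition GV_mod :: "'v::ab_group_add quad_space \<Rightarrow> (complex, 'v cl gmod, array \<Rightarrow> array) lmcat" where
  "GV_mod Q =
    \<lparr>obj = {M. is_GV_module Q M},
     arr = {f. is_GV_module Q (src f) \<and> is_GV_module Q (tgt f) \<and>
       amap f \<in> lin_maps fscale fscale (car (src f)) (car (tgt f)) \<and>
       (\<forall>g\<in>GV Q. \<forall>t\<in>car (src f). amap f (act (src f) g t) = act (tgt f) g (amap f t))},
     ide = (\<lambda>M. \<lparr>src = M, tgt = M, amap = (\<lambda>t\<in>car M. t)\<rparr>),
     cmp = (\<lambda>g f. \<lparr>src = src f, tgt = tgt g, amap = (\<lambda>t\<in>car (src f). amap g (amap f t))\<rparr>),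
     unt = unit_module Q,
     tenO = tensor_module Q,
     tenA = (\<lambda>f g. \<lparr>src = tensor_module Q (src f) (src g), tgt = tensor_module Q (tgt f) (tgt g),
       amap = map_tensor (car (src f)) (car (src g)) (amap f) (amap g)\<rparr>),
     addA = (\<lambda>f g. \<lparr>src = src f, tgt = tgt f, amap = (\<lambda>t\<in>car (src f). amap f t + amap g t)\<rparr>),
     sclA = (\<lambda>c f. \<lparr>src = src f, tgt = tgt f, amap = (\<lambda>t\<in>car (src f). fscale c (amap f t))\<rparr>)\<rparr>"


section \<open>The spin module and the vector module\<close>

text \<open>An element \<open>x\<close> of the exterior algebra \<open>S\<close> is represented by its coefficients: \<open>x I\<close> is the
  coefficient of \<open>x\<^sub>I\<close>.\<close>

definition spin_space :: "nat \<Rightarrow> (nat set \<Rightarrow> complex) set" where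
  "spin_space n = {x. \<forall>I. x I \<noteq> 0 \<longrightarrow> I \<subseteq> {1..n}}"

definition spin_basis :: "nat set \<Rightarrow> nat set \<Rightarrow> complex" where
  "spin_basis I = (\<lambda>J. if J = I then 1 else 0)"

definition inversions :: "nat set \<Rightarrow> nat set \<Rightarrow> nat" where
  "inversions I J = card {(i, j) \<in> I \<times> J. i > j}"

text \<open>Determined by \<open>x\<^sub>I \<and> x\<^sub>J = (-1)^(inversions I J) x\<^sub>I\<^sub>\<union>\<^sub>J\<close> if \<open>I\<close> and \<open>J\<close> are disjoint, and \<open>0\<close>
  otherwise.\<close>

definition wedge :: "(nat set \<Rightarrow> complex) \<Rightarrow> (nat set \<Rightarrow> complex) \<Rightarrow> nat set \<Rightarrow> complex" where
  "wedge x y = (\<lambda>K. \<Sum>I\<in>Pow K. (- 1) ^ inversions I (K - I) * x I * y (K - I))"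

definition psi :: "'v::ab_group_add quad_space \<Rightarrow> (nat \<Rightarrow> 'v) \<Rightarrow> nat \<Rightarrow> 'v" where
  "psi Q e j = vscale Q (1/2) (e (2 * j - 1) + vscale Q \<i> (e (2 * j)))"

definition psi_dag :: "'v::ab_group_add quad_space \<Rightarrow> (nat \<Rightarrow> 'v) \<Rightarrow> nat \<Rightarrow> 'v" where
  "psi_dag Q e j = vscale Q (1/2) (e (2 * j - 1) - vscale Q \<i> (e (2 * j)))"

definition is_spin_action :: "'v::ab_group_add quad_space \<Rightarrow> (nat \<Rightarrow> 'v) \<Rightarrow> complex \<Rightarrow>
    ('v cl \<Rightarrow> (nat set \<Rightarrow> complex) \<Rightarrow> nat set \<Rightarrow> complex) \<Rightarrow> bool" where
  "is_spin_action Q e \<epsilon> \<rho> \<longleftrightarrow>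
    (let n = qdim Q div 2; S = spin_space n in
     \<rho> \<in> carrier (Cl Q) \<rightarrow>\<^sub>E lin_maps fscale fscale S S \<and>
     (\<forall>x\<in>S. \<rho> \<one>\<^bsub>Cl Q\<^esub> x = x) \<and>
     (\<forall>a\<in>carrier (Cl Q). \<forall>b\<in>carrier (Cl Q). \<forall>x\<in>S.
        \<rho> (a \<oplus>\<^bsub>Cl Q\<^esub> b) x = \<rho> a x + \<rho> b x \<and> \<rho> (a \<otimes>\<^bsub>Cl Q\<^esub> b) x = \<rho> a (\<rho> b x)) \<and>
     (\<forall>c. \<forall>a\<in>carrier (Cl Q). \<forall>x\<in>S. \<rho> (cl_scale Q c a) x = fscale c (\<rho> a x)) \<and>
     (\<forall>i\<in>{1..n}. \<forall>I. I \<subseteq> {1..n} \<longrightarrow>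
        \<rho> (cl_vec Q (psi_dag Q e i)) (spin_basis I) = wedge (spin_basis {i}) (spin_basis I) \<and>
        \<rho> (cl_vec Q (psi Q e i)) (spin_basis I) =
          (if i \<in> I then fscale ((- 1) ^ card {j\<in>I. j < i}) (spin_basis (I - {i})) else 0)) \<and>
     (odd (qdim Q) \<longrightarrow> (\<forall>I. I \<subseteq> {1..n} \<longrightarrow>
        \<rho> (cl_vec Q (e (qdim Q))) (spin_basis I) = fscale (\<epsilon> * (- 1) ^ card I) (spin_basis I))))"

definition spin_action :: "'v::ab_group_add quad_space \<Rightarrow> (nat \<Rightarrow> 'v) \<Rightarrow> complex \<Rightarrow>
    'v cl \<Rightarrow> (nat set \<Rightarrow> complex) \<Rightarrow> nat set \<Rightarrow> complex" where
  "spin_action Q e \<epsilon> = (THE \<rho>. is_spin_action Q e \<epsilon> \<rho>)"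

definition vec_action :: "'v::ab_group_add quad_space \<Rightarrow> 'v cl \<Rightarrow> 'v \<Rightarrow> 'v" where
  "vec_action Q g v =
     (THE w. cl_vec Q w = g \<otimes>\<^bsub>Cl Q\<^esub> cl_vec Q v \<otimes>\<^bsub>Cl Q\<^esub> inv\<^bsub>Cl Q\<^esub> g)"

text \<open>\<open>S\<close> and \<open>V\<close> are placed among the arrays of rank 1 by their coordinates with respect to the
  \<open>x\<^sub>I\<close> and to the orthonormal basis \<open>e\<close>, and their actions are transported along these injections.\<close>

definition spin_arr :: "(nat set \<Rightarrow> complex) \<Rightarrow> array" where
  "spin_arr x = (\<lambda>w. case w of [IS I] \<Rightarrow> x I | _ \<Rightarrow> 0)"

definition vec_arr :: "'v::ab_group_add quad_space \<Rightarrow> (nat \<Rightarrow> 'v) \<Rightarrow> 'v \<Rightarrow> array" where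
  "vec_arr Q e v = (\<lambda>w. case w of [IV i] \<Rightarrow> if i \<in> {1..qdim Q} then vform Q (e i) v else 0 | _ \<Rightarrow> 0)"

definition spin_module :: "'v::ab_group_add quad_space \<Rightarrow> (nat \<Rightarrow> 'v) \<Rightarrow> complex \<Rightarrow> 'v cl gmod" where
  "spin_module Q e \<epsilon> = (let S = spin_space (qdim Q div 2) in
     \<lparr>rank = 1, car = spin_arr ` S,
      act = (\<lambda>g\<in>GV Q. \<lambda>t\<in>spin_arr ` S. spin_arr (spin_action Q e \<epsilon> g (inv_into S spin_arr t)))\<rparr>)"

definition vector_module :: "'v::ab_group_add quad_space \<Rightarrow> (nat \<Rightarrow> 'v) \<Rightarrow> 'v cl gmod" where
  "vector_module Q e =
     \<lparr>rank = 1, car = range (vec_arr Q e),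
      act = (\<lambda>g\<in>GV Q. \<lambda>t\<in>range (vec_arr Q e). vec_arr Q e (vec_action Q g (inv_into UNIV (vec_arr Q e) t)))\<rparr>"

definition spin_form :: "nat \<Rightarrow> (nat set \<Rightarrow> complex) \<Rightarrow> (nat set \<Rightarrow> complex) \<Rightarrow> complex" where
  "spin_form N x y = (let n = N div 2 in
     \<Sum>I\<in>Pow {1..n}. (- 1) ^ ((card I choose 2) + n * N * card I + inversions I ({1..n} - I))
       * x I * y ({1..n} - I))"

definition left_dual :: "('a \<Rightarrow> 'a \<Rightarrow> complex) \<Rightarrow> 'a set \<Rightarrow> 'a set \<Rightarrow> 'a \<Rightarrow> 'a" where
  "left_dual \<phi> U B x = (THE x'. x' \<in> U \<and> (\<forall>y\<in>B. \<phi> x' y = (if x = y then 1 else 0)))"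

definition basis_of :: "(complex \<Rightarrow> 'a::ab_group_add \<Rightarrow> 'a) \<Rightarrow> 'a set \<Rightarrow> 'a set \<Rightarrow> bool" where
  "basis_of s U B \<longleftrightarrow> \<not> module.dependent s B \<and> module.span s B = U"

text \<open>The prescribed values of a functor on the generating objects and morphisms. \<open>gen a b f\<close> stands
  for the arrow of the spin Brauer category given by the term \<open>f\<close>. A linear map on a tensor product
  is described by its values on pure tensors.\<close>

definition generator_values :: "'v::ab_group_add quad_space \<Rightarrow> (nat \<Rightarrow> 'v) \<Rightarrow> complex \<Rightarrow>
    (sb_ob list \<Rightarrow> sb_ob list \<Rightarrow> complex sb_term \<Rightarrow> (sb_ob list, complex sb_term set) arrow) \<Rightarrow>
    (sb_ob list, complex sb_term set, 'v cl gmod, array \<Rightarrow> array) functor_data \<Rightarrow> bool" where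
  "generator_values Q e \<epsilon> gen F \<longleftrightarrow>
    (let N = qdim Q; n = N div 2; \<sigma> = (- 1) ^ ((n choose 2) + n * N);
         U = spin_space n; s = spin_arr; v = vec_arr Q e;
         F\<^sub>1 = (\<lambda>a b f. amap (fmor F (gen a b f))) in
     fobj F [\<S>] = spin_module Q e \<epsilon> \<and>
     fobj F [\<V>] = vector_module Q e \<and>
     (\<forall>x\<in>U. \<forall>y\<in>U. F\<^sub>1 [\<S>, \<S>] [] (Cap \<S>) (s x \<star> s y) = fscale (spin_form N x y) aone) \<and>
     (\<forall>p q. F\<^sub>1 [\<V>, \<V>] [] (Cap \<V>) (v p \<star> v q) = fscale (vform Q p q) aone) \<and>
     (\<forall>p. \<forall>x\<in>U. F\<^sub>1 [\<V>, \<S>] [\<S>] Mu (v p \<star> s x) = s (spin_action Q e \<epsilon> (cl_vec Q p) x)) \<and>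
     (\<forall>x\<in>U. \<forall>y\<in>U. F\<^sub>1 [\<S>, \<S>] [\<S>, \<S>] (Swap \<S> \<S>) (s x \<star> s y) = fscale \<sigma> (s y \<star> s x)) \<and>
     (\<forall>x\<in>U. \<forall>p. F\<^sub>1 [\<S>, \<V>] [\<V>, \<S>] (Swap \<S> \<V>) (s x \<star> v p) = v p \<star> s x) \<and>
     (\<forall>p. \<forall>x\<in>U. F\<^sub>1 [\<V>, \<S>] [\<S>, \<V>] (Swap \<V> \<S>) (v p \<star> s x) = s x \<star> v p) \<and>
     (\<forall>p q. F\<^sub>1 [\<V>, \<V>] [\<V>, \<V>] (Swap \<V> \<V>) (v p \<star> v q) = v q \<star> v p))"

end

theory Submission
  imports Defs
begin

text \<open>Words in \<open>\<S>\<close>, \<open>\<V>\<close> are sent to modules whose underlying space consists of all arrays supported on a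
  finite set of words, so a morphism between them is determined by its values on pure tensors, and every
  relation of the spin Brauer category can be checked there. The spin module is realised by operators on
  functions of a subset of \<open>[n]\<close>, and everything rests on \<open>\<Phi>\<^sub>S(v x, y) = (-1)\<^bsup>n N\<^esup> \<Phi>\<^sub>S(x, v y)\<close>: together with
  \<open>g \<iota>(g) = 1\<close> it makes \<open>\<Phi>\<^sub>S\<close> invariant under \<open>G(V)\<close> (an odd \<open>g\<close> occurs only for even \<open>N\<close>, where the sign is 1),
  and it is also what the relations that move \<open>\<mu>\<close> across \<open>\<inter>\<^sub>S\<close> and \<open>\<union>\<^sub>S\<close> amount to. Since a nondegenerate form
  admits only one copairing that satisfies a zigzag identity, the values on the cups are forced, invariant,
  and independent of the basis used to write them.\<close>

section \<open>Arrays supported on finite sets of words\<close>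

text \<open>The functor is strict, so the tensor product of modules has to be associative and unital
  as an equality of records. Concatenation provides this: the module of a tensor word is the space
  of all arrays supported on a set of words of one length, and both these sets and the actions
  (extensional maps, fixed by their values on delta arrays) can be compared literally. What has to
  be known about Cl(V), a bare quotient of a free algebra, is read off from its action on S. The
  coefficient of the vacuum x_{} in (v w + w v) x_{} is 2 \<Phi>_V(v, w); hence V embeds in Cl(V),
  conjugation by g preserves \<Phi>_V, and the matrix entries of g on V are polynomials in those of
  g and \<iota>(g) on S. The constants come from two signs. \<Phi>_S(y, x) = \<sigma> \<Phi>_S(x, y)
  explains the factor \<sigma> in the image of the swap of S with itself, and makes the S-loop equal
  to \<sigma> 2^n. The adjunction sign \<kappa> = (-1)^(n N) is what rotating \<mu> around S
  produces.\<close>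

global_interpretation fscale: vector_space "fscale :: complex \<Rightarrow> ('a \<Rightarrow> complex) \<Rightarrow> 'a \<Rightarrow> complex"
  by unfold_locales (auto simp: fscale_def algebra_simps)

lemma fscale_apply [simp]: "fscale c f x = c * f x"
  by (simp add: fscale_def)

lemma sum_fun_apply [simp]: "sum f A x = (\<Sum>i\<in>A. f i x)"
  for f :: "'b \<Rightarrow> 'a \<Rightarrow> 'c::comm_monoid_add"
  by (induction A rule: infinite_finite_induct) auto

lemma fun_diff_apply [simp]: "(f - g) x = f x - g x" for f g :: "'a \<Rightarrow> 'b::group_add"
  by (simp add: fun_diff_def)

definition supp_on :: "'a set \<Rightarrow> ('a \<Rightarrow> complex) set" where
  "supp_on W = {t. \<forall>w. t w \<noteq> 0 \<longrightarrow> w \<in> W}"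

definition dlt :: "'a \<Rightarrow> 'a \<Rightarrow> complex" where
  "dlt w = (\<lambda>u. if u = w then 1 else 0)"

lemma dlt_apply: "dlt w u = (if u = w then 1 else 0)"
  by (simp add: dlt_def)

lemma supp_onD: "t \<in> supp_on W \<Longrightarrow> w \<notin> W \<Longrightarrow> t w = 0"
  by (auto simp: supp_on_def)

lemma supp_onI: "(\<And>w. w \<notin> W \<Longrightarrow> t w = 0) \<Longrightarrow> t \<in> supp_on W"
  by (auto simp: supp_on_def)

lemma supp_on_dlt [simp, intro]: "w \<in> W \<Longrightarrow> dlt w \<in> supp_on W"
  by (auto simp: supp_on_def dlt_apply)

lemma dlt_in_supp_on_iff [simp]: "dlt w \<in> supp_on W \<longleftrightarrow> w \<in> W"
  by (auto simp: supp_on_def dlt_apply)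

lemma supp_on_zero [simp, intro]: "0 \<in> supp_on W"
  by (auto simp: supp_on_def)

lemma supp_on_add [simp, intro]: "s \<in> supp_on W \<Longrightarrow> t \<in> supp_on W \<Longrightarrow> s + t \<in> supp_on W"
  by (force simp: supp_on_def)

lemma supp_on_scale [simp, intro]: "t \<in> supp_on W \<Longrightarrow> fscale c t \<in> supp_on W"
  by (force simp: supp_on_def)

lemma supp_on_sum [intro]: "(\<And>i. i \<in> A \<Longrightarrow> f i \<in> supp_on W) \<Longrightarrow> sum f A \<in> supp_on W"
  by (induction A rule: infinite_finite_induct) auto

lemma supp_on_subspace: "fscale.subspace (supp_on W)"
  by (auto simp: fscale.subspace_def)

lemma supp_on_expand:
  assumes "finite W" and "t \<in> supp_on W"
  shows "t = (\<Sum>w\<in>W. fscale (t w) (dlt w))"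
proof
  fix u
  have "(\<Sum>w\<in>W. t w * (if u = w then 1 else 0)) = (if u \<in> W then t u else 0)"
    using assms(1) by (simp add: if_distrib cong: if_cong)
  then show "t u = (\<Sum>w\<in>W. fscale (t w) (dlt w)) u"
    using assms(2) by (auto simp: dlt_apply supp_onD)
qed

lemma span_dlt: "finite W \<Longrightarrow> fscale.span (dlt ` W) = supp_on W"
proof (rule antisym)
  show "fscale.span (dlt ` W) \<subseteq> supp_on W"
    by (rule fscale.span_minimal) (auto simp: supp_on_subspace)
  show "supp_on W \<subseteq> fscale.span (dlt ` W)" if "finite W"
  proof
    fix t assume "t \<in> supp_on W"
    from supp_on_expand[OF that this] show "t \<in> fscale.span (dlt ` W)"
      by (metis (no_types, lifting) fscale.span_sum fscale.span_scale fscale.span_base imageI)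
  qed
qed

subsection \<open>Linear maps on such spaces\<close>

lemma lin_mapsI:
  assumes "f \<in> extensional A" "\<And>x. x \<in> A \<Longrightarrow> f x \<in> B"
    "\<And>x y. x \<in> A \<Longrightarrow> y \<in> A \<Longrightarrow> f (x + y) = f x + f y"
    "\<And>c x. x \<in> A \<Longrightarrow> f (s c x) = t c (f x)"
  shows "f \<in> lin_maps s t A B"
  using assms by (auto simp: lin_maps_def PiE_def)

lemma
  assumes "f \<in> lin_maps s t A B"
  shows lin_maps_in: "x \<in> A \<Longrightarrow> f x \<in> B"
    and lin_maps_ext: "f \<in> extensional A"
    and lin_maps_add: "x \<in> A \<Longrightarrow> y \<in> A \<Longrightarrow> f (x + y) = f x + f y"
    and lin_maps_scale: "x \<in> A \<Longrightarrow> f (s c x) = t c (f x)"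
  using assms by (auto simp: lin_maps_def PiE_def)

lemma lin_maps_restrict:
  assumes "f \<in> lin_maps s t A B" "\<And>x. x \<in> A \<Longrightarrow> f x = g x"
  shows "f = restrict g A"
  using lin_maps_ext[OF assms(1)] assms(2) by (auto simp: extensional_def restrict_def)

context
  fixes t :: "complex \<Rightarrow> 'b \<Rightarrow> 'b::ab_group_add" and f :: "('a \<Rightarrow> complex) \<Rightarrow> 'b"
    and W :: "'a set" and B :: "'b set"
  assumes t: "vector_space t"
    and f: "f \<in> lin_maps fscale t (supp_on W) B"
begin

lemma lin_maps_zero: "f 0 = 0"
proof -
  interpret t: vector_space t by (fact t)
  have "f (fscale 0 0) = t 0 (f 0)"
    by (rule lin_maps_scale[OF f]) auto
  then show ?thesis by simp
qed

lemma lin_maps_sum: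
  "(\<And>i. i \<in> I \<Longrightarrow> x i \<in> supp_on W) \<Longrightarrow> f (\<Sum>i\<in>I. fscale (c i) (x i)) = (\<Sum>i\<in>I. t (c i) (f (x i)))"
proof (induction I rule: infinite_finite_induct)
  case (insert i I)
  have "f (\<Sum>j\<in>insert i I. fscale (c j) (x j)) = f (fscale (c i) (x i) + (\<Sum>j\<in>I. fscale (c j) (x j)))"
    using insert.hyps by simp
  also have "\<dots> = f (fscale (c i) (x i)) + f (\<Sum>j\<in>I. fscale (c j) (x j))"
    by (rule lin_maps_add[OF f]) (use insert.prems in \<open>auto intro!: supp_on_sum\<close>)
  finally show ?case
    using insert lin_maps_scale[OF f, of "x i" "c i"]
    by (simp del: plus_fun_apply zero_fun_apply fscale_apply sum_fun_apply)
qed (simp_all add: lin_maps_zero del: plus_fun_apply zero_fun_apply fscale_apply sum_fun_apply)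

lemma lin_maps_expand:
  "finite W \<Longrightarrow> x \<in> supp_on W \<Longrightarrow> f x = (\<Sum>w\<in>W. t (x w) (f (dlt w)))"
  by (subst supp_on_expand) (auto simp: lin_maps_sum)

end

text \<open>Maps in \<open>lin_maps\<close> are \<open>undefined\<close> off their domain, so
  agreement on the delta arrays is equality of functions. Later equalities of actions and of arrows
  are reduced to this.\<close>

lemma lin_maps_eqI:
  fixes W :: "'a set"
  assumes t: "vector_space t"
    and f: "f \<in> lin_maps fscale t (supp_on W) B" and g: "g \<in> lin_maps fscale t (supp_on W) B'"
    and W: "finite W" and eq: "\<And>w. w \<in> W \<Longrightarrow> f (dlt w) = g (dlt w)"
  shows "f = g"
proof (rule extensionalityI[OF lin_maps_ext[OF f] lin_maps_ext[OF g]])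
  fix x assume "x \<in> supp_on W"
  then show "f x = g x"
    using lin_maps_expand[OF t f W] lin_maps_expand[OF t g W] eq by simp
qed

lemma lin_maps_mono: "f \<in> lin_maps s t A B \<Longrightarrow> (\<And>x. x \<in> A \<Longrightarrow> f x \<in> C) \<Longrightarrow> f \<in> lin_maps s t A C"
  by (auto simp: lin_maps_def PiE_def)

lemma vector_space_complex_mult: "vector_space ((*) :: complex \<Rightarrow> complex \<Rightarrow> complex)"
  by unfold_locales (auto simp: algebra_simps)

subsection \<open>Concatenation of arrays\<close>

text \<open>Among all cuts of \<open>u @ v\<close> only the one at \<open>length u\<close> survives,
  because \<open>s\<close> vanishes on words of any other length.\<close>

lemma aprod_append:
  assumes "\<And>w. s w \<noteq> 0 \<Longrightarrow> length w = length u"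
  shows "(s \<star> t) (u @ v) = s u * t v"
proof -
  have "(s \<star> t) (u @ v) = (\<Sum>i\<le>length (u @ v). if i = length u then s u * t v else 0)"
    unfolding aprod_def
  proof (rule sum.cong)
    fix i assume "i \<in> {..length (u @ v)}"
    then have "s (take i (u @ v)) = 0" if "i \<noteq> length u"
      using assms[of "take i (u @ v)"] that by (metis atMost_iff length_take min_absorb2)
    then show "s (take i (u @ v)) * t (drop i (u @ v)) = (if i = length u then s u * t v else 0)"
      by auto
  qed simp
  then show ?thesis by simp
qed

lemma dlt_aprod: "dlt u \<star> dlt v = dlt (u @ v)"
proof
  fix w
  have eq: "dlt u (take i w) * dlt v (drop i w) = (if i = length u then dlt (u @ v) w else 0)"
    if "i \<le> length w" for i
  proof (cases "i = length u")
    case True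
    have "(w = u @ v) = (take i w = u \<and> drop i w = v)"
      unfolding True by (metis append_eq_conv_conj append_take_drop_id)
    then show ?thesis using True by (simp add: dlt_apply)
  next
    case False
    with that have "take i w \<noteq> u" by auto
    then show ?thesis using False by (simp add: dlt_apply)
  qed
  have "length u \<le> length w" if "w = u @ v" using that by simp
  then have "(\<Sum>i\<le>length w. if i = length u then dlt (u @ v) w else 0) = dlt (u @ v) w"
    by (auto simp: dlt_apply)
  then show "(dlt u \<star> dlt v) w = dlt (u @ v) w"
    unfolding aprod_def using eq by simp
qed

lemma aprod_add_left: "(s + s') \<star> t = s \<star> t + s' \<star> t"
  and aprod_add_right: "s \<star> (t + t') = s \<star> t + s \<star> t'"
  and aprod_scale_left: "fscale c s \<star> t = fscale c (s \<star> t)"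
  and aprod_scale_right: "s \<star> fscale c t = fscale c (s \<star> t)"
  by (auto simp: aprod_def fun_eq_iff algebra_simps sum.distrib sum_distrib_left)

lemma aprod_zero_left [simp]: "0 \<star> t = 0" and aprod_zero_right [simp]: "s \<star> 0 = 0"
  by (auto simp: aprod_def fun_eq_iff)

lemma aprod_sum_left: "sum f A \<star> t = (\<Sum>i\<in>A. f i \<star> t)"
  by (induction A rule: infinite_finite_induct) (simp_all add: aprod_add_left del: plus_fun_apply zero_fun_apply fscale_apply sum_fun_apply)

lemma aprod_sum_right: "s \<star> sum f A = (\<Sum>i\<in>A. s \<star> f i)"
  by (induction A rule: infinite_finite_induct) (simp_all add: aprod_add_right del: plus_fun_apply zero_fun_apply fscale_apply sum_fun_apply)

lemma aone_dlt: "aone = dlt []"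
  by (auto simp: aone_def dlt_def)

text \<open>Both sides sum over the ways to cut a word into three pieces: \<open>i\<close> and
  \<open>k\<close> are the positions of the two cuts, and \<open>j = k - i\<close> is the length of
  the middle piece.\<close>

lemma aprod_assoc: "(r \<star> s) \<star> t = r \<star> (s \<star> t)"
proof
  fix w
  let ?g = "\<lambda>i j. r (take i w) * s (take j (drop i w)) * t (drop (i + j) w)"
  have "((r \<star> s) \<star> t) w = (\<Sum>k\<le>length w. \<Sum>i\<le>k. ?g i (k - i))"
    unfolding aprod_def by (auto simp: sum_distrib_right take_drop min_def intro!: sum.cong)
  also have "\<dots> = (\<Sum>i\<le>length w. \<Sum>j\<le>length w - i. ?g i j)"
    by (subst (1 2) sum.Sigma, simp, simp, simp, simp)
      (rule sum.reindex_bij_witness[of _ "\<lambda>(i, j). (i + j, i)" "\<lambda>(k, i). (i, k - i)"], auto)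
  also have "\<dots> = (r \<star> (s \<star> t)) w"
    unfolding aprod_def by (auto simp: sum_distrib_left mult.assoc add.commute intro!: sum.cong)
  finally show "((r \<star> s) \<star> t) w = (r \<star> (s \<star> t)) w" .
qed

lemma aprod_one_left [simp]: "aone \<star> t = t"
proof
  fix w
  have "(aone \<star> t) ([] @ w) = aone [] * t w"
    by (rule aprod_append) (auto simp: aone_def split: if_splits)
  then show "(aone \<star> t) w = t w" by (simp add: aone_def)
qed

lemma aprod_one_right [simp]: "t \<star> aone = t"
proof
  fix w
  have "(t \<star> aone) w = (\<Sum>i\<le>length w. if i = length w then t w else 0)"
    unfolding aprod_def aone_def by (rule sum.cong) auto
  then show "(t \<star> aone) w = t w" by simp
qed

definition cat_words :: "'a list set \<Rightarrow> 'a list set \<Rightarrow> 'a list set" where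
  "cat_words W Z = (\<lambda>(u, v). u @ v) ` (W \<times> Z)"

lemma finite_cat_words: "finite W \<Longrightarrow> finite Z \<Longrightarrow> finite (cat_words W Z)"
  by (simp add: cat_words_def)

lemma cat_wordsI: "u \<in> W \<Longrightarrow> v \<in> Z \<Longrightarrow> u @ v \<in> cat_words W Z"
  by (auto simp: cat_words_def)

lemma cat_wordsE:
  assumes "w \<in> cat_words W Z"
  obtains u v where "w = u @ v" "u \<in> W" "v \<in> Z"
  using assms by (auto simp: cat_words_def)

lemma cat_words_assoc: "cat_words (cat_words W Z) Y = cat_words W (cat_words Z Y)"
proof -
  have "cat_words (cat_words W Z) Y = {(u @ v) @ w | u v w. u \<in> W \<and> v \<in> Z \<and> w \<in> Y}"
    unfolding cat_words_def by fast
  moreover have "cat_words W (cat_words Z Y) = {u @ v @ w | u v w. u \<in> W \<and> v \<in> Z \<and> w \<in> Y}"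
    unfolding cat_words_def by fast
  ultimately show ?thesis by simp
qed

lemma cat_words_Nil [simp]: "cat_words {[]} W = W" "cat_words W {[]} = W"
  by (simp_all add: cat_words_def image_def)

lemma aprod_supp:
  assumes "s \<in> supp_on W" "t \<in> supp_on Z"
  shows "s \<star> t \<in> supp_on (cat_words W Z)"
proof (rule supp_onI)
  fix w assume w: "w \<notin> cat_words W Z"
  have "s (take i w) * t (drop i w) = 0" for i
    using w cat_wordsI[of "take i w" W "drop i w" Z] assms
    by (metis append_take_drop_id mult_eq_0_iff supp_onD)
  then show "(s \<star> t) w = 0" unfolding aprod_def by (intro sum.neutral) blast
qed

text \<open>The delta array at \<open>u @ v\<close> is itself a pure tensor, so the tensor product
  is again the space of all arrays on a set of words.\<close>

lemma aten_supp:
  assumes "finite W" "finite Z"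
  shows "aten (supp_on W) (supp_on Z) = supp_on (cat_words W Z)"
proof (rule antisym)
  show "aten (supp_on W) (supp_on Z) \<subseteq> supp_on (cat_words W Z)"
    unfolding aten_def
    by (rule fscale.span_minimal) (auto simp: supp_on_subspace aprod_supp)
  have "dlt ` cat_words W Z \<subseteq> {s \<star> t |s t. s \<in> supp_on W \<and> t \<in> supp_on Z}"
    by (force simp: cat_words_def dlt_aprod[symmetric])
  from fscale.span_mono[OF this] show "supp_on (cat_words W Z) \<subseteq> aten (supp_on W) (supp_on Z)"
    unfolding aten_def using assms by (simp add: span_dlt finite_cat_words)
qed

text \<open>Fixing the length of the words in \<open>W\<close> makes the splitting of a word of \<open>cat_words W Z\<close> unique;
  this is what makes the tensor product of two linear maps well defined.\<close>

context
  fixes W Z :: "ix list set" and W' Z' :: "ix list set" and k :: nat and f g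
  assumes fin: "finite W" "finite Z" and len: "\<And>w. w \<in> W \<Longrightarrow> length w = k"
    and f: "f \<in> lin_maps fscale fscale (supp_on W) (supp_on W')"
    and g: "g \<in> lin_maps fscale fscale (supp_on Z) (supp_on Z')"
begin

private definition mt :: "array \<Rightarrow> array" where
  "mt = (\<lambda>t\<in>supp_on (cat_words W Z). \<Sum>u\<in>W. \<Sum>v\<in>Z. fscale (t (u @ v)) (f (dlt u) \<star> g (dlt v)))"

private lemma mt_lin: "mt \<in> lin_maps fscale fscale (supp_on (cat_words W Z)) (supp_on (cat_words W' Z'))"
proof (rule lin_mapsI)
  fix x assume x: "x \<in> supp_on (cat_words W Z)"
  show "mt x \<in> supp_on (cat_words W' Z')"
    using x f g by (auto simp: mt_def intro!: supp_on_sum supp_on_scale aprod_supp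
        lin_maps_in[OF f] lin_maps_in[OF g])
  show "mt (fscale c x) = fscale c (mt x)" for c
    using x by (simp add: mt_def fscale.scale_sum_right)
  fix y assume y: "y \<in> supp_on (cat_words W Z)"
  show "mt (x + y) = mt x + mt y"
    using x y by (simp add: mt_def fscale.scale_left_distrib sum.distrib)
qed (simp add: mt_def)

private lemma mt_aprod:
  assumes s: "s \<in> supp_on W" and t: "t \<in> supp_on Z"
  shows "mt (s \<star> t) = f s \<star> g t"
proof -
  have sp: "(s \<star> t) (u @ v) = s u * t v" if "u \<in> W" for u v
    by (rule aprod_append) (use s len that in \<open>auto simp: supp_on_def\<close>)
  have "mt (s \<star> t) = (\<Sum>u\<in>W. \<Sum>v\<in>Z. fscale (s u * t v) (f (dlt u) \<star> g (dlt v)))"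
    using aprod_supp[OF s t] by (simp add: mt_def sp)
  also have "\<dots> = (\<Sum>u\<in>W. fscale (s u) (f (dlt u))) \<star> (\<Sum>v\<in>Z. fscale (t v) (g (dlt v)))"
    by (subst sum.swap) (simp only: aprod_sum_left aprod_sum_right aprod_scale_left
        aprod_scale_right fscale.scale_sum_right fscale.scale_scale mult.commute)
  also have "\<dots> = f s \<star> g t"
    using lin_maps_expand[OF fscale.vector_space_axioms f fin(1) s]
      lin_maps_expand[OF fscale.vector_space_axioms g fin(2) t] by simp
  finally show ?thesis .
qed

private lemma map_tensor_eq: "map_tensor (supp_on W) (supp_on Z) f g = mt"
  unfolding map_tensor_def aten_supp[OF fin]
proof (rule the_equality)
  show "mt \<in> lin_maps fscale fscale (supp_on (cat_words W Z)) UNIV \<and>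
    (\<forall>s\<in>supp_on W. \<forall>t\<in>supp_on Z. mt (s \<star> t) = f s \<star> g t)"
    using mt_aprod lin_maps_mono[OF mt_lin] by auto
next
  fix h assume h: "h \<in> lin_maps fscale fscale (supp_on (cat_words W Z)) UNIV \<and>
    (\<forall>s\<in>supp_on W. \<forall>t\<in>supp_on Z. h (s \<star> t) = f s \<star> g t)"
  show "h = mt"
  proof (rule lin_maps_eqI[OF fscale.vector_space_axioms _ mt_lin])
    fix w assume "w \<in> cat_words W Z"
    then obtain u v where w: "w = u @ v" "u \<in> W" "v \<in> Z" by (rule cat_wordsE)
    with h mt_aprod[of "dlt u" "dlt v"] show "h (dlt w) = mt (dlt w)"
      by (simp add: dlt_aprod[symmetric])
  qed (use h fin in \<open>auto simp: finite_cat_words\<close>)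
qed

lemma map_tensor_lin:
  "map_tensor (supp_on W) (supp_on Z) f g
    \<in> lin_maps fscale fscale (supp_on (cat_words W Z)) (supp_on (cat_words W' Z'))"
  unfolding map_tensor_eq by (rule mt_lin)

lemma map_tensor_aprod:
  "s \<in> supp_on W \<Longrightarrow> t \<in> supp_on Z \<Longrightarrow>
    map_tensor (supp_on W) (supp_on Z) f g (s \<star> t) = f s \<star> g t"
  unfolding map_tensor_eq by (rule mt_aprod)

end

section \<open>The Clifford algebra as a quotient of the free algebra\<close>

lemma ring_free_alg: "ring (free_alg :: ('v list \<Rightarrow>\<^sub>0 complex) ring)"
proof (rule ringI)
  show "abelian_group (free_alg :: ('v list \<Rightarrow>\<^sub>0 complex) ring)"
  proof (rule abelian_groupI)
    fix x :: "'v list \<Rightarrow>\<^sub>0 complex"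
    show "\<exists>y\<in>carrier free_alg. y \<oplus>\<^bsub>free_alg\<^esub> x = \<zero>\<^bsub>free_alg\<^esub>"
      by (rule bexI[of _ "- x"]) (auto simp: free_alg_def)
  qed (auto simp: free_alg_def algebra_simps)
  show "monoid (free_alg :: ('v list \<Rightarrow>\<^sub>0 complex) ring)"
    by unfold_locales (auto simp: free_alg_def algebra_simps)
qed (auto simp: free_alg_def algebra_simps)

abbreviation cl_ideal :: "'v::ab_group_add quad_space \<Rightarrow> ('v list \<Rightarrow>\<^sub>0 complex) set" where
  "cl_ideal Q \<equiv> Idl\<^bsub>free_alg\<^esub> (cl_rels Q)"

lemma ideal_cl_ideal: "ideal (cl_ideal Q) free_alg"
  by (rule ring.genideal_ideal[OF ring_free_alg]) (auto simp: free_alg_def)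

global_interpretation cl: ring "Cl Q" for Q :: "'v::ab_group_add quad_space"
  unfolding Cl_def by (rule ideal.quotient_is_ring[OF ideal_cl_ideal])

lemma cl_rels_in_ideal: "a \<in> cl_rels Q \<Longrightarrow> a \<in> cl_ideal Q"
  using ring.genideal_self[OF ring_free_alg, of "cl_rels Q"] by (auto simp: free_alg_def)

text \<open>Turns a statement about the generated ideal into closure conditions. Closure under
  negatives follows from multiplication by \<open>- 1\<close>.\<close>

lemma cl_ideal_minimal:
  fixes Q :: "'v::ab_group_add quad_space"
  assumes "cl_rels Q \<subseteq> K" "0 \<in> K" "\<And>a b. a \<in> K \<Longrightarrow> b \<in> K \<Longrightarrow> a + b \<in> K"
    "\<And>a b. a \<in> K \<Longrightarrow> b * a \<in> K" "\<And>a b. a \<in> K \<Longrightarrow> a * b \<in> K"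
  shows "cl_ideal Q \<subseteq> K"
proof -
  interpret ring "free_alg :: ('v list \<Rightarrow>\<^sub>0 complex) ring" by (rule ring_free_alg)
  have uminus: "- a \<in> K" if "a \<in> K" for a
    using assms(4)[OF that, of "- 1"] by simp
  have neg: "\<ominus>\<^bsub>free_alg\<^esub> a = - a" for a :: "'v list \<Rightarrow>\<^sub>0 complex"
    by (rule minus_equality) (auto simp: free_alg_def)
  have "ideal K free_alg"
  proof (rule idealI)
    show "subgroup K (add_monoid free_alg)"
    proof (rule group.subgroupI)
      show "group (add_monoid (free_alg :: ('v list \<Rightarrow>\<^sub>0 complex) ring))"
        by (rule a_group)
      show "inv\<^bsub>add_monoid free_alg\<^esub> a \<in> K" if "a \<in> K" for a
        using uminus[OF that] neg[of a] by (simp add: a_inv_def)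
    qed (use assms in \<open>auto simp: free_alg_def\<close>)
  qed (use assms ring_free_alg in \<open>auto simp: free_alg_def\<close>)
  then show ?thesis
    using genideal_minimal assms(1) by blast
qed

lemma cl_carrier: "carrier (Cl Q) = range (cl_class Q)"
  by (auto simp: Cl_def FactRing_def A_RCOSETS_defs cl_class_def a_r_coset_def free_alg_def)

lemma cl_class_in_carrier [simp]: "cl_class Q a \<in> carrier (Cl Q)"
  by (simp add: cl_carrier)

lemma cl_class_hom: "cl_class Q \<in> ring_hom free_alg (Cl Q)"
proof -
  have "cl_class Q = (+>\<^bsub>free_alg\<^esub>) (cl_ideal Q)"
    by (auto simp: cl_class_def)
  then show ?thesis
    unfolding Cl_def by (metis ideal.rcos_ring_hom[OF ideal_cl_ideal])
qed

lemma cl_class_add: "cl_class Q a \<oplus>\<^bsub>Cl Q\<^esub> cl_class Q b = cl_class Q (a + b)"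
  using ring_hom_add[OF cl_class_hom, of a b] by (simp add: free_alg_def)

lemma cl_class_mult: "cl_class Q a \<otimes>\<^bsub>Cl Q\<^esub> cl_class Q b = cl_class Q (a * b)"
  using ring_hom_mult[OF cl_class_hom, of a b] by (simp add: free_alg_def)

lemma cl_class_one: "\<one>\<^bsub>Cl Q\<^esub> = cl_class Q 1"
  using ring_hom_one[OF cl_class_hom, of Q] by (simp add: free_alg_def)

lemma free_alg_ops: "\<zero>\<^bsub>free_alg\<^esub> = 0" "\<one>\<^bsub>free_alg\<^esub> = 1"
    "a \<oplus>\<^bsub>free_alg\<^esub> b = a + b" "a \<otimes>\<^bsub>free_alg\<^esub> b = a * b" "a \<in> carrier free_alg"
  by (simp_all add: free_alg_def)

lemma cl_ideal_zero: "0 \<in> cl_ideal Q"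
  and cl_ideal_add: "a \<in> cl_ideal Q \<Longrightarrow> b \<in> cl_ideal Q \<Longrightarrow> a + b \<in> cl_ideal Q"
  and cl_ideal_mult_left: "a \<in> cl_ideal Q \<Longrightarrow> b * a \<in> cl_ideal Q"
  and cl_ideal_mult_right: "a \<in> cl_ideal Q \<Longrightarrow> a * b \<in> cl_ideal Q"
  using additive_subgroup.zero_closed[OF ideal.axioms(1)[OF ideal_cl_ideal], of Q]
    additive_subgroup.a_closed[OF ideal.axioms(1)[OF ideal_cl_ideal], of a Q b]
    ideal.I_l_closed[OF ideal_cl_ideal, of a Q b] ideal.I_r_closed[OF ideal_cl_ideal, of a Q b]
  by (simp_all add: free_alg_ops)

lemma cl_class_eq_iff: "cl_class Q a = cl_class Q b \<longleftrightarrow> a - b \<in> cl_ideal Q"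
proof -
  interpret ideal "cl_ideal Q" free_alg by (rule ideal_cl_ideal)
  have mem: "x \<in> cl_class Q y \<longleftrightarrow> x - y \<in> cl_ideal Q" for x y
  proof -
    have "x \<in> cl_class Q y \<longleftrightarrow> (\<exists>h\<in>cl_ideal Q. x = h + y)"
      by (auto simp: cl_class_def a_r_coset_def r_coset_def free_alg_def)
    also have "\<dots> \<longleftrightarrow> x - y \<in> cl_ideal Q"
      by (metis add_diff_cancel diff_add_cancel)
    finally show ?thesis .
  qed
  show ?thesis
  proof
    assume "cl_class Q a = cl_class Q b"
    moreover have "a \<in> cl_class Q a"
      using cl_ideal_zero by (simp add: mem)
    ultimately show "a - b \<in> cl_ideal Q" using mem by blast
  next
    assume "a - b \<in> cl_ideal Q"
    then have "a \<in> cl_class Q b" using mem by blast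
    then show "cl_class Q a = cl_class Q b"
      unfolding cl_class_def using a_repr_independence' by (auto simp: free_alg_def)
  qed
qed

lemma cl_class_eqI: "a - b \<in> cl_rels Q \<Longrightarrow> cl_class Q a = cl_class Q b"
  by (simp add: cl_class_eq_iff cl_rels_in_ideal)

lemma cl_scale_class: "cl_scale Q c (cl_class Q a) = cl_class Q (Poly_Mapping.single [] c * a)"
  by (simp add: cl_scale_def cl_class_mult)

lemma cl_scale_closed [simp]: "x \<in> carrier (Cl Q) \<Longrightarrow> cl_scale Q c x \<in> carrier (Cl Q)"
  by (simp add: cl_scale_def)

lemma cl_vec_closed [simp]: "cl_vec Q v \<in> carrier (Cl Q)"
  by (simp add: cl_vec_def)

text \<open>The zero element is covered by \<open>single [] 0\<close>, so sums of monomials exhaust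
  the algebra.\<close>

lemma free_alg_induct [case_names single add]:
  assumes "\<And>w c. P (Poly_Mapping.single w c)" "\<And>a b. P a \<Longrightarrow> P b \<Longrightarrow> P (a + b)"
  shows "P (a :: 'v list \<Rightarrow>\<^sub>0 complex)"
proof (induction a rule: update_induct)
  case const
  then show ?case using assms(1)[of "[]" 0] by simp
next
  case (update f a b)
  have "Poly_Mapping.update a b f = f + Poly_Mapping.single a b"
    using update.hyps by (intro poly_mapping_eqI)
      (auto simp: lookup_update lookup_add lookup_single when_def not_in_keys_iff_lookup_eq_zero)
  then show ?case using assms update.IH by metis
qed

text \<open>A scalar sits on the empty word, hence is central.\<close>

lemma single_Nil_commute:
  "Poly_Mapping.single [] c * a = a * Poly_Mapping.single [] c" for a :: "'v list \<Rightarrow>\<^sub>0 complex"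
  by (induction a rule: free_alg_induct)
    (simp_all add: mult_single algebra_simps plus_list_def)

lemma single_one_list: "Poly_Mapping.single [] 1 = (1 :: 'v list \<Rightarrow>\<^sub>0 complex)"
  by (metis single_one zero_list_def)

lemma single_scale:
  "Poly_Mapping.single w c = Poly_Mapping.single [] c * Poly_Mapping.single w (1::complex)"
  by (simp add: mult_single plus_list_def)

lemma single_Cons:
  "Poly_Mapping.single (v # w) (1::complex) = Poly_Mapping.single [v] 1 * Poly_Mapping.single w 1"
  by (simp add: mult_single plus_list_def)

text \<open>Words in vectors span Cl(V). They are built up by left multiplication, matching the
  order in which \<open>word_op\<close> applies operators.\<close>

lemma cl_induct [consumes 1, case_names one add scale vec]:
  assumes x: "x \<in> carrier (Cl Q)"
    and one: "P \<one>\<^bsub>Cl Q\<^esub>"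
    and add: "\<And>x y. x \<in> carrier (Cl Q) \<Longrightarrow> y \<in> carrier (Cl Q) \<Longrightarrow> P x \<Longrightarrow> P y \<Longrightarrow> P (x \<oplus>\<^bsub>Cl Q\<^esub> y)"
    and scale: "\<And>c x. x \<in> carrier (Cl Q) \<Longrightarrow> P x \<Longrightarrow> P (cl_scale Q c x)"
    and vec: "\<And>v x. x \<in> carrier (Cl Q) \<Longrightarrow> P x \<Longrightarrow> P (cl_vec Q v \<otimes>\<^bsub>Cl Q\<^esub> x)"
  shows "P x"
proof -
  obtain a where "x = cl_class Q a" using x cl_carrier by blast
  moreover have "P (cl_class Q a)"
  proof (induction a rule: free_alg_induct)
    case (single w c)
    have "P (cl_class Q (Poly_Mapping.single w 1))"
    proof (induction w)
      case Nil
      then show ?case using one by (simp add: single_one_list cl_class_one)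
    next
      case (Cons v w)
      then show ?case
        using vec[of "cl_class Q (Poly_Mapping.single w 1)" v]
        by (subst single_Cons) (simp add: cl_vec_def cl_class_mult)
    qed
    from scale[OF _ this] show ?case
      by (subst single_scale) (simp add: cl_scale_class)
  next
    case (add a b)
    then show ?case using assms(3)[of "cl_class Q a" "cl_class Q b"] by (simp add: cl_class_add)
  qed
  ultimately show ?thesis by simp
qed

lemma cl_scale_mult_left:
  "x \<in> carrier (Cl Q) \<Longrightarrow> y \<in> carrier (Cl Q) \<Longrightarrow>
    cl_scale Q c x \<otimes>\<^bsub>Cl Q\<^esub> y = cl_scale Q c (x \<otimes>\<^bsub>Cl Q\<^esub> y)"
  by (simp add: cl_scale_def cl.m_assoc)

lemma cl_scale_mult_right:
  "x \<in> carrier (Cl Q) \<Longrightarrow> y \<in> carrier (Cl Q) \<Longrightarrow>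
    x \<otimes>\<^bsub>Cl Q\<^esub> cl_scale Q c y = cl_scale Q c (x \<otimes>\<^bsub>Cl Q\<^esub> y)"
  by (auto simp: cl_carrier cl_scale_class cl_class_mult mult.assoc[symmetric]
      simp flip: single_Nil_commute)

lemma cl_vec_add: "cl_vec Q (v + w) = cl_vec Q v \<oplus>\<^bsub>Cl Q\<^esub> cl_vec Q w"
  unfolding cl_vec_def cl_class_add
  by (rule cl_class_eqI) (auto simp: cl_rels_def diff_diff_add)

lemma cl_vec_scale: "cl_vec Q (vscale Q c v) = cl_scale Q c (cl_vec Q v)"
  unfolding cl_vec_def cl_scale_class
  by (rule cl_class_eqI) (auto simp: cl_rels_def mult_single plus_list_def)

subsection \<open>Representations\<close>

fun word_op :: "('v \<Rightarrow> ('a \<Rightarrow> complex) \<Rightarrow> 'a \<Rightarrow> complex) \<Rightarrow> 'v list \<Rightarrow> ('a \<Rightarrow> complex) \<Rightarrow> 'a \<Rightarrow> complex" where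
  "word_op T [] x = x"
| "word_op T (v # w) x = T v (word_op T w x)"

lemma word_op_append: "word_op T (u @ w) x = word_op T u (word_op T w x)"
  by (induction u) auto

definition free_op :: "('v \<Rightarrow> ('a \<Rightarrow> complex) \<Rightarrow> 'a \<Rightarrow> complex) \<Rightarrow>
    ('v list \<Rightarrow>\<^sub>0 complex) \<Rightarrow> ('a \<Rightarrow> complex) \<Rightarrow> 'a \<Rightarrow> complex" where
  "free_op T a x = (\<Sum>w\<in>Poly_Mapping.keys a. fscale (Poly_Mapping.lookup a w) (word_op T w x))"

lemma free_op_single: "free_op T (Poly_Mapping.single w c) x = fscale c (word_op T w x)"
  by (cases "c = 0") (auto simp: free_op_def)

lemma free_op_add: "free_op T (a + b) x = free_op T a x + free_op T b x"
  unfolding free_op_def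
  by (rule setsum_keys_plus_distrib) (auto simp: fscale.scale_left_distrib)

lemma free_op_diff: "free_op T (a - b) x = free_op T a x - free_op T b x"
  by (metis add_diff_cancel diff_add_cancel free_op_add)

lemma free_op_zero: "free_op T 0 x = 0"
  by (simp add: free_op_def)

text \<open>The universal property of Cl(V): operators indexed by vectors and satisfying the
  Clifford relation extend to an action \<open>cl_op\<close>. They act on all functions on
  \<open>'a\<close>; the restriction to an invariant subspace is made where it is used.\<close>

locale clifford_rep =
  fixes Q :: "'v::ab_group_add quad_space"
    and T :: "'v \<Rightarrow> ('a \<Rightarrow> complex) \<Rightarrow> 'a \<Rightarrow> complex"
  assumes T_add: "T v (x + y) = T v x + T v y"
    and T_scale: "T v (fscale c x) = fscale c (T v x)"
    and T_vec_add: "T (v + w) x = T v x + T w x"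
    and T_vec_scale: "T (vscale Q c v) x = fscale c (T v x)"
    and T_clifford: "T v (T w x) + T w (T v x) = fscale (2 * vform Q v w) x"
begin

lemma word_op_add: "word_op T w (x + y) = word_op T w x + word_op T w y"
  by (induction w) (auto simp: T_add simp del: plus_fun_apply)

lemma word_op_scale: "word_op T w (fscale c x) = fscale c (word_op T w x)"
  by (induction w) (auto simp: T_scale simp del: fscale_apply)

lemma free_op_arg_add: "free_op T a (x + y) = free_op T a x + free_op T a y"
  by (simp add: free_op_def word_op_add fscale.scale_right_distrib sum.distrib)

lemma free_op_arg_scale: "free_op T a (fscale c x) = fscale c (free_op T a x)"
  by (simp add: free_op_def word_op_scale fscale.scale_sum_right mult.commute)

lemma free_op_mult: "free_op T (a * b) x = free_op T a (free_op T b x)"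
proof (induction a rule: free_alg_induct)
  case (single w c)
  then show ?case
  proof (induction b rule: free_alg_induct)
    case (single u d)
    show ?case
      by (simp add: mult_single free_op_single plus_list_def word_op_append word_op_scale
          del: fscale_apply)
  next
    case (add a b)
    then show ?case
      by (simp add: distrib_left free_op_add free_op_arg_add del: plus_fun_apply)
  qed
next
  case (add a b)
  then show ?case by (simp add: distrib_right free_op_add del: plus_fun_apply)
qed

text \<open>The annihilator of the whole function space is a two-sided ideal containing the
  relations. Quantifying over \<open>x\<close> inside the set gives closure under multiplication on
  the right.\<close>

lemma free_op_ideal: "a \<in> cl_ideal Q \<Longrightarrow> free_op T a x = 0"
proof -
  have zero: "free_op T a 0 = 0" for a
    using free_op_arg_scale[of a 0 0] by simp
  have "cl_ideal Q \<subseteq> {a. \<forall>x. free_op T a x = 0}"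
  proof (rule cl_ideal_minimal)
    show "cl_rels Q \<subseteq> {a. \<forall>x. free_op T a x = 0}"
      unfolding cl_rels_def
      by (auto simp: free_op_add free_op_diff free_op_single T_vec_add T_vec_scale T_clifford
          simp del: plus_fun_apply fscale_apply)
  qed (auto simp: free_op_zero free_op_add free_op_mult zero simp del: plus_fun_apply)
  then show "a \<in> cl_ideal Q \<Longrightarrow> free_op T a x = 0" by blast
qed

definition cl_op :: "'v cl \<Rightarrow> ('a \<Rightarrow> complex) \<Rightarrow> 'a \<Rightarrow> complex" where
  "cl_op X = free_op T (SOME a. cl_class Q a = X)"

text \<open>The representative chosen by \<open>SOME\<close> differs from \<open>a\<close> by an
  element of the ideal, which acts as zero.\<close>

lemma cl_op_class: "cl_op (cl_class Q a) x = free_op T a x"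
proof -
  have "cl_class Q (SOME b. cl_class Q b = cl_class Q a) = cl_class Q a"
    by (rule someI) simp
  then have "free_op T ((SOME b. cl_class Q b = cl_class Q a) - a) x = 0"
    using cl_class_eq_iff free_op_ideal by blast
  then show ?thesis by (simp add: cl_op_def free_op_diff)
qed

lemma cl_op_one: "cl_op \<one>\<^bsub>Cl Q\<^esub> x = x"
  by (simp add: cl_class_one cl_op_class flip: single_one_list) (simp add: free_op_single)

lemma cl_op_add:
  "a \<in> carrier (Cl Q) \<Longrightarrow> b \<in> carrier (Cl Q) \<Longrightarrow> cl_op (a \<oplus>\<^bsub>Cl Q\<^esub> b) x = cl_op a x + cl_op b x"
  by (auto simp: cl_carrier cl_class_add cl_op_class free_op_add)

lemma cl_op_mult:
  "a \<in> carrier (Cl Q) \<Longrightarrow> b \<in> carrier (Cl Q) \<Longrightarrow> cl_op (a \<otimes>\<^bsub>Cl Q\<^esub> b) x = cl_op a (cl_op b x)"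
  by (auto simp: cl_carrier cl_class_mult cl_op_class free_op_mult)

lemma cl_op_scale: "a \<in> carrier (Cl Q) \<Longrightarrow> cl_op (cl_scale Q c a) x = fscale c (cl_op a x)"
  by (auto simp: cl_carrier cl_scale_class cl_op_class free_op_mult free_op_single)

lemma cl_op_vec: "cl_op (cl_vec Q v) x = T v x"
  by (simp add: cl_vec_def cl_op_class free_op_single)

lemma cl_op_arg_add: "cl_op a (x + y) = cl_op a x + cl_op a y"
  unfolding cl_op_def by (rule free_op_arg_add)

lemma cl_op_arg_scale: "cl_op a (fscale c x) = fscale c (cl_op a x)"
  unfolding cl_op_def by (rule free_op_arg_scale)

end

subsection \<open>The reversal antiautomorphism\<close>

abbreviation rev_free :: "('v list \<Rightarrow>\<^sub>0 complex) \<Rightarrow> 'v list \<Rightarrow>\<^sub>0 complex" where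
  "rev_free \<equiv> Poly_Mapping.map_key rev"

lemma rev_free_single: "rev_free (Poly_Mapping.single w c) = Poly_Mapping.single (rev w) c"
  using map_key_single[of rev "rev w" c] by simp

lemma rev_free_add: "rev_free (a + b) = rev_free a + rev_free b"
  by (rule map_key_plus) simp

lemma rev_free_diff: "rev_free (a - b) = rev_free a - rev_free b"
  by (metis add_diff_cancel diff_add_cancel rev_free_add)

lemma rev_free_one [simp]: "rev_free 1 = 1"
  using rev_free_single[of "[]" 1] by (simp add: single_one_list)

lemma rev_free_mult: "rev_free (a * b) = rev_free b * rev_free a"
proof (induction a rule: free_alg_induct)
  case (single w c)
  then show ?case
    by (induction b rule: free_alg_induct)
      (simp_all add: mult_single rev_free_single plus_list_def distrib_left distrib_right rev_free_add
        mult.commute)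
qed (simp add: distrib_left distrib_right rev_free_add)

lemma rev_free_rev_free: "rev_free (rev_free a) = a"
  by (induction a rule: free_alg_induct) (auto simp: rev_free_single rev_free_add)

text \<open>The linearity relations involve only words of length one, which reversal fixes, and a
  Clifford relation is symmetric in its two words. Reversal exchanges left and right multiples, so
  the preimage of the ideal is again a two-sided ideal.\<close>

lemma rev_free_ideal: "a \<in> cl_ideal Q \<Longrightarrow> rev_free a \<in> cl_ideal Q"
proof -
  have "cl_ideal Q \<subseteq> {a. rev_free a \<in> cl_ideal Q}"
  proof (rule cl_ideal_minimal)
    have sw: "Poly_Mapping.single [w, v] 1 + Poly_Mapping.single [v, w] 1
        - Poly_Mapping.single [] (2 * vform Q v w) \<in> cl_rels Q" for v w
      unfolding cl_rels_def by (intro UnI2) (auto simp: add.commute)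
    have "rev_free a \<in> cl_rels Q" if "a \<in> cl_rels Q" for a
    proof -
      from that[unfolded cl_rels_def] show ?thesis
        by (elim UnE CollectE exE conjE)
          (use that sw in \<open>simp_all add: rev_free_diff rev_free_add rev_free_single\<close>)
    qed
    then show "cl_rels Q \<subseteq> {a. rev_free a \<in> cl_ideal Q}"
      using cl_rels_in_ideal by auto
    show "0 \<in> {a. rev_free a \<in> cl_ideal Q}"
      using cl_ideal_zero rev_free_diff[of 0 0] by simp
    show "a + b \<in> {a. rev_free a \<in> cl_ideal Q}"
      if "a \<in> {a. rev_free a \<in> cl_ideal Q}" "b \<in> {a. rev_free a \<in> cl_ideal Q}" for a b
      using that by (simp add: rev_free_add cl_ideal_add)
    show "b * a \<in> {a. rev_free a \<in> cl_ideal Q}" if "a \<in> {a. rev_free a \<in> cl_ideal Q}" for a b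
      using that by (simp add: rev_free_mult cl_ideal_mult_right)
    show "a * b \<in> {a. rev_free a \<in> cl_ideal Q}" if "a \<in> {a. rev_free a \<in> cl_ideal Q}" for a b
      using that by (simp add: rev_free_mult cl_ideal_mult_left)
  qed
  then show "a \<in> cl_ideal Q \<Longrightarrow> rev_free a \<in> cl_ideal Q" by blast
qed

text \<open>Reversal of words descends to the quotient and is its own inverse there, which gives
  existence. An antiautomorphism that fixes V is determined on words by induction, which gives
  uniqueness.\<close>

lemma cl_iota_class: "cl_iota Q (cl_class Q a) = cl_class Q (rev_free a)"
proof -
  define f where "f = (\<lambda>X\<in>carrier (Cl Q). cl_class Q (rev_free (SOME a. cl_class Q a = X)))"
  have f: "f (cl_class Q a) = cl_class Q (rev_free a)" for a
  proof -
    have "cl_class Q (SOME b. cl_class Q b = cl_class Q a) = cl_class Q a"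
      by (rule someI) simp
    then show ?thesis
      by (simp add: f_def) (metis cl_class_eq_iff rev_free_diff rev_free_ideal)
  qed
  have "cl_iota Q = f"
    unfolding cl_iota_def
  proof (rule the_equality, intro conjI ballI allI)
    show "f \<in> carrier (Cl Q) \<rightarrow>\<^sub>E carrier (Cl Q)"
      by (auto simp: f_def)
    show "bij_betw f (carrier (Cl Q)) (carrier (Cl Q))"
      by (rule bij_betw_byWitness[where f' = f]) (auto simp: cl_carrier f rev_free_rev_free)
    fix x y assume "x \<in> carrier (Cl Q)" "y \<in> carrier (Cl Q)"
    then show "f (x \<oplus>\<^bsub>Cl Q\<^esub> y) = f x \<oplus>\<^bsub>Cl Q\<^esub> f y" "f (x \<otimes>\<^bsub>Cl Q\<^esub> y) = f y \<otimes>\<^bsub>Cl Q\<^esub> f x"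
      by (auto simp: cl_carrier f cl_class_add cl_class_mult rev_free_add rev_free_mult)
  next
    fix c x assume "x \<in> carrier (Cl Q)"
    then show "f (cl_scale Q c x) = cl_scale Q c (f x)"
      by (auto simp: cl_carrier f cl_scale_class rev_free_mult rev_free_single single_Nil_commute)
  next
    show "f \<one>\<^bsub>Cl Q\<^esub> = \<one>\<^bsub>Cl Q\<^esub>"
      by (simp add: f cl_class_one)
    show "f (cl_vec Q v) = cl_vec Q v" for v
      by (simp add: f cl_vec_def rev_free_single)
  next
    fix g assume g: "g \<in> carrier (Cl Q) \<rightarrow>\<^sub>E carrier (Cl Q) \<and>
       bij_betw g (carrier (Cl Q)) (carrier (Cl Q)) \<and>
       (\<forall>x\<in>carrier (Cl Q). \<forall>y\<in>carrier (Cl Q).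
          g (x \<oplus>\<^bsub>Cl Q\<^esub> y) = g x \<oplus>\<^bsub>Cl Q\<^esub> g y \<and> g (x \<otimes>\<^bsub>Cl Q\<^esub> y) = g y \<otimes>\<^bsub>Cl Q\<^esub> g x) \<and>
       (\<forall>c. \<forall>x\<in>carrier (Cl Q). g (cl_scale Q c x) = cl_scale Q c (g x)) \<and>
       g \<one>\<^bsub>Cl Q\<^esub> = \<one>\<^bsub>Cl Q\<^esub> \<and> (\<forall>v. g (cl_vec Q v) = cl_vec Q v)"
    have "g x = f x" if "x \<in> carrier (Cl Q)" for x
      using that
    proof (induction x rule: cl_induct)
      case one
      show ?case using g by (simp add: f cl_class_one)
    next
      case (add x y)
      then show ?case using g
        by (auto simp: cl_carrier f cl_class_add rev_free_add)
    next
      case (scale c x)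
      then show ?case using g
        by (auto simp: cl_carrier f cl_scale_class rev_free_mult rev_free_single single_Nil_commute)
    next
      case (vec v x)
      then have "g (cl_vec Q v \<otimes>\<^bsub>Cl Q\<^esub> x) = f x \<otimes>\<^bsub>Cl Q\<^esub> cl_vec Q v"
        using g by simp
      also have "\<dots> = f (cl_vec Q v \<otimes>\<^bsub>Cl Q\<^esub> x)"
        using vec(1) by (auto simp: cl_carrier f cl_class_mult cl_vec_def rev_free_mult rev_free_single)
      finally show ?case .
    qed
    then show "g = f"
      using g by (intro extensionalityI[of g "carrier (Cl Q)" f]) (auto simp: f_def PiE_def)
  qed
  then show ?thesis using f by simp
qed

lemma cl_iota_closed [simp]: "x \<in> carrier (Cl Q) \<Longrightarrow> cl_iota Q x \<in> carrier (Cl Q)"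
  by (auto simp: cl_carrier cl_iota_class)

lemma cl_iota_mult:
  "x \<in> carrier (Cl Q) \<Longrightarrow> y \<in> carrier (Cl Q) \<Longrightarrow>
    cl_iota Q (x \<otimes>\<^bsub>Cl Q\<^esub> y) = cl_iota Q y \<otimes>\<^bsub>Cl Q\<^esub> cl_iota Q x"
  by (auto simp: cl_carrier cl_iota_class cl_class_mult rev_free_mult)

lemma cl_iota_add:
  "x \<in> carrier (Cl Q) \<Longrightarrow> y \<in> carrier (Cl Q) \<Longrightarrow>
    cl_iota Q (x \<oplus>\<^bsub>Cl Q\<^esub> y) = cl_iota Q x \<oplus>\<^bsub>Cl Q\<^esub> cl_iota Q y"
  by (auto simp: cl_carrier cl_iota_class cl_class_add rev_free_add)

lemma cl_iota_scale: "x \<in> carrier (Cl Q) \<Longrightarrow> cl_iota Q (cl_scale Q c x) = cl_scale Q c (cl_iota Q x)"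
  by (auto simp: cl_carrier cl_iota_class cl_scale_class rev_free_mult rev_free_single single_Nil_commute)

lemma cl_iota_one [simp]: "cl_iota Q \<one>\<^bsub>Cl Q\<^esub> = \<one>\<^bsub>Cl Q\<^esub>"
  by (simp add: cl_iota_class cl_class_one)

subsection \<open>The groups Pin and Spin\<close>

lemma cl_parity_mult:
  shows cl_even_even: "x \<in> cl_even Q \<Longrightarrow> y \<in> cl_even Q \<Longrightarrow> x \<otimes>\<^bsub>Cl Q\<^esub> y \<in> cl_even Q"
    and cl_odd_odd: "x \<in> cl_odd Q \<Longrightarrow> y \<in> cl_odd Q \<Longrightarrow> x \<otimes>\<^bsub>Cl Q\<^esub> y \<in> cl_even Q"
    and cl_even_odd: "x \<in> cl_even Q \<Longrightarrow> y \<in> cl_odd Q \<Longrightarrow> x \<otimes>\<^bsub>Cl Q\<^esub> y \<in> cl_odd Q"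
    and cl_odd_even: "x \<in> cl_odd Q \<Longrightarrow> y \<in> cl_even Q \<Longrightarrow> x \<otimes>\<^bsub>Cl Q\<^esub> y \<in> cl_odd Q"
proof -
  have keys: "\<exists>u\<in>Poly_Mapping.keys a. \<exists>v\<in>Poly_Mapping.keys b. w = u @ v"
    if "w \<in> Poly_Mapping.keys (a * b)" for a b :: "'a list \<Rightarrow>\<^sub>0 complex" and w
    using keys_mult[of a b] that unfolding plus_list_def by blast
  have *: "cl_class Q a \<otimes>\<^bsub>Cl Q\<^esub> cl_class Q b = cl_class Q (a * b)" for a b
    by (rule cl_class_mult)
  show "x \<in> cl_even Q \<Longrightarrow> y \<in> cl_even Q \<Longrightarrow> x \<otimes>\<^bsub>Cl Q\<^esub> y \<in> cl_even Q"
    "x \<in> cl_odd Q \<Longrightarrow> y \<in> cl_odd Q \<Longrightarrow> x \<otimes>\<^bsub>Cl Q\<^esub> y \<in> cl_even Q"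
    "x \<in> cl_even Q \<Longrightarrow> y \<in> cl_odd Q \<Longrightarrow> x \<otimes>\<^bsub>Cl Q\<^esub> y \<in> cl_odd Q"
    "x \<in> cl_odd Q \<Longrightarrow> y \<in> cl_even Q \<Longrightarrow> x \<otimes>\<^bsub>Cl Q\<^esub> y \<in> cl_odd Q"
    unfolding cl_even_def cl_odd_def by (auto simp: * intro!: imageI dest!: keys)
qed

lemma cl_one_even: "\<one>\<^bsub>Cl Q\<^esub> \<in> cl_even Q"
  unfolding cl_class_one cl_even_def by (rule imageI) (auto simp: zero_list_def)

lemma cl_unit_inv:
  assumes "g \<in> Units (Cl Q)" "y \<in> carrier (Cl Q)" "g \<otimes>\<^bsub>Cl Q\<^esub> y = \<one>\<^bsub>Cl Q\<^esub>"
  shows "inv\<^bsub>Cl Q\<^esub> g = y"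
  using assms by (metis cl.Units_closed cl.Units_inv_closed cl.Units_l_inv cl.inv_unique)

context
  fixes Q :: "'v::ab_group_add quad_space" and g :: "'v cl"
  assumes g: "g \<in> Pin Q"
begin

lemma Pin_closed: "g \<in> carrier (Cl Q)"
  using g by (auto simp: Pin_def Units_def)

text \<open>Replaces inversion by the linear map \<iota>; this is what makes conjugation by g
  polynomial in g.\<close>

lemma Pin_inv: "inv\<^bsub>Cl Q\<^esub> g = cl_iota Q g"
  using g Pin_closed by (intro cl_unit_inv) (auto simp: Pin_def)

lemma Pin_iota_right: "g \<otimes>\<^bsub>Cl Q\<^esub> cl_iota Q g = \<one>\<^bsub>Cl Q\<^esub>"
  using g by (auto simp: Pin_def)

lemma Pin_iota_left: "cl_iota Q g \<otimes>\<^bsub>Cl Q\<^esub> g = \<one>\<^bsub>Cl Q\<^esub>"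
proof -
  have "g \<in> Units (Cl Q)" using g by (simp add: Pin_def)
  then show ?thesis using cl.Units_l_inv Pin_inv by metis
qed

end

lemma Pin_mult:
  assumes g: "g \<in> Pin Q" and h: "h \<in> Pin Q"
  shows "g \<otimes>\<^bsub>Cl Q\<^esub> h \<in> Pin Q"
proof -
  note c = Pin_closed[OF g] Pin_closed[OF h]
  let ?c = "\<lambda>g x. g \<otimes>\<^bsub>Cl Q\<^esub> x \<otimes>\<^bsub>Cl Q\<^esub> inv\<^bsub>Cl Q\<^esub> g"
  have U: "g \<otimes>\<^bsub>Cl Q\<^esub> h \<in> Units (Cl Q)"
    using g h by (auto simp: Pin_def)
  have "g \<otimes>\<^bsub>Cl Q\<^esub> h \<otimes>\<^bsub>Cl Q\<^esub> cl_iota Q (g \<otimes>\<^bsub>Cl Q\<^esub> h)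
      = g \<otimes>\<^bsub>Cl Q\<^esub> (h \<otimes>\<^bsub>Cl Q\<^esub> cl_iota Q h) \<otimes>\<^bsub>Cl Q\<^esub> cl_iota Q g"
    using c by (simp add: cl_iota_mult cl.m_assoc)
  also have "\<dots> = \<one>\<^bsub>Cl Q\<^esub>"
    using c by (simp add: Pin_iota_right[OF g] Pin_iota_right[OF h])
  finally have one: "g \<otimes>\<^bsub>Cl Q\<^esub> h \<otimes>\<^bsub>Cl Q\<^esub> cl_iota Q (g \<otimes>\<^bsub>Cl Q\<^esub> h) = \<one>\<^bsub>Cl Q\<^esub>" .
  have inv: "inv\<^bsub>Cl Q\<^esub> (g \<otimes>\<^bsub>Cl Q\<^esub> h) = inv\<^bsub>Cl Q\<^esub> h \<otimes>\<^bsub>Cl Q\<^esub> inv\<^bsub>Cl Q\<^esub> g"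
    using cl_unit_inv[OF U _ one] c by (simp add: cl_iota_mult Pin_inv[OF g] Pin_inv[OF h])
  have "?c (g \<otimes>\<^bsub>Cl Q\<^esub> h) ` range (cl_vec Q) = ?c g ` (?c h ` range (cl_vec Q))"
    unfolding image_image inv using c
    by (intro image_cong refl) (auto simp: cl.m_assoc Pin_inv[OF g] Pin_inv[OF h])
  also have "\<dots> = range (cl_vec Q)"
    using g h by (auto simp: Pin_def)
  finally have "?c (g \<otimes>\<^bsub>Cl Q\<^esub> h) ` range (cl_vec Q) = range (cl_vec Q)" .
  moreover have "g \<otimes>\<^bsub>Cl Q\<^esub> h \<in> cl_even Q \<union> cl_odd Q"
    using g h cl_parity_mult[of g Q h] by (auto simp: Pin_def)
  ultimately show ?thesis
    using U one by (auto simp: Pin_def)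
qed

lemma Pin_one: "\<one>\<^bsub>Cl Q\<^esub> \<in> Pin Q"
  by (simp add: Pin_def cl_one_even image_image)

lemma GV_subset_Pin: "g \<in> GV Q \<Longrightarrow> g \<in> Pin Q"
  by (auto simp: GV_def Spin_def split: if_splits)

lemma GV_one: "\<one>\<^bsub>Cl Q\<^esub> \<in> GV Q"
  by (simp add: GV_def Spin_def Pin_one cl_one_even)

lemma GV_mult: "g \<in> GV Q \<Longrightarrow> h \<in> GV Q \<Longrightarrow> g \<otimes>\<^bsub>Cl Q\<^esub> h \<in> GV Q"
  by (auto simp: GV_def Spin_def Pin_mult cl_even_even)

lemma Pin_conj_vec:
  assumes "g \<in> Pin Q"
  obtains w where "cl_vec Q w = g \<otimes>\<^bsub>Cl Q\<^esub> cl_vec Q v \<otimes>\<^bsub>Cl Q\<^esub> inv\<^bsub>Cl Q\<^esub> g"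
proof -
  let ?c = "\<lambda>x. g \<otimes>\<^bsub>Cl Q\<^esub> x \<otimes>\<^bsub>Cl Q\<^esub> inv\<^bsub>Cl Q\<^esub> g"
  have "?c ` range (cl_vec Q) = range (cl_vec Q)"
    using assms by (simp add: Pin_def)
  moreover have "?c (cl_vec Q v) \<in> ?c ` range (cl_vec Q)" by blast
  ultimately show ?thesis using that by (metis rangeE)
qed

section \<open>Clifford operators on the exterior algebra\<close>

definition tog :: "nat \<Rightarrow> nat set \<Rightarrow> nat set" where
  "tog k K = (if k \<in> K then K - {k} else insert k K)"

text \<open>The Jordan-Wigner sign: the cost of moving the k-th generator past the factors of
  smaller index.\<close>

definition below :: "nat \<Rightarrow> nat set \<Rightarrow> complex" where
  "below k K = (- 1) ^ card {j \<in> K. j < k}"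

lemma mem_tog: "i \<in> tog k K \<longleftrightarrow> (if i = k then i \<notin> K else i \<in> K)"
  by (auto simp: tog_def)

lemma tog_tog [simp]: "tog k (tog k K) = K"
  by (auto simp: tog_def)

lemma tog_commute: "tog k (tog l K) = tog l (tog k K)"
  by (rule Set.set_eqI) (simp add: mem_tog)

lemma tog_Diff: "k \<in> A \<Longrightarrow> A - tog k K = tog k (A - K)"
  by (auto simp: tog_def)

lemma tog_subset: "k \<in> A \<Longrightarrow> tog k K \<subseteq> A \<longleftrightarrow> K \<subseteq> A"
  by (auto simp: tog_def)

lemma minus_one_card_tog:
  assumes "finite K"
  shows "(- 1 :: complex) ^ card (tog k K) = - ((- 1) ^ card K)"
proof (cases "k \<in> K")
  case True
  then have "(- 1 :: complex) ^ card K = (- 1) ^ Suc (card (K - {k}))"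
    using assms by (simp only: card.remove)
  moreover have "tog k K = K - {k}" using True by (simp add: tog_def)
  ultimately show ?thesis by (simp only: power_Suc) simp
qed (use assms in \<open>simp add: tog_def\<close>)

text \<open>For distinct \<open>k\<close> and \<open>l\<close>, toggling each in the sign of the
  other changes exactly one of the two signs. This is the source of all anticommutation between
  different modes.\<close>

lemma below_tog: "below k (tog l K) = (if l < k then - below k K else below k K)"
proof -
  have "{j \<in> tog l K. j < k} = (if l < k then tog l {j \<in> K. j < k} else {j \<in> K. j < k})"
    by (rule Set.set_eqI) (simp add: mem_tog)
  then show ?thesis
    using minus_one_card_tog[of "{j \<in> K. j < k}" l] by (simp add: below_def)
qed

lemma below_below [simp]: "below k K * below k K = 1"
  by (simp add: below_def flip: power_add mult_2)

text \<open>The operator \<open>a \<psi>\<^sub>k + b \<psi>\<^sub>k\<^sup>\<dagger>\<close>, and the parity operator \<open>x\<^sub>I \<mapsto> (-1)^|I| x\<^sub>I\<close>.\<close>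

definition fermi :: "nat \<Rightarrow> complex \<Rightarrow> complex \<Rightarrow> (nat set \<Rightarrow> complex) \<Rightarrow> nat set \<Rightarrow> complex" where
  "fermi k a b x = (\<lambda>K. (if k \<in> K then b else a) * below k K * x (tog k K))"

definition par :: "nat \<Rightarrow> (nat set \<Rightarrow> complex) \<Rightarrow> nat set \<Rightarrow> complex" where
  "par n x = (\<lambda>K. (- 1) ^ card (K \<inter> {1..n}) * x K)"

text \<open>For \<open>k = l\<close> the toggles cancel and the two signs agree, so the summands
  leave the products \<open>a * b'\<close> and \<open>b * a'\<close> in some order. For distinct
  indices \<open>below_tog\<close> makes the summands opposite.\<close>

lemma fermi_anticommute:
  "fermi k a b (fermi l a' b' x) + fermi l a' b' (fermi k a b x)
    = fscale (if k = l then a * b' + b * a' else 0) x"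
proof
  fix K
  show "(fermi k a b (fermi l a' b' x) + fermi l a' b' (fermi k a b x)) K
    = fscale (if k = l then a * b' + b * a' else 0) x K"
  proof (cases "k = l")
    case True
    have sq: "u * below l K * (v * below l K * y) = u * v * y" for u v y
    proof -
      have "u * below l K * (v * below l K * y) = u * v * y * (below l K * below l K)"
        by (simp only: mult_ac)
      then show ?thesis by simp
    qed
    show ?thesis
      using True by (simp add: fermi_def mem_tog below_tog sq algebra_simps)
  next
    case False
    then show ?thesis
      by (simp add: fermi_def mem_tog below_tog tog_commute[of l k])
  qed
qed

text \<open>Here \<open>K\<close> ranges over all sets of naturals, infinite ones included.
  Intersecting with \<open>{1..n}\<close> keeps the cardinality meaningful, so that anticommutation
  with \<open>par\<close> holds for all functions and not just for spinors.\<close>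

lemma par_tog: "k \<in> {1..n} \<Longrightarrow> (- 1 :: complex) ^ card (tog k K \<inter> {1..n}) = - ((- 1) ^ card (K \<inter> {1..n}))"
proof -
  assume "k \<in> {1..n}"
  then have "tog k K \<inter> {1..n} = tog k (K \<inter> {1..n})" by (auto simp: tog_def)
  then show ?thesis using minus_one_card_tog[of "K \<inter> {1..n}" k] by simp
qed

lemma fermi_par_anticommute:
  "k \<in> {1..n} \<Longrightarrow> fermi k a b (par n x) + par n (fermi k a b x) = 0"
  using par_tog[of k n] by (simp add: fermi_def par_def fun_eq_iff)

lemma par_par: "par n (par n x) = x"
  by (simp add: par_def fun_eq_iff flip: power_add mult_2 mult.assoc)

lemma fermi_add: "fermi k a b (x + y) = fermi k a b x + fermi k a b y"
  and fermi_scale: "fermi k a b (fscale c x) = fscale c (fermi k a b x)"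
  and par_add: "par n (x + y) = par n x + par n y"
  and par_scale: "par n (fscale c x) = fscale c (par n x)"
  by (auto simp: fermi_def par_def fun_eq_iff algebra_simps)

lemma spin_space_supp: "spin_space n = supp_on (Pow {1..n})"
  by (auto simp: spin_space_def supp_on_def)

lemma spin_basis_dlt: "spin_basis I = dlt I"
  by (auto simp: spin_basis_def dlt_def)

text \<open>\<open>gam N \<epsilon> j\<close> is the action of \<open>e\<^sub>j\<close>: \<open>e\<^sub>2\<^sub>k\<^sub>-\<^sub>1 = \<psi>\<^sub>k + \<psi>\<^sub>k\<^sup>\<dagger>\<close> and \<open>e\<^sub>2\<^sub>k = - i \<psi>\<^sub>k + i \<psi>\<^sub>k\<^sup>\<dagger>\<close>, and
  the index \<open>2 n + 1\<close> occurs only for odd \<open>N\<close>.\<close>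

definition gam :: "nat \<Rightarrow> complex \<Rightarrow> nat \<Rightarrow> (nat set \<Rightarrow> complex) \<Rightarrow> nat set \<Rightarrow> complex" where
  "gam N \<epsilon> j = (if j = 2 * (N div 2) + 1 then (\<lambda>x. fscale \<epsilon> (par (N div 2) x))
     else if odd j then fermi ((j + 1) div 2) 1 1 else fermi (j div 2) (- \<i>) \<i>)"

lemma gam_cases:
  assumes "j \<in> {1..N}"
  obtains (par) "odd N" "j = N" "gam N \<epsilon> j = (\<lambda>x. fscale \<epsilon> (par (N div 2) x))"
  | (odd) k where "k \<in> {1..N div 2}" "j = 2 * k - 1" "gam N \<epsilon> j = fermi k 1 1"
  | (even) k where "k \<in> {1..N div 2}" "j = 2 * k" "gam N \<epsilon> j = fermi k (- \<i>) \<i>"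
proof (cases "j = 2 * (N div 2) + 1")
  case True
  then have "odd N" "j = N" using assms by (auto elim!: evenE oddE)
  with True show ?thesis by (intro par) (auto simp: gam_def)
next
  case neq: False
  show ?thesis
  proof (cases "odd j")
    case True
    then obtain m where m: "j = 2 * m + 1" by (rule oddE)
    then show ?thesis using assms neq True
      by (intro odd[of "Suc m"]) (auto simp: gam_def)
  next
    case False
    then obtain m where m: "j = 2 * m" by (auto elim: evenE)
    then show ?thesis using assms neq False
      by (intro even[of m]) (auto simp: gam_def)
  qed
qed

lemma gam_add: "gam N \<epsilon> j (x + y) = gam N \<epsilon> j x + gam N \<epsilon> j y"
  and gam_scale: "gam N \<epsilon> j (fscale c x) = fscale c (gam N \<epsilon> j x)"
  by (simp_all add: gam_def fermi_add fermi_scale par_add par_scale fscale.scale_right_distrib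
      mult.commute del: plus_fun_apply fscale_apply)

lemma gam_zero: "gam N \<epsilon> j 0 = 0"
  using gam_scale[of N \<epsilon> j 0 0] by simp

lemma gam_sum: "gam N \<epsilon> j (\<Sum>i\<in>A. f i) = (\<Sum>i\<in>A. gam N \<epsilon> j (f i))"
  by (induction A rule: infinite_finite_induct)
    (simp_all add: gam_zero gam_add del: plus_fun_apply zero_fun_apply sum_fun_apply)

lemma gam_anticommute:
  assumes j: "j \<in> {1..N}" and k: "k \<in> {1..N}" and eps: "\<epsilon> * \<epsilon> = 1"
  shows "gam N \<epsilon> j (gam N \<epsilon> k x) + gam N \<epsilon> k (gam N \<epsilon> j x) = fscale (if j = k then 2 else 0) x"
proof -
  have pf: "fermi i a b (fscale \<epsilon> (par m x)) + fscale \<epsilon> (par m (fermi i a b x)) = 0"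
    if "i \<in> {1..m}" for i m a b
    using fermi_par_anticommute[OF that, of a b x]
    by (simp add: fermi_scale flip: fscale.scale_right_distrib del: plus_fun_apply fscale_apply)
  then have fp: "fscale \<epsilon> (par m (fermi i a b x)) + fermi i a b (fscale \<epsilon> (par m x)) = 0"
    if "i \<in> {1..m}" for i m a b
    using that by (metis add.commute)
  have pp: "fscale \<epsilon> (par m (fscale \<epsilon> (par m x))) = x" for m
    by (simp add: par_scale par_par eps del: fscale_apply)
  have two: "x + x = fscale 2 x" by (simp add: fun_eq_iff)
  \<comment> \<open>Indices of different kinds never coincide, and indices of one kind coincide only
    for equal modes. Subtraction on naturals is truncated, which is why positivity appears as a
    premise.\<close>
  have d: "2 * a - Suc 0 \<noteq> 2 * b" "2 * b \<noteq> 2 * a - Suc 0" if "a > 0" for a b :: nat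
    using that by presburger+
  have e: "(2 * a - Suc 0 = 2 * b - Suc 0) = (a = b)" if "a > 0" "b > 0" for a b :: nat
    using that by auto
  have g: "odd N \<Longrightarrow> N \<noteq> 2 * a" "odd N \<Longrightarrow> 2 * a \<noteq> N" "a \<le> N div 2 \<Longrightarrow> odd N \<Longrightarrow> N \<noteq> 2 * a - Suc 0"
    "a \<le> N div 2 \<Longrightarrow> odd N \<Longrightarrow> 2 * a - Suc 0 \<noteq> N" for a
    by presburger+
  note rl = fermi_anticommute pf fp pp two d e g
  show ?thesis
  proof (cases rule: gam_cases[where \<epsilon>=\<epsilon>, OF j, case_names par odd even])
    case par1: par
    show ?thesis
      by (cases rule: gam_cases[where \<epsilon>=\<epsilon>, OF k])
        (use par1 in \<open>simp_all add: rl del: plus_fun_apply fscale_apply\<close>)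
  next
    case odd1: (odd l)
    show ?thesis
      by (cases rule: gam_cases[where \<epsilon>=\<epsilon>, OF k])
        (use odd1 in \<open>simp_all add: rl del: plus_fun_apply fscale_apply\<close>)
  next
    case even1: (even l)
    show ?thesis
      by (cases rule: gam_cases[where \<epsilon>=\<epsilon>, OF k])
        (use even1 in \<open>simp_all add: rl del: plus_fun_apply fscale_apply\<close>)
  qed
qed

lemma fermi_supp:
  "k \<in> {1..n} \<Longrightarrow> x \<in> supp_on (Pow {1..n}) \<Longrightarrow> fermi k a b x \<in> supp_on (Pow {1..n})"
  by (rule supp_onI) (simp add: fermi_def supp_onD tog_subset)

lemma par_supp: "x \<in> supp_on W \<Longrightarrow> par n x \<in> supp_on W"
  by (rule supp_onI) (simp add: par_def supp_onD)

lemma gam_supp: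
  assumes j: "j \<in> {1..N}" and x: "x \<in> supp_on (Pow {1..N div 2})"
  shows "gam N \<epsilon> j x \<in> supp_on (Pow {1..N div 2})"
  by (rule gam_cases[where \<epsilon>=\<epsilon>, OF j]) (simp_all only: fermi_supp par_supp supp_on_scale x)

section \<open>The spin form\<close>

definition form_sign :: "nat \<Rightarrow> nat set \<Rightarrow> complex" where
  "form_sign N I = (- 1) ^ ((card I choose 2) + (N div 2) * N * card I + inversions I ({1..N div 2} - I))"

lemma spin_form_eq:
  "spin_form N x y = (\<Sum>I\<in>Pow {1..N div 2}. form_sign N I * x I * y ({1..N div 2} - I))"
  by (simp add: spin_form_def form_sign_def Let_def)

lemma spin_form_add_left: "spin_form N (x + x') y = spin_form N x y + spin_form N x' y"
  and spin_form_add_right: "spin_form N x (y + y') = spin_form N x y + spin_form N x y'"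
  and spin_form_scale_left: "spin_form N (fscale c x) y = c * spin_form N x y"
  and spin_form_scale_right: "spin_form N x (fscale c y) = c * spin_form N x y"
  by (auto simp: spin_form_eq algebra_simps sum.distrib sum_distrib_left)

lemma spin_form_zero [simp]: "spin_form N 0 y = 0" "spin_form N x 0 = 0"
  by (simp_all add: spin_form_eq)

lemma spin_form_sum_left: "spin_form N (\<Sum>i\<in>A. f i) y = (\<Sum>i\<in>A. spin_form N (f i) y)"
  by (induction A rule: infinite_finite_induct)
    (simp_all add: spin_form_add_left del: plus_fun_apply zero_fun_apply sum_fun_apply)

lemma spin_form_sum_right: "spin_form N x (\<Sum>i\<in>A. f i) = (\<Sum>i\<in>A. spin_form N x (f i))"
  by (induction A rule: infinite_finite_induct)
    (simp_all add: spin_form_add_right del: plus_fun_apply zero_fun_apply sum_fun_apply)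

lemma form_sign_sq [simp]: "form_sign N I * form_sign N I = 1"
  by (simp add: form_sign_def flip: power_add mult_2)

section \<open>Inversion counts and the signs in the spin form\<close>

lemma inversions_sum:
  assumes "finite I" "finite J"
  shows "inversions I J = (\<Sum>i\<in>I. card {j \<in> J. j < i})"
proof -
  have "{(i, j) \<in> I \<times> J. i > j} = (SIGMA i:I. {j \<in> J. j < i})" by auto
  then show ?thesis using assms by (simp add: inversions_def)
qed

lemma inversions_insert_left:
  assumes "finite I" "finite J" "k \<notin> I"
  shows "inversions (insert k I) J = inversions I J + card {j \<in> J. j < k}"
  using assms by (simp add: inversions_sum)

lemma inversions_insert_right:
  assumes "finite I" "finite J" "k \<notin> J"
  shows "inversions I (insert k J) = inversions I J + card {i \<in> I. k < i}"
proof -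
  have "card {j \<in> insert k J. j < i} = card {j \<in> J. j < i} + (if k < i then 1 else 0)" for i
  proof -
    have "{j \<in> insert k J. j < i} = (if k < i then insert k {j \<in> J. j < i} else {j \<in> J. j < i})"
      by auto
    then show ?thesis using assms by simp
  qed
  then show ?thesis
    using assms by (simp add: inversions_sum sum.distrib sum.If_cases Int_def)
qed

text \<open>For disjoint sets each pair is out of order in exactly one of the two
  arrangements.\<close>

lemma inversions_swap:
  assumes "finite I" "finite J" "I \<inter> J = {}"
  shows "inversions I J + inversions J I = card I * card J"
  using assms
proof (induction I rule: finite_induct)
  case empty
  then show ?case by (simp add: inversions_sum)
next
  case (insert k I)
  have "J = {j \<in> J. j < k} \<union> {j \<in> J. k < j}"
    using insert.prems by (auto simp: not_less_iff_gr_or_eq)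
  moreover have "card ({j \<in> J. j < k} \<union> {j \<in> J. k < j}) = card {j \<in> J. j < k} + card {j \<in> J. k < j}"
    using insert.prems by (intro card_Un_disjoint) auto
  ultimately have "card J = card {j \<in> J. j < k} + card {j \<in> J. k < j}" by simp
  then show ?case
    using insert by (simp add: inversions_insert_left inversions_insert_right)
qed

text \<open>This explains the exponent in \<Phi>_S. Adding \<open>k\<close> to \<open>I\<close>
  raises \<open>card I choose 2\<close> by \<open>card I\<close> and the linear term by n N; among
  the inversions, the pairs formed by \<open>k\<close> and the larger elements of \<open>I\<close>
  are lost, and those formed by \<open>k\<close> and the smaller elements of the complement are
  gained. Since (-1)^(card I) times \<open>below k I\<close> is the sign counting the elements of
  \<open>I\<close> above \<open>k\<close>, it compensates the loss.\<close>

lemma form_sign_insert: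
  assumes I: "I \<subseteq> {1..N div 2}" and k: "k \<in> {1..N div 2}" "k \<notin> I"
  shows "form_sign N (insert k I) * below k I
    = (- 1) ^ (N div 2 * N) * form_sign N I * below k ({1..N div 2} - I)"
proof -
  let ?J = "{1..N div 2} - I"
  let ?J' = "{1..N div 2} - insert k I"
  have fin: "finite I" using I finite_subset by blast
  have J: "?J = insert k ?J'" using k by auto
  have inv1: "inversions (insert k I) ?J' = inversions I ?J' + card {j \<in> ?J'. j < k}"
    using fin k by (intro inversions_insert_left) auto
  have inv2: "inversions I ?J = inversions I ?J' + card {i \<in> I. k < i}"
    using fin k by (subst J, intro inversions_insert_right) auto
  have "{j \<in> ?J. j < k} = {j \<in> ?J'. j < k}" by auto
  then have below: "below k ?J = (- 1) ^ card {j \<in> ?J'. j < k}" by (simp add: below_def)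
  have "I = {i \<in> I. i < k} \<union> {i \<in> I. k < i}" using k by (auto simp: not_less_iff_gr_or_eq)
  then have "card I = card {i \<in> I. i < k} + card {i \<in> I. k < i}"
    using fin by (metis (no_types, lifting) card_Un_disjoint disjoint_iff finite_Un mem_Collect_eq
        not_less_iff_gr_or_eq)
  then have par: "(- 1 :: complex) ^ card I * below k I = (- 1) ^ card {i \<in> I. k < i}"
    by (simp add: below_def power_add mult.assoc mult.left_commute flip: power_mult_distrib)
  have ch: "Suc (card I) choose 2 = (card I choose 2) + card I"
    by (simp add: numeral_2_eq_2)
  have cancel: "(- 1 :: complex) ^ m * (- 1) ^ m = 1" for m
    by (simp flip: power_add mult_2)
  have "form_sign N (insert k I) * below k I
      = (- 1) ^ (card I choose 2) * ((- 1) ^ card I * below k I) * (- 1) ^ (N div 2 * N)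
        * (- 1) ^ (N div 2 * N * card I) * (- 1) ^ inversions I ?J' * below k ?J"
    unfolding form_sign_def inv1 below card_insert_disjoint[OF fin k(2)] ch
    by (simp add: power_add algebra_simps)
  also have "\<dots> = (- 1) ^ (N div 2 * N) * form_sign N I * below k ?J"
    unfolding par form_sign_def inv2 by (simp add: power_add algebra_simps)
  finally show ?thesis .
qed

text \<open>Removing \<open>k\<close> undoes inserting it. All factors are signs, so
  \<open>form_sign_insert\<close> can be solved for the other form sign.\<close>

lemma form_sign_tog:
  assumes I: "I \<subseteq> {1..N div 2}" and k: "k \<in> {1..N div 2}"
  shows "form_sign N (tog k I) * below k I
    = (- 1) ^ (N div 2 * N) * form_sign N I * below k ({1..N div 2} - I)"
proof (cases "k \<in> I")
  case False
  then show ?thesis using form_sign_insert[OF I k] by (simp add: tog_def)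
next
  case True
  let ?K = "tog k I"
  let ?s = "(- 1 :: complex) ^ (N div 2 * N)"
  have K: "?K \<subseteq> {1..N div 2}" "k \<notin> ?K" "insert k ?K = I"
    using I True by (auto simp: tog_def)
  have b: "below k ?K = below k I" "below k ({1..N div 2} - ?K) = below k ({1..N div 2} - I)"
    using k by (simp_all add: below_tog tog_Diff)
  let ?c = "below k ({1..N div 2} - I)" let ?b = "below k I"
  have eq: "form_sign N I * ?b = ?s * form_sign N ?K * ?c"
    using form_sign_insert[OF K(1) k K(2)] K(3) b by simp
  have ss: "?s * ?s = 1" by (simp flip: power_add mult_2)
  have "form_sign N ?K * ?b = (?s * ?s) * (?c * ?c) * (form_sign N ?K * ?b)"
    by (simp only: ss below_below mult_1)
  also have "\<dots> = ?s * ?b * ?c * (?s * form_sign N ?K * ?c)"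
    by (simp only: mult_ac)
  also have "\<dots> = ?s * form_sign N I * ?c * (?b * ?b)"
    unfolding eq[symmetric] by (simp only: mult_ac)
  finally show ?thesis by simp
qed

text \<open>Every gamma operator is self-adjoint up to the same sign. For a fermion operator the
  sign comes from \<open>form_sign_tog\<close>. The parity operator contributes (-1)^n, because the
  sizes of a set and its complement add up to n; it occurs only for odd N, where (-1)^n = (-1)^(n
  N).\<close>

lemma spin_form_gam:
  assumes j: "j \<in> {1..N}"
  shows "spin_form N (gam N \<epsilon> j x) y = (- 1) ^ (N div 2 * N) * spin_form N x (gam N \<epsilon> j y)"
proof -
  let ?n = "N div 2"
  have fermi: "spin_form N (fermi k a b x) y = (- 1) ^ (?n * N) * spin_form N x (fermi k a b y)"
    if k: "k \<in> {1..?n}" for k a b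
  proof -
    have "spin_form N (fermi k a b x) y
        = (\<Sum>I\<in>Pow {1..?n}. form_sign N I * ((if k \<in> I then b else a) * below k I * x (tog k I)) * y ({1..?n} - I))"
      by (simp add: spin_form_eq fermi_def)
    \<comment> \<open>The substitution of \<open>tog k I\<close> for \<open>I\<close> exchanges the
      coefficients \<open>a\<close> and \<open>b\<close>. Passing to the complement in the second
      argument exchanges them once more, so the same operator appears on the right.\<close>
    also have "\<dots> = (\<Sum>I\<in>Pow {1..?n}. form_sign N (tog k I) *
        ((if k \<in> I then a else b) * below k I * x I) * y (tog k ({1..?n} - I)))"
      by (rule sum.reindex_bij_witness[of _ "tog k" "tog k"])
        (use k in \<open>auto simp: tog_subset mem_tog below_tog tog_Diff\<close>)
    also have "\<dots> = (\<Sum>I\<in>Pow {1..?n}. (form_sign N (tog k I) * below k I) *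
        ((if k \<in> I then a else b) * x I * y (tog k ({1..?n} - I))))"
      by (simp add: mult_ac)
    also have "\<dots> = (\<Sum>I\<in>Pow {1..?n}. ((- 1) ^ (?n * N) * form_sign N I * below k ({1..?n} - I)) *
        ((if k \<in> I then a else b) * x I * y (tog k ({1..?n} - I))))"
      using k by (intro sum.cong refl arg_cong2[of _ _ _ _ "(*)"] form_sign_tog) auto
    also have "\<dots> = (- 1) ^ (?n * N) * spin_form N x (fermi k a b y)"
      unfolding spin_form_eq fermi_def sum_distrib_left
      by (rule sum.cong) (use k in \<open>simp_all add: mult_ac\<close>)
    finally show ?thesis .
  qed
  have par: "spin_form N (par ?n x) y = (- 1) ^ (?n * N) * spin_form N x (par ?n y)" if "odd N"
  proof -
    have sign: "(- 1 :: complex) ^ card (I \<inter> {1..?n}) = (- 1) ^ (?n * N) * (- 1) ^ card (({1..?n} - I) \<inter> {1..?n})"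
      if I: "I \<subseteq> {1..?n}" for I
    proof -
      have "I \<inter> {1..?n} = I" "({1..?n} - I) \<inter> {1..?n} = {1..?n} - I" using I by auto
      moreover have "card I + card ({1..?n} - I) = ?n"
        using card_mono[OF _ I] finite_subset[OF I] I by (simp add: card_Diff_subset)
      moreover from this have "even (card I) = even (card ({1..?n} - I)) \<longleftrightarrow> even ?n"
        by (metis even_add)
      ultimately show ?thesis
        using \<open>odd N\<close> unfolding minus_one_power_iff
        by (cases "even (card I)"; cases "even (card ({1..?n} - I))"; cases "even ?n") simp_all
    qed
    show ?thesis
      unfolding spin_form_eq par_def sum_distrib_left
    proof (rule sum.cong)
      fix I assume "I \<in> Pow {1..?n}"
      then have I: "I \<subseteq> {1..?n}" by simp
      show "form_sign N I * ((- 1) ^ card (I \<inter> {1..?n}) * x I) * y ({1..?n} - I)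
        = (- 1) ^ (?n * N) * (form_sign N I * x I *
            ((- 1) ^ card (({1..?n} - I) \<inter> {1..?n}) * y ({1..?n} - I)))"
        unfolding sign[OF I] by (simp only: mult_ac)
    qed simp
  qed
  show ?thesis
  proof (cases rule: gam_cases[where \<epsilon>=\<epsilon>, OF j])
    case 1
    then show ?thesis using par by (simp add: spin_form_scale_left spin_form_scale_right del: fscale_apply)
  next
    case (2 k)
    show ?thesis unfolding 2(3) by (rule fermi[OF 2(1)])
  next
    case (3 k)
    show ?thesis unfolding 3(3) by (rule fermi[OF 3(1)])
  qed
qed

lemma card_choose_2_add: "((a + b) choose 2) = (a choose 2) + (b choose 2) + a * b"
  by (induction a) (auto simp: numeral_2_eq_2)

text \<open>In the product of the two signs the inversions add up to
  \<open>card I * card ?J\<close>, which together with the two binomials is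
  \<open>n choose 2\<close>. The linear terms add up to n^2 N, of the same parity as n N.\<close>

lemma form_sign_compl:
  assumes I: "I \<subseteq> {1..N div 2}"
  shows "form_sign N ({1..N div 2} - I)
    = (- 1) ^ ((N div 2 choose 2) + N div 2 * N) * form_sign N I"
proof -
  let ?n = "N div 2" let ?J = "{1..N div 2} - I"
  have fin: "finite I" using I finite_subset by blast
  have JI: "{1..?n} - ?J = I" using I by auto
  have c: "card I + card ?J = ?n"
    using I fin card_mono[OF _ I] by (simp add: card_Diff_subset)
  have inv: "inversions I ?J + inversions ?J I = card I * card ?J"
    using fin by (intro inversions_swap) auto
  have ch: "?n choose 2 = (card I choose 2) + (card ?J choose 2) + card I * card ?J"
    unfolding card_choose_2_add[symmetric] c ..
  have "form_sign N ?J * form_sign N I = (- 1) ^ ((?n choose 2) + ?n * N * (card I + card ?J))"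
    unfolding form_sign_def JI ch inv[symmetric]
    by (simp add: algebra_simps flip: power_add)
  also have "\<dots> = (- 1) ^ ((?n choose 2) + ?n * N)"
    unfolding c
    by (cases "even ?n"; cases "even N"; cases "even (?n choose 2)") (simp_all add: minus_one_power_iff)
  finally have "form_sign N ?J * form_sign N I * form_sign N I
      = (- 1) ^ ((?n choose 2) + ?n * N) * form_sign N I" by simp
  then show ?thesis by (simp add: mult.assoc)
qed

text \<open>The origin of \<sigma>: a multiple of the flip leaves the form unchanged, as the cap
  relation demands, when the multiple is this sign.\<close>

lemma spin_form_swap:
  "spin_form N y x = (- 1) ^ ((N div 2 choose 2) + N div 2 * N) * spin_form N x y"
proof -
  let ?n = "N div 2"
  have dd: "{1..?n} - ({1..?n} - I) = I" if "I \<subseteq> {1..?n}" for I using that by auto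
  have "spin_form N y x = (\<Sum>I\<in>Pow {1..?n}. form_sign N ({1..?n} - I) * y ({1..?n} - I) * x I)"
    unfolding spin_form_eq
    by (rule sum.reindex_bij_witness[of _ "\<lambda>I. {1..?n} - I" "\<lambda>I. {1..?n} - I"])
      (use dd in \<open>auto simp del: One_nat_def\<close>)
  also have "\<dots> = (- 1) ^ ((?n choose 2) + ?n * N) * spin_form N x y"
    by (auto simp: spin_form_eq form_sign_compl sum_distrib_left simp del: One_nat_def intro!: sum.cong)
  finally show ?thesis .
qed

section \<open>The spin and vector representations\<close>

text \<open>Otherwise \<open>{1..n}\<close> is rewritten to \<open>{Suc 0..n}\<close>, which no longer matches the statements below.\<close>

declare One_nat_def [simp del]

locale spin_setup =
  fixes Q :: "'v::ab_group_add quad_space" and e :: "nat \<Rightarrow> 'v" and \<epsilon> :: complex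
  assumes quad: "quadratic_space Q" and onb: "orthonormal_basis Q e" and eps: "\<epsilon> \<in> {1, - 1}"
begin

abbreviation "N \<equiv> qdim Q"
abbreviation "n \<equiv> qdim Q div 2"
abbreviation "Spinors \<equiv> supp_on (Pow {1..n})"

sublocale vs: vector_space "vscale Q"
  using quad by (simp add: quadratic_space_def)

lemma vform_sym: "vform Q v w = vform Q w v"
  using quad by (auto simp: quadratic_space_def)

lemma vform_linear: "Vector_Spaces.linear (vscale Q) (*) (vform Q v)"
  using quad by (auto simp: quadratic_space_def)

lemma vform_add_right: "vform Q u (v + w) = vform Q u v + vform Q u w"
  by (rule module_hom.add[OF Vector_Spaces.linear.axioms(3)[OF vform_linear]])

lemma vform_scale_right: "vform Q u (vscale Q c v) = c * vform Q u v"
  by (rule module_hom.scale[OF Vector_Spaces.linear.axioms(3)[OF vform_linear]])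

lemma vform_zero_right: "vform Q u 0 = 0"
  by (rule module_hom.zero[OF Vector_Spaces.linear.axioms(3)[OF vform_linear]])

lemma vform_sum_right: "vform Q u (\<Sum>i\<in>A. f i) = (\<Sum>i\<in>A. vform Q u (f i))"
  by (rule module_hom.sum[OF Vector_Spaces.linear.axioms(3)[OF vform_linear]])

lemma vform_e: "i \<in> {1..N} \<Longrightarrow> j \<in> {1..N} \<Longrightarrow> vform Q (e i) (e j) = (if i = j then 1 else 0)"
  using onb by (auto simp: orthonormal_basis_def)

lemma span_e: "vs.span (e ` {1..N}) = UNIV"
  using onb by (auto simp: orthonormal_basis_def)

lemma vec_expand: "v = (\<Sum>i\<in>{1..N}. vscale Q (vform Q (e i) v) (e i))"
proof -
  have "v \<in> vs.span (e ` {1..N})" using span_e by simp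
  then show ?thesis
  proof (induction rule: vs.span_induct_alt)
    case base
    then show ?case by (simp add: vform_zero_right)
  next
    case (step c x y)
    then obtain j where j: "j \<in> {1..N}" "x = e j" by blast
    have "(\<Sum>i\<in>{1..N}. vscale Q (c * vform Q (e i) (e j)) (e i)) = vscale Q c (e j)"
      using j by (subst sum.remove[of _ j]) (auto simp: vform_e intro!: sum.neutral)
    then show ?case using step(2)
      by (simp add: j vform_add_right vform_scale_right vs.scale_left_distrib sum.distrib)
  qed
qed

lemma vec_eqI: "(\<And>i. i \<in> {1..N} \<Longrightarrow> vform Q (e i) v = vform Q (e i) w) \<Longrightarrow> v = w"
  by (subst vec_expand[of v], subst vec_expand[of w]) simp

lemma vform_expand: "vform Q v w = (\<Sum>i\<in>{1..N}. vform Q (e i) v * vform Q (e i) w)"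
proof -
  have "vform Q v w = vform Q v (\<Sum>i\<in>{1..N}. vscale Q (vform Q (e i) w) (e i))"
    using vec_expand[of w] by simp
  then show ?thesis
    by (simp add: vform_sum_right vform_scale_right vform_sym[of v] mult.commute)
qed

definition cliff :: "'v \<Rightarrow> (nat set \<Rightarrow> complex) \<Rightarrow> nat set \<Rightarrow> complex" where
  "cliff v x = (\<Sum>j\<in>{1..N}. fscale (vform Q (e j) v) (gam N \<epsilon> j x))"

lemma cliff_e: "j \<in> {1..N} \<Longrightarrow> cliff (e j) x = gam N \<epsilon> j x"
  unfolding cliff_def
  by (subst sum.remove[of _ j]) (auto simp: vform_e intro!: sum.neutral simp del: fscale_apply)

lemma cliff_cliff:
  "cliff v (cliff w x) =
    (\<Sum>j\<in>{1..N}. \<Sum>k\<in>{1..N}. fscale (vform Q (e j) v * vform Q (e k) w) (gam N \<epsilon> j (gam N \<epsilon> k x)))"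
  by (simp add: cliff_def gam_sum gam_scale fscale.scale_sum_right del: fscale_apply sum_fun_apply)

lemma eps_sq: "\<epsilon> * \<epsilon> = 1"
  using eps by auto

text \<open>In orthonormal coordinates the mixed terms cancel by \<open>gam_anticommute\<close>; the
  diagonal ones leave twice the sum of the products of coordinates, which is 2 \<Phi>_V(v,
  w).\<close>

sublocale rep: clifford_rep Q cliff
proof
  fix v w :: 'v and x y :: "nat set \<Rightarrow> complex" and c
  show "cliff v (x + y) = cliff v x + cliff v y"
    by (simp add: cliff_def gam_add fscale.scale_right_distrib sum.distrib
        del: plus_fun_apply fscale_apply sum_fun_apply)
  show "cliff v (fscale c x) = fscale c (cliff v x)"
    by (simp add: cliff_def gam_scale fscale.scale_sum_right mult.commute
        del: fscale_apply sum_fun_apply)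
  show "cliff (v + w) x = cliff v x + cliff w x"
    by (simp add: cliff_def vform_add_right fscale.scale_left_distrib sum.distrib
        del: plus_fun_apply fscale_apply sum_fun_apply)
  show "cliff (vscale Q c v) x = fscale c (cliff v x)"
    by (simp add: cliff_def vform_scale_right fscale.scale_sum_right del: fscale_apply sum_fun_apply)
  let ?c = "\<lambda>j k. vform Q (e j) v * vform Q (e k) w"
  have "cliff w (cliff v x) = (\<Sum>j\<in>{1..N}. \<Sum>k\<in>{1..N}. fscale (?c j k) (gam N \<epsilon> k (gam N \<epsilon> j x)))"
    unfolding cliff_cliff by (subst sum.swap) (simp only: mult.commute)
  then have "cliff v (cliff w x) + cliff w (cliff v x)
      = (\<Sum>j\<in>{1..N}. \<Sum>k\<in>{1..N}. fscale (?c j k) (gam N \<epsilon> j (gam N \<epsilon> k x) + gam N \<epsilon> k (gam N \<epsilon> j x)))"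
    by (simp only: cliff_cliff fscale.scale_right_distrib sum.distrib)
  also have "\<dots> = (\<Sum>j\<in>{1..N}. \<Sum>k\<in>{1..N}. fscale (?c j k * (if j = k then 2 else 0)) x)"
    by (rule sum.cong[OF HOL.refl], rule sum.cong[OF HOL.refl])
      (simp only: gam_anticommute[OF _ _ eps_sq] fscale.scale_scale)
  also have "\<dots> = (\<Sum>j\<in>{1..N}. fscale (?c j j * 2) x)"
  proof (intro sum.cong HOL.refl)
    fix j assume j: "j \<in> {1..N}"
    show "(\<Sum>k\<in>{1..N}. fscale (?c j k * (if j = k then 2 else 0)) x) = fscale (?c j j * 2) x"
      using j by (subst sum.remove[of _ j]) (auto intro!: sum.neutral simp del: fscale_apply)
  qed
  also have "\<dots> = fscale (2 * vform Q v w) x"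
    unfolding vform_expand[of v w]
    by (simp only: fscale.scale_sum_left[symmetric] sum_distrib_left mult.commute)
  finally show "cliff v (cliff w x) + cliff w (cliff v x) = fscale (2 * vform Q v w) x" .
qed

lemma cliff_supp: "x \<in> Spinors \<Longrightarrow> cliff v x \<in> Spinors"
  unfolding cliff_def by (intro supp_on_sum supp_on_scale gam_supp)

lemma cl_op_supp: "a \<in> carrier (Cl Q) \<Longrightarrow> x \<in> Spinors \<Longrightarrow> rep.cl_op a x \<in> Spinors"
proof (induction a rule: cl_induct)
  case one
  then show ?case by (simp add: rep.cl_op_one)
next
  case (add a b)
  then show ?case by (simp add: rep.cl_op_add del: plus_fun_apply)
next
  case (scale c a)
  then show ?case by (simp add: rep.cl_op_scale del: fscale_apply)
next
  case (vec v a)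
  then show ?case by (simp add: rep.cl_op_mult rep.cl_op_vec cliff_supp)
qed

lemma spin_index:
  assumes "i \<in> {1..n}"
  shows "2 * i - 1 \<in> {1..N}" "2 * i \<in> {1..N}"
    "gam N \<epsilon> (2 * i - 1) = fermi i 1 1" "gam N \<epsilon> (2 * i) = fermi i (- \<i>) \<i>"
proof -
  show "2 * i - 1 \<in> {1..N}" "2 * i \<in> {1..N}" using assms by auto
  have "2 * i - 1 \<noteq> 2 * n + 1" "odd (2 * i - 1)" "(2 * i - 1 + 1) div 2 = i"
    using assms by auto
  then show "gam N \<epsilon> (2 * i - 1) = fermi i 1 1" unfolding gam_def by simp
  have "2 * i \<noteq> 2 * n + 1" by presburger
  then show "gam N \<epsilon> (2 * i) = fermi i (- \<i>) \<i>" by (simp add: gam_def)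
qed

lemma cliff_psi:
  assumes i: "i \<in> {1..n}"
  shows "cliff (psi Q e i) x = fermi i 1 0 x" "cliff (psi_dag Q e i) x = fermi i 0 1 x"
proof -
  note s = spin_index[OF i]
  have m: "cliff (u - w) x = cliff u x - cliff w x" for u w
    by (metis add_diff_cancel diff_add_cancel rep.T_vec_add)
  show "cliff (psi Q e i) x = fermi i 1 0 x"
    unfolding psi_def rep.T_vec_scale rep.T_vec_add cliff_e[OF s(1)] cliff_e[OF s(2)] s
    by (auto simp: fermi_def fun_eq_iff algebra_simps)
  show "cliff (psi_dag Q e i) x = fermi i 0 1 x"
    unfolding psi_dag_def rep.T_vec_scale m cliff_e[OF s(1)] cliff_e[OF s(2)] s
    by (auto simp: fermi_def fun_eq_iff algebra_simps)
qed

text \<open>The defining formulas of \<psi> and its dagger solved for the orthonormal basis. The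
  spin action is prescribed on the former, whereas V is spanned by the latter.\<close>

lemma e_psi:
  "e (2 * i - 1) = psi Q e i + psi_dag Q e i"
  "e (2 * i) = vscale Q (- \<i>) (psi Q e i + vscale Q (- 1) (psi_dag Q e i))"
proof -
  have "vscale Q (1/2) x + vscale Q (1/2) x = x" for x
    by (simp flip: vs.scale_left_distrib)
  then have half: "vscale Q (1/2) (x + y) + vscale Q (1/2) (x - y) = x" for x y
    by (simp add: vs.scale_right_distrib vs.scale_right_diff_distrib)
  show "e (2 * i - 1) = psi Q e i + psi_dag Q e i"
    unfolding psi_def psi_dag_def half ..
  have "vscale Q (1/2) (x + y) - vscale Q (1/2) (x - y) = y" for x y
    using half[of y x] by (simp add: vs.scale_right_distrib vs.scale_right_diff_distrib algebra_simps)
  then have "psi Q e i - psi_dag Q e i = vscale Q \<i> (e (2 * i))"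
    unfolding psi_def psi_dag_def .
  then show "e (2 * i) = vscale Q (- \<i>) (psi Q e i + vscale Q (- 1) (psi_dag Q e i))"
    by simp
qed

lemma fermi_dlt:
  assumes I: "I \<subseteq> {1..n}"
  shows "fermi i 0 1 (dlt I) = wedge (spin_basis {i}) (spin_basis I)"
    and "fermi i 1 0 (dlt I) = (if i \<in> I then fscale ((- 1) ^ card {j \<in> I. j < i}) (spin_basis (I - {i})) else 0)"
proof -
  have fin: "finite I" using I finite_subset by blast
  show "fermi i 0 1 (dlt I) = wedge (spin_basis {i}) (spin_basis I)"
  proof
    fix K
    show "fermi i 0 1 (dlt I) K = wedge (spin_basis {i}) (spin_basis I) K"
    proof (cases "i \<in> K \<and> K - {i} = I")
      case True
      then have K: "K = insert i I" "i \<notin> I" "finite K" using fin by auto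
      have "{(a, j) \<in> {i} \<times> I. a > j} = Pair i ` {j \<in> I. j < i}" by auto
      then have inv: "inversions {i} I = card {j \<in> I. j < i}"
        by (simp add: inversions_def card_image inj_on_def)
      have "{j \<in> K. j < i} = {j \<in> I. j < i}" using K by auto
      then have "fermi i 0 1 (dlt I) K = (- 1) ^ inversions {i} I"
        using True by (simp add: fermi_def below_def tog_def dlt_apply inv)
      \<comment> \<open>Of all splittings of \<open>K\<close> only the one into \<open>{i}\<close>
        and \<open>I\<close> meets both basis vectors.\<close>
      moreover have "wedge (spin_basis {i}) (spin_basis I) K
          = (\<Sum>J\<in>Pow K. if J = {i} then (- 1) ^ inversions {i} I else 0)"
        unfolding wedge_def using True by (intro sum.cong) (auto simp: spin_basis_def)
      ultimately show ?thesis using K by simp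
    next
      case False
      then have "fermi i 0 1 (dlt I) K = 0"
        by (auto simp: fermi_def tog_def dlt_apply)
      moreover have "wedge (spin_basis {i}) (spin_basis I) K = 0"
        unfolding wedge_def using False by (intro sum.neutral) (auto simp: spin_basis_def)
      ultimately show ?thesis by simp
    qed
  qed
  have "{j \<in> I - {i}. j < i} = {j \<in> I. j < i}" by auto
  then have "below i (I - {i}) = (- 1) ^ card {j \<in> I. j < i}"
    by (simp add: below_def)
  then show "fermi i 1 0 (dlt I) = (if i \<in> I then fscale ((- 1) ^ card {j \<in> I. j < i}) (spin_basis (I - {i})) else 0)"
    by (auto simp: fermi_def fun_eq_iff spin_basis_def tog_def dlt_apply)
qed

lemma gam_top_dlt:
  assumes "odd N" "I \<subseteq> {1..n}"
  shows "gam N \<epsilon> N (dlt I) = fscale (\<epsilon> * (- 1) ^ card I) (spin_basis I)"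
proof -
  have "N = 2 * n + 1" using assms(1) by presburger
  then have "gam N \<epsilon> N = (\<lambda>x. fscale \<epsilon> (par n x))"
    unfolding gam_def by metis
  moreover have "I \<inter> {1..n} = I" using assms(2) by auto
  ultimately show ?thesis
    by (auto simp: fun_eq_iff par_def dlt_apply spin_basis_def)
qed

section \<open>Existence and uniqueness of the prescribed spin action\<close>

lemma restrict_cl_op_lin:
  "a \<in> carrier (Cl Q) \<Longrightarrow> restrict (rep.cl_op a) Spinors \<in> lin_maps fscale fscale Spinors Spinors"
  by (rule lin_mapsI) (simp_all add: cl_op_supp rep.cl_op_arg_add rep.cl_op_arg_scale
      del: plus_fun_apply fscale_apply)

lemma is_spin_action_cl_op:
  "is_spin_action Q e \<epsilon> (\<lambda>a\<in>carrier (Cl Q). \<lambda>x\<in>Spinors. rep.cl_op a x)" (is "is_spin_action _ _ _ ?r")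
proof -
  have v: "?r (cl_vec Q v) (spin_basis I) = cliff v (dlt I)" if "I \<subseteq> {1..n}" for v I
    using that by (simp add: spin_basis_dlt rep.cl_op_vec)
  show ?thesis
    unfolding is_spin_action_def Let_def spin_space_supp
  proof (intro conjI ballI allI impI)
    show "?r \<in> carrier (Cl Q) \<rightarrow>\<^sub>E lin_maps fscale fscale Spinors Spinors"
      using restrict_cl_op_lin by auto
    show "?r \<one>\<^bsub>Cl Q\<^esub> x = x" if "x \<in> Spinors" for x
      using that by (simp add: rep.cl_op_one)
    fix a b x assume "a \<in> carrier (Cl Q)" "b \<in> carrier (Cl Q)" "x \<in> Spinors"
    then show "?r (a \<oplus>\<^bsub>Cl Q\<^esub> b) x = ?r a x + ?r b x" "?r (a \<otimes>\<^bsub>Cl Q\<^esub> b) x = ?r a (?r b x)"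
      by (simp_all add: rep.cl_op_add rep.cl_op_mult cl_op_supp)
  next
    fix c a x assume "a \<in> carrier (Cl Q)" "x \<in> Spinors"
    then show "?r (cl_scale Q c a) x = fscale c (?r a x)"
      by (simp add: rep.cl_op_scale del: fscale_apply)
  next
    fix i I assume i: "i \<in> {1..n}" and I: "I \<subseteq> {1..n}"
    show "?r (cl_vec Q (psi_dag Q e i)) (spin_basis I) = wedge (spin_basis {i}) (spin_basis I)"
      unfolding v[OF I] cliff_psi[OF i] by (rule fermi_dlt[OF I])
    show "?r (cl_vec Q (psi Q e i)) (spin_basis I) =
          (if i \<in> I then fscale ((- 1) ^ card {j\<in>I. j < i}) (spin_basis (I - {i})) else 0)"
      unfolding v[OF I] cliff_psi[OF i] by (rule fermi_dlt[OF I])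
  next
    fix I assume odd: "odd N" and I: "I \<subseteq> {1..n}"
    then have "N \<in> {1..N}" by (auto elim: oddE)
    then show "?r (cl_vec Q (e N)) (spin_basis I) = fscale (\<epsilon> * (- 1) ^ card I) (spin_basis I)"
      unfolding v[OF I] by (simp only: cliff_e gam_top_dlt[OF odd I])
  qed
qed

text \<open>The prescription fixes the \<psi>, their daggers and, for odd N, the last basis vector
  on all x_I. The vectors on which \<open>r\<close> agrees with \<open>cliff\<close> form a
  subspace; by \<open>e_psi\<close> it contains the orthonormal basis, hence is V, and words in
  vectors then reach all of Cl(V).\<close>

lemma is_spin_action_unique:
  assumes r: "is_spin_action Q e \<epsilon> r" and a: "a \<in> carrier (Cl Q)" and x: "x \<in> Spinors"
  shows "r a x = rep.cl_op a x"
proof -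
  note r' = r[unfolded is_spin_action_def Let_def spin_space_supp]
  note c1 = conjunct1[OF r'] and r2 = conjunct2[OF r']
  note c2 = conjunct1[OF r2] and r3 = conjunct2[OF r2]
  note c3 = conjunct1[OF r3] and r4 = conjunct2[OF r3]
  note c4 = conjunct1[OF r4] and r5 = conjunct2[OF r4]
  note c5 = conjunct1[OF r5] and c6 = conjunct2[OF r5]
  have lin: "r a \<in> lin_maps fscale fscale Spinors Spinors" if "a \<in> carrier (Cl Q)" for a
    using c1 that by (auto simp: PiE_def)
  have rone: "r \<one>\<^bsub>Cl Q\<^esub> x = x" if "x \<in> Spinors" for x
    by (rule bspec[OF c2 that])
  have radd: "r (a \<oplus>\<^bsub>Cl Q\<^esub> b) x = r a x + r b x" and rmult: "r (a \<otimes>\<^bsub>Cl Q\<^esub> b) x = r a (r b x)"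
    if "a \<in> carrier (Cl Q)" "b \<in> carrier (Cl Q)" "x \<in> Spinors" for a b x
    using bspec[OF bspec[OF bspec[OF c3 that(1)] that(2)] that(3)] by (rule conjunct1, rule conjunct2)
  have rscale: "r (cl_scale Q c a) x = fscale c (r a x)"
    if "a \<in> carrier (Cl Q)" "x \<in> Spinors" for c a x
    by (rule bspec[OF bspec[OF spec[OF c4] that(1)] that(2)])
  have rpsi: "r (cl_vec Q (psi_dag Q e i)) (spin_basis I) = fermi i 0 1 (dlt I)"
      "r (cl_vec Q (psi Q e i)) (spin_basis I) = fermi i 1 0 (dlt I)"
    if "i \<in> {1..n}" "I \<subseteq> {1..n}" for i I
    using mp[OF spec[OF bspec[OF c5 that(1)]] that(2)] unfolding fermi_dlt[OF that(2)]
    by (rule conjunct1, rule conjunct2)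
  have rtop: "r (cl_vec Q (e N)) (spin_basis I) = gam N \<epsilon> N (dlt I)" if "odd N" "I \<subseteq> {1..n}" for I
    unfolding gam_top_dlt[OF that] by (rule mp[OF spec[OF mp[OF c6 that(1)]] that(2)])
  let ?L = "{v. \<forall>x\<in>Spinors. r (cl_vec Q v) x = cliff v x}"
  have basis: "v \<in> ?L" if "\<And>I. I \<subseteq> {1..n} \<Longrightarrow> r (cl_vec Q v) (spin_basis I) = cliff v (dlt I)" for v
  proof -
    have "r (cl_vec Q v) = restrict (rep.cl_op (cl_vec Q v)) Spinors"
    proof (rule lin_maps_eqI[OF fscale.vector_space_axioms lin restrict_cl_op_lin])
      fix I assume "I \<in> Pow {1..n}"
      then show "r (cl_vec Q v) (dlt I) = restrict (rep.cl_op (cl_vec Q v)) Spinors (dlt I)"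
        using that[of I] by (simp add: rep.cl_op_vec spin_basis_dlt)
    qed simp_all
    then show ?thesis by (simp add: rep.cl_op_vec)
  qed
  have psi: "psi_dag Q e i \<in> ?L" "psi Q e i \<in> ?L" if i: "i \<in> {1..n}" for i
    by (rule basis, simp add: cliff_psi[OF i] rpsi[OF i])+
  have add': "v + w \<in> ?L" if "v \<in> ?L" "w \<in> ?L" for v w
    using that by (simp add: cl_vec_add radd rep.T_vec_add del: plus_fun_apply)
  have scale': "vscale Q c v \<in> ?L" if "v \<in> ?L" for v c
    using that by (simp add: cl_vec_scale rscale rep.T_vec_scale del: fscale_apply)
  have e: "e j \<in> ?L" if j: "j \<in> {1..N}" for j
  proof (cases rule: gam_cases[OF j, of \<epsilon>])
    case 1
    have "e N \<in> ?L"
      by (rule basis) (use 1 j in \<open>simp add: rtop cliff_e\<close>)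
    then show ?thesis using 1 by simp
  next
    case (2 k)
    show ?thesis unfolding 2(2) e_psi(1) by (intro add' psi 2(1))
  next
    case (3 k)
    show ?thesis unfolding 3(2) e_psi(2) by (intro add' scale' psi 3(1))
  qed
  have "(0::'v) \<in> ?L"
    using cl_vec_scale[of Q 0 0] rep.T_vec_scale[of 0 0] rscale[of "cl_vec Q 0" _ 0] by simp
  then have "vs.subspace ?L"
    by (intro vs.subspaceI add' scale')
  moreover have "e ` {1..N} \<subseteq> ?L"
    by (rule image_subsetI) (rule e)
  ultimately have "vs.span (e ` {1..N}) \<subseteq> ?L"
    by (intro vs.span_minimal)
  then have L: "r (cl_vec Q v) x = cliff v x" if "x \<in> Spinors" for v x
    using that unfolding span_e by blast
  show ?thesis
    using a x
  proof (induction a arbitrary: x rule: cl_induct)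
    case one
    then show ?case by (simp add: rone rep.cl_op_one)
  next
    case (add a b)
    then show ?case by (simp add: radd rep.cl_op_add del: plus_fun_apply)
  next
    case (scale c a)
    then show ?case by (simp add: rscale rep.cl_op_scale del: fscale_apply)
  next
    case (vec v a)
    then show ?case
      by (simp add: rmult rep.cl_op_mult rep.cl_op_vec cl_op_supp L)
  qed
qed

text \<open>Existence and uniqueness together give meaning to the definite description of
  \<open>spin_action\<close>. Uniqueness as a function also uses that every candidate is
  \<open>undefined\<close> off its domain.\<close>

lemma spin_action_eq:
  assumes "a \<in> carrier (Cl Q)" "x \<in> Spinors"
  shows "spin_action Q e \<epsilon> a x = rep.cl_op a x"
proof -
  have "is_spin_action Q e \<epsilon> (spin_action Q e \<epsilon>)"
    unfolding spin_action_def
  proof (rule theI[where P = "is_spin_action Q e \<epsilon>", OF is_spin_action_cl_op])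
    fix r assume r: "is_spin_action Q e \<epsilon> r"
    then have ext: "r \<in> carrier (Cl Q) \<rightarrow>\<^sub>E lin_maps fscale fscale Spinors Spinors"
      by (simp add: is_spin_action_def Let_def spin_space_supp)
    show "r = (\<lambda>a\<in>carrier (Cl Q). \<lambda>x\<in>Spinors. rep.cl_op a x)"
    proof (rule extensionalityI)
      show "r \<in> extensional (carrier (Cl Q))" using ext by (simp add: PiE_def)
      fix a assume a: "a \<in> carrier (Cl Q)"
      then have "r a \<in> lin_maps fscale fscale Spinors Spinors" using ext by auto
      from lin_maps_restrict[OF this is_spin_action_unique[OF r a]] a
      show "r a = (\<lambda>a\<in>carrier (Cl Q). \<lambda>x\<in>Spinors. rep.cl_op a x) a" by simp
    qed auto
  qed
  from is_spin_action_unique[OF this assms] show ?thesis .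
qed

subsection \<open>Invariance of the spin form\<close>

abbreviation "\<kappa> \<equiv> (- 1 :: complex) ^ (n * N)"
abbreviation "\<sigma> \<equiv> (- 1 :: complex) ^ ((n choose 2) + n * N)"

lemma spin_form_cliff: "spin_form N (cliff v x) y = \<kappa> * spin_form N x (cliff v y)"
  unfolding cliff_def spin_form_sum_left spin_form_sum_right spin_form_scale_left
    spin_form_scale_right sum_distrib_left
proof (rule sum.cong)
  fix j assume "j \<in> {1..N}"
  from spin_form_gam[OF this] show "vform Q (e j) v * spin_form N (gam N \<epsilon> j x) y
      = \<kappa> * (vform Q (e j) v * spin_form N x (gam N \<epsilon> j y))"
    by (simp only: mult.left_commute)
qed (rule HOL.refl)

lemma kappa_sq: "\<kappa> * \<kappa> = 1" and sigma_sq: "\<sigma> * \<sigma> = 1"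
  by (simp_all flip: power_mult_distrib)

text \<open>The letters are moved across the form one at a time from the outside, so they arrive in
  reverse order, each at the price of one \<kappa>.\<close>

lemma spin_form_word_op:
  "spin_form N (word_op cliff w x) y = \<kappa> ^ length w * spin_form N x (word_op cliff (rev w) y)"
proof (induction w arbitrary: y)
  case (Cons v w)
  then show ?case by (simp add: spin_form_cliff word_op_append)
qed simp

lemma spin_form_free_op:
  assumes "\<And>w. w \<in> Poly_Mapping.keys a \<Longrightarrow> \<kappa> ^ length w = 1"
  shows "spin_form N (free_op cliff a x) y = spin_form N x (free_op cliff (rev_free a) y)"
proof -
  have "rev -` A = rev ` A" for A :: "'v list set"
  proof
    show "rev -` A \<subseteq> rev ` A"
    proof
      fix w assume "w \<in> rev -` A"
      then show "w \<in> rev ` A" using imageI[of "rev w" A rev] by simp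
    qed
  qed auto
  then have "Poly_Mapping.keys (rev_free a) = rev ` Poly_Mapping.keys a"
    by (simp add: keys_map_key)
  then have "free_op cliff (rev_free a) y
      = (\<Sum>w\<in>Poly_Mapping.keys a. fscale (Poly_Mapping.lookup a w) (word_op cliff (rev w) y))"
    by (simp add: free_op_def sum.reindex map_key.rep_eq)
  then show ?thesis
    using assms by (simp add: free_op_def spin_form_sum_left spin_form_sum_right spin_form_scale_left
        spin_form_scale_right spin_form_word_op del: sum_fun_apply fscale_apply)
qed

lemma spin_form_GV:
  assumes g: "g \<in> GV Q"
  shows "spin_form N (rep.cl_op g x) (rep.cl_op g y) = spin_form N x y"
proof -
  note P = GV_subset_Pin[OF g]
  \<comment> \<open>For even N any representative works, as \<kappa> = 1. For odd N the group is
    Spin, whose elements are represented on words of even length, where the powers of \<kappa> are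
    1.\<close>
  obtain a where a: "g = cl_class Q a" "\<And>w. w \<in> Poly_Mapping.keys a \<Longrightarrow> \<kappa> ^ length w = 1"
  proof (cases "even N")
    case True
    obtain a where "g = cl_class Q a" using Pin_closed[OF P] unfolding cl_carrier by (rule rangeE)
    moreover have "\<kappa> = 1" using True by simp
    ultimately show thesis by (intro that[of a]) (simp_all only: power_one)
  next
    case False
    then have "g \<in> cl_even Q" using g by (simp add: GV_def Spin_def)
    then obtain a where a: "g = cl_class Q a" "\<forall>w\<in>Poly_Mapping.keys a. even (length w)"
      unfolding cl_even_def by blast
    have ev: "\<kappa> ^ m = 1" if "even m" for m :: nat
      using that by (simp flip: power_mult)
    show thesis
      by (rule that[OF a(1)], rule ev, rule bspec[OF a(2)])
  qed
  have "spin_form N (rep.cl_op g x) (rep.cl_op g y) = spin_form N x (rep.cl_op (cl_iota Q g) (rep.cl_op g y))"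
    using spin_form_free_op[OF a(2)] by (simp add: a(1) cl_iota_class rep.cl_op_class)
  then show ?thesis
    using rep.cl_op_mult[of "cl_iota Q g" g y] Pin_iota_left[OF P] Pin_closed[OF P]
    by (simp add: rep.cl_op_one)
qed

subsection \<open>The vector representation\<close>

text \<open>The vacuum coefficient of the Clifford relation. It makes \<Phi>_V, and with it the
  coordinates of a vector, visible in the spin representation.\<close>

lemma cliff_pair: "2 * vform Q v w = cliff v (cliff w (dlt {})) {} + cliff w (cliff v (dlt {})) {}"
  using fun_cong[OF rep.T_clifford[of v w "dlt {}"], of "{}"] by (simp add: dlt_apply)

text \<open>Vectors with the same class act equally on S, hence by \<open>cliff_pair\<close> pair
  equally with every vector. This also makes the vector action well defined.\<close>

lemma cl_vec_inj: "cl_vec Q v = cl_vec Q w \<longleftrightarrow> v = w"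
proof
  assume "cl_vec Q v = cl_vec Q w"
  then have c: "cliff v x = cliff w x" for x
    using rep.cl_op_vec[of v x] rep.cl_op_vec[of w x] by simp
  have "2 * vform Q v u = 2 * vform Q w u" for u
    unfolding cliff_pair c by (rule HOL.refl)
  then have "vform Q u v = vform Q u w" for u
    using vform_sym[of u v] vform_sym[of u w] by simp
  then show "v = w" by (rule vec_eqI)
qed simp

lemma cl_vec_vec_action:
  assumes "g \<in> Pin Q"
  shows "cl_vec Q (vec_action Q g v) = g \<otimes>\<^bsub>Cl Q\<^esub> cl_vec Q v \<otimes>\<^bsub>Cl Q\<^esub> inv\<^bsub>Cl Q\<^esub> g"
proof -
  obtain w where w: "cl_vec Q w = g \<otimes>\<^bsub>Cl Q\<^esub> cl_vec Q v \<otimes>\<^bsub>Cl Q\<^esub> inv\<^bsub>Cl Q\<^esub> g"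
    by (rule Pin_conj_vec[OF assms])
  show ?thesis
    unfolding vec_action_def by (rule theI, rule w) (metis w cl_vec_inj)
qed

context
  fixes g assumes g: "g \<in> Pin Q"
begin

lemma cliff_vec_action: "cliff (vec_action Q g v) x = rep.cl_op g (cliff v (rep.cl_op (cl_iota Q g) x))"
proof -
  have "cliff (vec_action Q g v) x = rep.cl_op (cl_vec Q (vec_action Q g v)) x"
    by (simp add: rep.cl_op_vec)
  also have "\<dots> = rep.cl_op g (cliff v (rep.cl_op (cl_iota Q g) x))"
    using Pin_closed[OF g]
    by (simp add: cl_vec_vec_action[OF g] Pin_inv[OF g] rep.cl_op_mult rep.cl_op_vec)
  finally show ?thesis .
qed

lemma cl_op_iota_cancel: "rep.cl_op (cl_iota Q g) (rep.cl_op g x) = x" "rep.cl_op g (rep.cl_op (cl_iota Q g) x) = x"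
  using rep.cl_op_mult[of "cl_iota Q g" g x] rep.cl_op_mult[of g "cl_iota Q g" x]
    Pin_iota_left[OF g] Pin_iota_right[OF g] Pin_closed[OF g]
  by (simp_all add: rep.cl_op_one)

lemma cliff_vec_action': "cliff (vec_action Q g v) (rep.cl_op g x) = rep.cl_op g (cliff v x)"
  by (simp add: cliff_vec_action cl_op_iota_cancel)

lemma vec_action_add: "vec_action Q g (v + w) = vec_action Q g v + vec_action Q g w"
  using Pin_closed[OF g]
  by (subst cl_vec_inj[symmetric])
    (simp add: cl_vec_vec_action[OF g] cl_vec_add Pin_inv[OF g] cl.r_distr cl.l_distr)

lemma vec_action_scale: "vec_action Q g (vscale Q c v) = vscale Q c (vec_action Q g v)"
  using Pin_closed[OF g]
  by (subst cl_vec_inj[symmetric])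
    (simp add: cl_vec_vec_action[OF g] cl_vec_scale Pin_inv[OF g] cl_scale_mult_left cl_scale_mult_right)

text \<open>The anticommutator of two vectors is the scalar 2 \<Phi>_V, and conjugation fixes
  scalars; the two scalars are compared on the vacuum.\<close>

lemma vform_vec_action: "vform Q (vec_action Q g v) (vec_action Q g w) = vform Q v w"
proof -
  have "cliff (vec_action Q g v) (cliff (vec_action Q g w) x) + cliff (vec_action Q g w) (cliff (vec_action Q g v) x)
      = rep.cl_op g (cliff v (cliff w (rep.cl_op (cl_iota Q g) x)) + cliff w (cliff v (rep.cl_op (cl_iota Q g) x)))" for x :: "nat set \<Rightarrow> complex"
    by (simp add: cliff_vec_action cl_op_iota_cancel rep.cl_op_arg_add del: plus_fun_apply)
  then have "fscale (2 * vform Q (vec_action Q g v) (vec_action Q g w)) x = fscale (2 * vform Q v w) x" for x :: "nat set \<Rightarrow> complex"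
    unfolding rep.T_clifford rep.cl_op_arg_scale cl_op_iota_cancel .
  from fun_cong[OF this[of "dlt {}"], of "{}"] show ?thesis by (simp add: dlt_apply)
qed

end

lemma vec_action_one: "vec_action Q \<one>\<^bsub>Cl Q\<^esub> v = v"
  by (subst cl_vec_inj[symmetric]) (simp add: cl_vec_vec_action[OF Pin_one] Pin_inv[OF Pin_one])

lemma vec_action_mult:
  assumes g: "g \<in> Pin Q" and h: "h \<in> Pin Q"
  shows "vec_action Q (g \<otimes>\<^bsub>Cl Q\<^esub> h) v = vec_action Q g (vec_action Q h v)"
  using Pin_closed[OF g] Pin_closed[OF h]
  by (subst cl_vec_inj[symmetric])
    (simp add: cl_vec_vec_action Pin_mult g h Pin_inv cl_iota_mult cl.m_assoc)

subsection \<open>Regular functions\<close>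

lemma regular_const: "regular_on_GV Q (\<lambda>g. c)"
  unfolding regular_on_GV_def by (rule bexI[of _ "\<lambda>_. c"]) (auto intro: cl_poly.const)

lemma regular_plus: "regular_on_GV Q f \<Longrightarrow> regular_on_GV Q h \<Longrightarrow> regular_on_GV Q (\<lambda>g. f g + h g)"
  unfolding regular_on_GV_def
proof (elim bexE)
  fix p q assume "p \<in> cl_poly Q" "q \<in> cl_poly Q" "\<forall>g\<in>GV Q. f g = p g" "\<forall>g\<in>GV Q. h g = q g"
  then show "\<exists>p\<in>cl_poly Q. \<forall>g\<in>GV Q. f g + h g = p g"
    by (intro bexI[OF _ cl_poly.plus[of p Q q]]) auto
qed

lemma regular_times: "regular_on_GV Q f \<Longrightarrow> regular_on_GV Q h \<Longrightarrow> regular_on_GV Q (\<lambda>g. f g * h g)"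
  unfolding regular_on_GV_def
proof (elim bexE)
  fix p q assume "p \<in> cl_poly Q" "q \<in> cl_poly Q" "\<forall>g\<in>GV Q. f g = p g" "\<forall>g\<in>GV Q. h g = q g"
  then show "\<exists>p\<in>cl_poly Q. \<forall>g\<in>GV Q. f g * h g = p g"
    by (intro bexI[OF _ cl_poly.times[of p Q q]]) auto
qed

lemma regular_sum: "(\<And>i. i \<in> A \<Longrightarrow> regular_on_GV Q (f i)) \<Longrightarrow> regular_on_GV Q (\<lambda>g. \<Sum>i\<in>A. f i g)"
  by (induction A rule: infinite_finite_induct) (auto intro: regular_const regular_plus)

lemma regular_cong: "(\<And>g. g \<in> GV Q \<Longrightarrow> f g = h g) \<Longrightarrow> regular_on_GV Q h \<Longrightarrow> regular_on_GV Q f"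
  unfolding regular_on_GV_def by auto

text \<open>For a fixed spinor each coefficient of the result is linear in the Clifford element,
  hence a polynomial function.\<close>

lemma regular_cl_op: "regular_on_GV Q (\<lambda>g. rep.cl_op g x K)"
  unfolding regular_on_GV_def
  by (rule bexI[of _ "\<lambda>g. rep.cl_op g x K"], simp)
    (rule cl_poly.functional, simp_all add: rep.cl_op_add rep.cl_op_scale)

lemma regular_cl_op_iota: "regular_on_GV Q (\<lambda>g. rep.cl_op (cl_iota Q g) x K)"
  unfolding regular_on_GV_def
  by (rule bexI[of _ "\<lambda>g. rep.cl_op (cl_iota Q g) x K"], simp)
    (rule cl_poly.functional, simp_all add: cl_iota_add cl_iota_scale rep.cl_op_add rep.cl_op_scale)

lemma cl_op_expand:
  assumes "x \<in> Spinors"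
  shows "rep.cl_op a x K = (\<Sum>J\<in>Pow {1..n}. x J * rep.cl_op a (dlt J) K)"
proof -
  have "rep.cl_op a (\<Sum>J\<in>B. fscale (x J) (dlt J)) = (\<Sum>J\<in>B. fscale (x J) (rep.cl_op a (dlt J)))" for B
  proof (induction B rule: infinite_finite_induct)
    case (insert b B)
    then show ?case
      by (simp add: rep.cl_op_arg_add rep.cl_op_arg_scale del: plus_fun_apply fscale_apply sum_fun_apply)
  qed (use rep.cl_op_arg_scale[of a 0 0] in \<open>simp_all del: zero_fun_apply\<close>)
  from this[of "Pow {1..n}"] supp_on_expand[OF _ assms] show ?thesis by simp
qed

lemma regular_compose_cl_op:
  assumes f: "\<And>J. J \<in> Pow {1..n} \<Longrightarrow> regular_on_GV Q (\<lambda>g. f g J)" and supp: "\<And>g. g \<in> GV Q \<Longrightarrow> f g \<in> Spinors"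
  shows "regular_on_GV Q (\<lambda>g. rep.cl_op g (f g) K)" "regular_on_GV Q (\<lambda>g. rep.cl_op a (f g) K)"
proof -
  show "regular_on_GV Q (\<lambda>g. rep.cl_op g (f g) K)"
    by (rule regular_cong[where h = "\<lambda>g. \<Sum>J\<in>Pow {1..n}. f g J * rep.cl_op g (dlt J) K"])
      (auto intro!: cl_op_expand supp regular_sum regular_times f regular_cl_op)
  show "regular_on_GV Q (\<lambda>g. rep.cl_op a (f g) K)"
    by (rule regular_cong[where h = "\<lambda>g. \<Sum>J\<in>Pow {1..n}. f g J * rep.cl_op a (dlt J) K"])
      (auto intro!: cl_op_expand supp regular_sum regular_times f regular_const)
qed

text \<open>The coordinates of \<open>g v g\<^sup>-\<^sup>1\<close> are read off from the matrices of \<open>g\<close> and \<open>\<iota> g\<close> on the spin module.\<close>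

lemma regular_vec_action: "regular_on_GV Q (\<lambda>g. vform Q (vec_action Q g v) u)"
proof -
  have r1: "regular_on_GV Q (\<lambda>g. cliff (vec_action Q g v) x K)" if x: "x \<in> Spinors" for x K
  proof (rule regular_cong)
    show "cliff (vec_action Q g v) x K = rep.cl_op g (rep.cl_op (cl_vec Q v) (rep.cl_op (cl_iota Q g) x)) K"
      if "g \<in> GV Q" for g
      using cliff_vec_action[OF GV_subset_Pin[OF that]] by (simp add: rep.cl_op_vec)
    have c: "cl_iota Q g \<in> carrier (Cl Q)" if "g \<in> GV Q" for g
      using Pin_closed[OF GV_subset_Pin[OF that]] by simp
    show "regular_on_GV Q (\<lambda>g. rep.cl_op g (rep.cl_op (cl_vec Q v) (rep.cl_op (cl_iota Q g) x)) K)"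
      by (intro regular_compose_cl_op regular_cl_op_iota cl_op_supp x c) auto
  qed
  have s: "cliff (vec_action Q g v) (dlt {}) \<in> Spinors" for g
    by (intro cliff_supp) auto
  \<comment> \<open>By \<open>cliff_pair\<close> this is the pairing of the moved vector with
    \<open>u\<close>, expressed through spinors only.\<close>
  have "regular_on_GV Q (\<lambda>g. 1 / 2 * (cliff (vec_action Q g v) (cliff u (dlt {})) {}
      + rep.cl_op (cl_vec Q u) (cliff (vec_action Q g v) (dlt {})) {}))"
    by (intro regular_times regular_const regular_plus r1 regular_compose_cl_op s cliff_supp) auto
  then show ?thesis
    by (rule regular_cong[rotated]) (simp add: rep.cl_op_vec flip: cliff_pair)
qed

end

section \<open>Coordinate modules\<close>

lemma restrict_id_lin: "(\<lambda>t\<in>supp_on W. t) \<in> lin_maps fscale fscale (supp_on W) (supp_on W)"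
  by (rule lin_mapsI) (simp_all del: plus_fun_apply fscale_apply)

lemma comp_lin:
  assumes f: "f \<in> lin_maps s t A B" and g: "g \<in> lin_maps t u B C"
    and A: "\<And>x y. x \<in> A \<Longrightarrow> y \<in> A \<Longrightarrow> x + y \<in> A" "\<And>c x. x \<in> A \<Longrightarrow> s c x \<in> A"
  shows "(\<lambda>x\<in>A. g (f x)) \<in> lin_maps s u A C"
  by (rule lin_mapsI) (simp_all add: A lin_maps_in[OF f] lin_maps_in[OF g] lin_maps_add[OF f]
      lin_maps_add[OF g] lin_maps_scale[OF f] lin_maps_scale[OF g])

lemma supp_comp_lin:
  "f \<in> lin_maps fscale t (supp_on W) B \<Longrightarrow> g \<in> lin_maps t u B C \<Longrightarrow>
    (\<lambda>x\<in>supp_on W. g (f x)) \<in> lin_maps fscale u (supp_on W) C"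
  by (rule comp_lin[of f fscale t "supp_on W" B g u C], assumption, assumption,
      rule supp_on_add, assumption+, rule supp_on_scale, assumption)

context spin_setup
begin

text \<open>Modules consisting of all arrays on a finite set of words of one length. With delta
  arrays as a basis, regularity can be asked of the matrix entries alone, and every condition can be
  tested on words.\<close>

definition coord_module :: "ix list set \<Rightarrow> 'v cl gmod \<Rightarrow> bool" where
  "coord_module W M \<longleftrightarrow> finite W \<and> (\<forall>w\<in>W. length w = rank M) \<and> car M = supp_on W \<and>
     act M \<in> GV Q \<rightarrow>\<^sub>E lin_maps fscale fscale (supp_on W) (supp_on W) \<and>
     (\<forall>t\<in>supp_on W. act M \<one>\<^bsub>Cl Q\<^esub> t = t) \<and>
     (\<forall>g\<in>GV Q. \<forall>h\<in>GV Q. \<forall>t\<in>supp_on W. act M (g \<otimes>\<^bsub>Cl Q\<^esub> h) t = act M g (act M h t)) \<and>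
     (\<forall>u\<in>W. \<forall>w\<in>W. regular_on_GV Q (\<lambda>g. act M g (dlt u) w))"

lemma
  assumes "coord_module W M"
  shows coord_finite: "finite W"
    and coord_length: "w \<in> W \<Longrightarrow> length w = rank M"
    and coord_car: "car M = supp_on W"
    and coord_act_PiE: "act M \<in> GV Q \<rightarrow>\<^sub>E lin_maps fscale fscale (supp_on W) (supp_on W)"
    and coord_act_lin: "g \<in> GV Q \<Longrightarrow> act M g \<in> lin_maps fscale fscale (supp_on W) (supp_on W)"
    and coord_act_one: "t \<in> supp_on W \<Longrightarrow> act M \<one>\<^bsub>Cl Q\<^esub> t = t"
    and coord_act_mult: "g \<in> GV Q \<Longrightarrow> h \<in> GV Q \<Longrightarrow> t \<in> supp_on W \<Longrightarrow>
      act M (g \<otimes>\<^bsub>Cl Q\<^esub> h) t = act M g (act M h t)"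
    and coord_regular: "u \<in> W \<Longrightarrow> w \<in> W \<Longrightarrow> regular_on_GV Q (\<lambda>g. act M g (dlt u) w)"
  using assms by (auto simp: coord_module_def PiE_def)

lemma coord_moduleI:
  assumes "finite W" "\<And>w. w \<in> W \<Longrightarrow> length w = rank M" "car M = supp_on W"
    "act M \<in> extensional (GV Q)"
    "\<And>g. g \<in> GV Q \<Longrightarrow> act M g \<in> lin_maps fscale fscale (supp_on W) (supp_on W)"
    "\<And>w. w \<in> W \<Longrightarrow> act M \<one>\<^bsub>Cl Q\<^esub> (dlt w) = dlt w"
    "\<And>g h w. g \<in> GV Q \<Longrightarrow> h \<in> GV Q \<Longrightarrow> w \<in> W \<Longrightarrow>
      act M (g \<otimes>\<^bsub>Cl Q\<^esub> h) (dlt w) = act M g (act M h (dlt w))"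
    "\<And>u w. u \<in> W \<Longrightarrow> w \<in> W \<Longrightarrow> regular_on_GV Q (\<lambda>g. act M g (dlt u) w)"
  shows "coord_module W M"
proof -
  have "act M \<one>\<^bsub>Cl Q\<^esub> = (\<lambda>t\<in>supp_on W. t)"
    by (rule lin_maps_eqI[OF fscale.vector_space_axioms assms(5)[OF GV_one] restrict_id_lin assms(1)])
      (simp add: assms(6))
  then have one: "act M \<one>\<^bsub>Cl Q\<^esub> t = t" if "t \<in> supp_on W" for t
    using that by simp
  have "act M (g \<otimes>\<^bsub>Cl Q\<^esub> h) = (\<lambda>t\<in>supp_on W. act M g (act M h t))"
    if "g \<in> GV Q" "h \<in> GV Q" for g h
    by (rule lin_maps_eqI[OF fscale.vector_space_axioms assms(5)[OF GV_mult[OF that]]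
          supp_comp_lin[OF assms(5)[OF that(2)] assms(5)[OF that(1)]] assms(1)])
      (simp add: assms(7) that)
  then have mult: "act M (g \<otimes>\<^bsub>Cl Q\<^esub> h) t = act M g (act M h t)"
    if "g \<in> GV Q" "h \<in> GV Q" "t \<in> supp_on W" for g h t
    using that by simp
  have "act M \<in> GV Q \<rightarrow>\<^sub>E lin_maps fscale fscale (supp_on W) (supp_on W)"
    using assms(4,5) by (simp add: PiE_def)
  then show ?thesis
    unfolding coord_module_def using assms one mult by simp
qed

text \<open>A matrix coefficient for an arbitrary functional is a finite linear combination of the
  entries between delta arrays, so regularity of these entries suffices.\<close>

lemma coord_is_GV_module:
  assumes M: "coord_module W M"
  shows "is_GV_module Q M"
  unfolding is_GV_module_def
proof (intro conjI ballI allI impI)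
  fix t w assume "t \<in> car M" "t w \<noteq> 0"
  then show "length w = rank M"
    using coord_length[OF M] coord_car[OF M] supp_onD by metis
next
  show "\<exists>B. finite B \<and> car M = fscale.span B"
    using coord_finite[OF M] coord_car[OF M] by (intro exI[of _ "dlt ` W"]) (simp add: span_dlt)
next
  fix l t assume l: "l \<in> lin_maps fscale (*) (car M) UNIV" and t: "t \<in> car M"
  note fin = coord_finite[OF M] and car = coord_car[OF M]
  have act: "act M g t w = (\<Sum>u\<in>W. t u * act M g (dlt u) w)" if "g \<in> GV Q" for g w
    using lin_maps_expand[OF fscale.vector_space_axioms coord_act_lin[OF M that] fin] t car by simp
  show "regular_on_GV Q (\<lambda>g. l (act M g t))"
  proof (rule regular_cong)
    fix g assume g: "g \<in> GV Q"
    show "l (act M g t) = (\<Sum>w\<in>W. (\<Sum>u\<in>W. t u * act M g (dlt u) w) * l (dlt w))"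
      using lin_maps_expand[OF vector_space_complex_mult l[unfolded car] fin]
        lin_maps_in[OF coord_act_lin[OF M g]] t car by (simp add: act[OF g])
  qed (intro regular_sum regular_times regular_const coord_regular[OF M])
qed (use coord_act_PiE[OF M] coord_car[OF M] coord_act_one[OF M] coord_act_mult[OF M] in auto)

lemma coord_unit: "coord_module {[]} (unit_module Q)"
proof -
  have "supp_on {[]} = range (\<lambda>c. fscale c aone)"
  proof (rule Set.set_eqI)
    fix t :: array
    show "t \<in> supp_on {[]} \<longleftrightarrow> t \<in> range (\<lambda>c. fscale c aone)"
    proof
      assume "t \<in> supp_on {[]}"
      from supp_on_expand[OF _ this] have "t = fscale (t []) aone"
        by (simp add: aone_dlt del: fscale_apply sum_fun_apply)
      then show "t \<in> range (\<lambda>c. fscale c aone)" by (rule image_eqI) simp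
    qed (auto simp: aone_dlt)
  qed
  then have car: "range (\<lambda>c. fscale c aone) = supp_on {[]}" ..
  show ?thesis
    by (rule coord_moduleI)
      (simp_all add: unit_module_def car restrict_id_lin GV_one GV_mult,
        rule regular_cong[OF _ regular_const], simp)
qed

lemma tensor_act_aprod:
  assumes M: "coord_module W M" and L: "coord_module Z L" and g: "g \<in> GV Q"
    and s: "s \<in> supp_on W" and t: "t \<in> supp_on Z"
  shows "act (tensor_module Q M L) g (s \<star> t) = act M g s \<star> act L g t"
  using g s t map_tensor_aprod[OF coord_finite[OF M] coord_finite[OF L] coord_length[OF M]
      coord_act_lin[OF M g] coord_act_lin[OF L g] s t]
  by (simp add: tensor_module_def coord_car[OF M] coord_car[OF L])

text \<open>Matrix entries of a tensor product are products of matrix entries. Reading them off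
  requires that words of the first factor have one length, so that the index \<open>u' @ v'\<close>
  splits uniquely.\<close>

lemma coord_tensor:
  assumes M: "coord_module W M" and L: "coord_module Z L"
  shows "coord_module (cat_words W Z) (tensor_module Q M L)" (is "coord_module ?Y ?T")
proof (rule coord_moduleI)
  note tact = tensor_act_aprod[OF M L]
  show "finite ?Y"
    using coord_finite[OF M] coord_finite[OF L] by (rule finite_cat_words)
  show "length w = rank ?T" if "w \<in> ?Y" for w
    using that coord_length[OF M] coord_length[OF L] by (auto simp: tensor_module_def elim!: cat_wordsE)
  show "car ?T = supp_on ?Y"
    using coord_finite[OF M] coord_finite[OF L]
    by (simp add: tensor_module_def coord_car[OF M] coord_car[OF L] aten_supp)
  show "act ?T \<in> extensional (GV Q)"
    by (simp add: tensor_module_def)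
  show "act ?T g \<in> lin_maps fscale fscale (supp_on ?Y) (supp_on ?Y)" if "g \<in> GV Q" for g
    using map_tensor_lin[OF coord_finite[OF M] coord_finite[OF L] coord_length[OF M]
        coord_act_lin[OF M that] coord_act_lin[OF L that]] that
    by (simp add: tensor_module_def coord_car[OF M] coord_car[OF L])
  show "act ?T \<one>\<^bsub>Cl Q\<^esub> (dlt w) = dlt w" if "w \<in> ?Y" for w
    using that by (auto elim!: cat_wordsE
        simp: dlt_aprod[symmetric] tact[OF GV_one] coord_act_one[OF M] coord_act_one[OF L])
  show "act ?T (g \<otimes>\<^bsub>Cl Q\<^esub> h) (dlt w) = act ?T g (act ?T h (dlt w))"
    if "g \<in> GV Q" "h \<in> GV Q" "w \<in> ?Y" for g h w
    using that(3) by (auto elim!: cat_wordsE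
        simp: dlt_aprod[symmetric] tact that(1,2) GV_mult coord_act_mult[OF M] coord_act_mult[OF L]
          lin_maps_in[OF coord_act_lin[OF M]] lin_maps_in[OF coord_act_lin[OF L]])
  fix x y assume "x \<in> ?Y" "y \<in> ?Y"
  then obtain u v u' v' where x: "x = u @ v" "u \<in> W" "v \<in> Z" and y: "y = u' @ v'" "u' \<in> W" "v' \<in> Z"
    by (meson cat_wordsE)
  show "regular_on_GV Q (\<lambda>g. act ?T g (dlt x) y)"
  proof (rule regular_cong)
    fix g assume g: "g \<in> GV Q"
    have "act M g (dlt u) \<in> supp_on W"
      using lin_maps_in[OF coord_act_lin[OF M g]] x by simp
    then have len: "length w = length u'" if "act M g (dlt u) w \<noteq> 0" for w
      using that coord_length[OF M] y(2) supp_onD by metis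
    show "act ?T g (dlt x) y = act M g (dlt u) u' * act L g (dlt v) v'"
      using x y aprod_append[of "act M g (dlt u)" u' "act L g (dlt v)" v', OF len]
      by (simp add: dlt_aprod[symmetric] tact[OF g])
  qed (intro regular_times coord_regular[OF M] coord_regular[OF L] x y)
qed

text \<open>Actions are extensional in the group element and in the array, so equality of modules,
  not merely isomorphism, can be tested on delta arrays. This is how the strict associativity and
  unit laws are obtained.\<close>

lemma gmod_eqI:
  assumes M: "coord_module W M" and L: "coord_module W L" and "rank M = rank L"
    and act: "\<And>g w. g \<in> GV Q \<Longrightarrow> w \<in> W \<Longrightarrow> act M g (dlt w) = act L g (dlt w)"
  shows "M = L"
proof -
  have "act M = act L"
  proof (rule extensionalityI[of _ "GV Q"])
    fix g assume g: "g \<in> GV Q"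
    show "act M g = act L g"
      by (rule lin_maps_eqI[OF fscale.vector_space_axioms coord_act_lin[OF M g] coord_act_lin[OF L g]
            coord_finite[OF M]]) (rule act[OF g])
  qed (use coord_act_PiE[OF M] coord_act_PiE[OF L] in \<open>auto simp: PiE_def\<close>)
  then show ?thesis
    using assms(3) coord_car[OF M] coord_car[OF L] by simp
qed

lemma tensor_assoc:
  assumes M: "coord_module W M" and L: "coord_module Z L" and K: "coord_module Y K"
  shows "tensor_module Q (tensor_module Q M L) K = tensor_module Q M (tensor_module Q L K)"
proof (rule gmod_eqI)
  note T1 = coord_tensor[OF M L] and T2 = coord_tensor[OF L K]
  show "coord_module (cat_words W (cat_words Z Y)) (tensor_module Q (tensor_module Q M L) K)"
    using coord_tensor[OF T1 K] by (simp add: cat_words_assoc)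
  show "coord_module (cat_words W (cat_words Z Y)) (tensor_module Q M (tensor_module Q L K))"
    by (rule coord_tensor[OF M T2])
  show "rank (tensor_module Q (tensor_module Q M L) K) = rank (tensor_module Q M (tensor_module Q L K))"
    by (simp add: tensor_module_def)
  fix g x assume g: "g \<in> GV Q" and "x \<in> cat_words W (cat_words Z Y)"
  then obtain u v w where x: "x = u @ (v @ w)" and uvw: "u \<in> W" "v \<in> Z" "w \<in> Y"
    unfolding cat_words_def by auto
  have "act (tensor_module Q (tensor_module Q M L) K) g ((dlt u \<star> dlt v) \<star> dlt w)
      = (act M g (dlt u) \<star> act L g (dlt v)) \<star> act K g (dlt w)"
    using uvw aprod_supp[of "dlt u" W "dlt v" Z]
    by (simp add: tensor_act_aprod[OF T1 K g] tensor_act_aprod[OF M L g])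
  moreover have "act (tensor_module Q M (tensor_module Q L K)) g (dlt u \<star> (dlt v \<star> dlt w))
      = act M g (dlt u) \<star> (act L g (dlt v) \<star> act K g (dlt w))"
    using uvw aprod_supp[of "dlt v" Z "dlt w" Y]
    by (simp add: tensor_act_aprod[OF M T2 g] tensor_act_aprod[OF L K g])
  ultimately show "act (tensor_module Q (tensor_module Q M L) K) g (dlt x)
      = act (tensor_module Q M (tensor_module Q L K)) g (dlt x)"
    by (simp add: x aprod_assoc dlt_aprod)
qed

lemma unit_act: "g \<in> GV Q \<Longrightarrow> act (unit_module Q) g aone = aone"
proof -
  have "aone \<in> range (\<lambda>c. fscale c aone)"
    by (rule image_eqI[of _ _ 1]) (simp_all add: fun_eq_iff)
  then show "g \<in> GV Q \<Longrightarrow> act (unit_module Q) g aone = aone"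
    by (simp add: unit_module_def)
qed

lemma tensor_unit_left: "coord_module W M \<Longrightarrow> tensor_module Q (unit_module Q) M = M"
proof (rule gmod_eqI)
  assume M: "coord_module W M"
  show "coord_module W (tensor_module Q (unit_module Q) M)"
    using coord_tensor[OF coord_unit M] by simp
  show "coord_module W M" by (rule M)
  show "rank (tensor_module Q (unit_module Q) M) = rank M"
    by (simp add: tensor_module_def unit_module_def)
  fix g w assume g: "g \<in> GV Q" "w \<in> W"
  then show "act (tensor_module Q (unit_module Q) M) g (dlt w) = act M g (dlt w)"
    using tensor_act_aprod[OF coord_unit M g(1), of aone "dlt w"] by (simp add: unit_act) (simp add: aone_dlt)
qed

lemma tensor_unit_right: "coord_module W M \<Longrightarrow> tensor_module Q M (unit_module Q) = M"
proof (rule gmod_eqI)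
  assume M: "coord_module W M"
  show "coord_module W (tensor_module Q M (unit_module Q))"
    using coord_tensor[OF M coord_unit] by simp
  show "coord_module W M" by (rule M)
  show "rank (tensor_module Q M (unit_module Q)) = rank M"
    by (simp add: tensor_module_def unit_module_def)
  fix g w assume g: "g \<in> GV Q" "w \<in> W"
  then show "act (tensor_module Q M (unit_module Q)) g (dlt w) = act M g (dlt w)"
    using tensor_act_aprod[OF M coord_unit g(1), of "dlt w" aone] by (simp add: unit_act) (simp add: aone_dlt)
qed

subsection \<open>The spin module and the vector module\<close>

fun idx :: "sb_ob \<Rightarrow> ix set" where
  "idx \<S> = IS ` Pow {1..n}"
| "idx \<V> = IV ` {1..N}"

fun base :: "sb_ob \<Rightarrow> 'v cl gmod" where
  "base \<S> = spin_module Q e \<epsilon>"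
| "base \<V> = vector_module Q e"

abbreviation R :: "sb_ob \<Rightarrow> array set" where
  "R X \<equiv> supp_on ((\<lambda>i. [i]) ` idx X)"

lemma finite_idx [simp]: "finite (idx X)"
  by (cases X) auto

lemma spin_arr_apply [simp]: "spin_arr x [IS I] = x I"
  by (simp add: spin_arr_def)

lemma spin_arr_zero: "(\<And>I. w \<noteq> [IS I]) \<Longrightarrow> spin_arr x w = 0"
  by (auto simp: spin_arr_def split: list.split ix.split)

lemma spin_arr_in_R: "x \<in> Spinors \<Longrightarrow> spin_arr x \<in> R \<S>"
proof (rule supp_onI)
  fix w assume x: "x \<in> Spinors" and w: "w \<notin> (\<lambda>i. [i]) ` idx \<S>"
  show "spin_arr x w = 0"
  proof (cases "\<exists>I. w = [IS I]")
    case True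
    then obtain I where I: "w = [IS I]" ..
    with w have "I \<notin> Pow {1..n}" by auto
    with x I show ?thesis by (simp add: supp_onD)
  qed (auto intro: spin_arr_zero)
qed

definition unspin :: "array \<Rightarrow> nat set \<Rightarrow> complex" where
  "unspin t = (\<lambda>I. t [IS I])"

lemma unspin_spin_arr [simp]: "unspin (spin_arr x) = x"
  by (simp add: unspin_def)

lemma unspin_Spinors: "t \<in> R \<S> \<Longrightarrow> unspin t \<in> Spinors"
proof (rule supp_onI)
  fix I assume t: "t \<in> R \<S>" and "I \<notin> Pow {1..n}"
  then have "[IS I] \<notin> (\<lambda>i. [i]) ` idx \<S>" by auto
  with t show "unspin t I = 0" unfolding unspin_def by (rule supp_onD)
qed

lemma spin_arr_unspin: "t \<in> R \<S> \<Longrightarrow> spin_arr (unspin t) = t"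
proof
  fix w assume t: "t \<in> R \<S>"
  show "spin_arr (unspin t) w = t w"
  proof (cases "\<exists>I. w = [IS I]")
    case True
    then show ?thesis by (auto simp: unspin_def)
  next
    case False
    then have "w \<notin> (\<lambda>i. [i]) ` idx \<S>" by auto
    with t False show ?thesis by (simp add: supp_onD spin_arr_zero)
  qed
qed

lemma R_S: "R \<S> = spin_arr ` Spinors"
proof
  show "R \<S> \<subseteq> spin_arr ` Spinors"
    by (rule subsetI, rule image_eqI, rule spin_arr_unspin[symmetric], assumption, rule unspin_Spinors)
  show "spin_arr ` Spinors \<subseteq> R \<S>"
    by (rule image_subsetI, rule spin_arr_in_R)
qed

lemma spin_arr_add: "spin_arr (x + y) = spin_arr x + spin_arr y"
  and spin_arr_scale: "spin_arr (fscale c x) = fscale c (spin_arr x)"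
  by (auto simp: spin_arr_def fun_eq_iff split: list.split ix.split)

lemma spin_arr_sum: "spin_arr (\<Sum>i\<in>A. f i) = (\<Sum>i\<in>A. spin_arr (f i))"
proof
  fix w
  show "spin_arr (\<Sum>i\<in>A. f i) w = (\<Sum>i\<in>A. spin_arr (f i)) w"
    by (cases "\<exists>I. w = [IS I]") (auto simp: spin_arr_zero)
qed

lemma spin_act:
  assumes "g \<in> GV Q" "x \<in> Spinors"
  shows "act (base \<S>) g (spin_arr x) = spin_arr (rep.cl_op g x)"
proof -
  have "inv_into Spinors spin_arr (spin_arr x) = x"
    by (rule inv_into_f_f) (use assms in \<open>auto intro!: inj_on_inverseI[where g = unspin]\<close>)
  then show ?thesis
    using assms spin_action_eq[OF Pin_closed[OF GV_subset_Pin[OF assms(1)]] assms(2)]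
    by (simp add: spin_module_def Let_def spin_space_supp)
qed

section \<open>The vector module in coordinates\<close>

lemma vec_arr_apply: "vec_arr Q e v [IV i] = (if i \<in> {1..N} then vform Q (e i) v else 0)"
  by (simp add: vec_arr_def)

lemma vec_arr_zero: "(\<And>i. i \<in> {1..N} \<Longrightarrow> w \<noteq> [IV i]) \<Longrightarrow> vec_arr Q e v w = 0"
  by (auto simp: vec_arr_def split: list.split ix.split)

lemma vec_arr_in_R: "vec_arr Q e v \<in> R \<V>"
  by (rule supp_onI, rule vec_arr_zero) auto

lemma vec_arr_add: "vec_arr Q e (v + w) = vec_arr Q e v + vec_arr Q e w"
  and vec_arr_scale: "vec_arr Q e (vscale Q c v) = fscale c (vec_arr Q e v)"
  by (auto simp: vec_arr_def fun_eq_iff vform_add_right vform_scale_right split: list.split ix.split)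

lemma vec_arr_e: "i \<in> {1..N} \<Longrightarrow> vec_arr Q e (e i) = dlt [IV i]"
  by (auto simp: vec_arr_def fun_eq_iff dlt_apply vform_e split: list.split ix.split)

definition unvec :: "array \<Rightarrow> 'v" where
  "unvec t = (\<Sum>i\<in>{1..N}. vscale Q (t [IV i]) (e i))"

lemma unvec_vec_arr [simp]: "unvec (vec_arr Q e v) = v"
  unfolding unvec_def by (subst (3) vec_expand) (auto simp: vec_arr_apply intro!: sum.cong)

lemma vec_arr_sum: "vec_arr Q e (\<Sum>i\<in>A. f i) = (\<Sum>i\<in>A. vec_arr Q e (f i))"
proof
  fix w
  show "vec_arr Q e (\<Sum>i\<in>A. f i) w = (\<Sum>i\<in>A. vec_arr Q e (f i)) w"
  proof (cases "\<exists>i\<in>{1..N}. w = [IV i]")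
    case False
    then have "vec_arr Q e v w = 0" for v by (intro vec_arr_zero) auto
    then show ?thesis by simp
  qed (auto simp: vec_arr_apply vform_sum_right)
qed

lemma vec_arr_unvec:
  assumes t: "t \<in> R \<V>"
  shows "vec_arr Q e (unvec t) = t"
proof -
  have "t = (\<Sum>i\<in>{1..N}. fscale (t [IV i]) (dlt [IV i]))"
    using supp_on_expand[OF _ t] by (simp add: sum.reindex inj_on_def image_image)
  also have "\<dots> = vec_arr Q e (unvec t)"
    unfolding unvec_def vec_arr_sum vec_arr_scale by (intro sum.cong) (auto simp: vec_arr_e)
  finally show ?thesis ..
qed

lemma R_V: "R \<V> = range (vec_arr Q e)"
proof
  show "R \<V> \<subseteq> range (vec_arr Q e)"
    by (rule subsetI, rule image_eqI, rule vec_arr_unvec[symmetric], assumption, rule UNIV_I)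
  show "range (vec_arr Q e) \<subseteq> R \<V>"
    by (rule image_subsetI, rule vec_arr_in_R)
qed

lemma vec_act:
  assumes "g \<in> GV Q"
  shows "act (base \<V>) g (vec_arr Q e v) = vec_arr Q e (vec_action Q g v)"
proof -
  have "inv_into UNIV (vec_arr Q e) (vec_arr Q e v) = v"
    by (rule inv_into_f_f) (auto intro!: inj_on_inverseI[where g = unvec])
  then show ?thesis using assms by (simp add: vector_module_def)
qed

lemma coord_spin: "coord_module ((\<lambda>i. [i]) ` idx \<S>) (base \<S>)"
proof -
  have arr: "t = spin_arr (unspin t)" "unspin t \<in> Spinors" if "t \<in> R \<S>" for t
    using that spin_arr_unspin unspin_Spinors by auto
  have act: "act (base \<S>) g t = spin_arr (rep.cl_op g (unspin t))" if "g \<in> GV Q" "t \<in> R \<S>" for g t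
    using spin_act[OF that(1) arr(2)[OF that(2)]] arr(1)[OF that(2)] by simp
  have cl: "rep.cl_op g x \<in> Spinors" if "g \<in> GV Q" "x \<in> Spinors" for g x
    using cl_op_supp Pin_closed[OF GV_subset_Pin] that by blast
  have un: "unspin (s + t) = unspin s + unspin t" "unspin (fscale c t) = fscale c (unspin t)" for s t c
    by (auto simp: unspin_def fun_eq_iff)
  show ?thesis
  proof (rule coord_moduleI)
    show "car (base \<S>) = R \<S>"
      by (simp only: R_S) (simp add: spin_module_def Let_def spin_space_supp)
    show "act (base \<S>) \<in> extensional (GV Q)"
      by (simp add: spin_module_def Let_def)
    fix g assume g: "g \<in> GV Q"
    show "act (base \<S>) g \<in> lin_maps fscale fscale (R \<S>) (R \<S>)"
    proof (rule lin_mapsI)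
      show "act (base \<S>) g \<in> extensional (R \<S>)"
        using g by (simp only: R_S) (simp add: spin_module_def Let_def spin_space_supp)
      fix s t assume s: "s \<in> R \<S>" and t: "t \<in> R \<S>"
      show "act (base \<S>) g s \<in> R \<S>"
        unfolding act[OF g s] by (intro spin_arr_in_R cl g arr s)
      show "act (base \<S>) g (s + t) = act (base \<S>) g s + act (base \<S>) g t"
        unfolding act[OF g s] act[OF g t] act[OF g supp_on_add[OF s t]] un rep.cl_op_arg_add spin_arr_add ..
      show "act (base \<S>) g (fscale c s) = fscale c (act (base \<S>) g s)" for c
        unfolding act[OF g s] act[OF g supp_on_scale[OF s]] un rep.cl_op_arg_scale spin_arr_scale ..
    qed
  next
    fix w assume w: "w \<in> (\<lambda>i. [i]) ` idx \<S>"
    then have d: "dlt w \<in> R \<S>" by (rule supp_on_dlt)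
    show "act (base \<S>) \<one>\<^bsub>Cl Q\<^esub> (dlt w) = dlt w"
      unfolding act[OF GV_one d] rep.cl_op_one by (rule spin_arr_unspin[OF d])
    show "act (base \<S>) (g \<otimes>\<^bsub>Cl Q\<^esub> h) (dlt w) = act (base \<S>) g (act (base \<S>) h (dlt w))"
      if g: "g \<in> GV Q" and h: "h \<in> GV Q" for g h
      unfolding act[OF h d] act[OF GV_mult[OF g h] d] spin_act[OF g cl[OF h arr(2)[OF d]]]
      using rep.cl_op_mult[OF Pin_closed[OF GV_subset_Pin[OF g]] Pin_closed[OF GV_subset_Pin[OF h]]]
      by (rule arg_cong)
  next
    fix u w assume u: "u \<in> (\<lambda>i. [i]) ` idx \<S>" and w: "w \<in> (\<lambda>i. [i]) ` idx \<S>"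
    then obtain K where K: "w = [IS K]" by auto
    show "regular_on_GV Q (\<lambda>g. act (base \<S>) g (dlt u) w)"
      by (rule regular_cong[OF _ regular_cl_op[of "unspin (dlt u)" K]]) (simp only: act[OF _ supp_on_dlt[OF u]] K spin_arr_apply)
  qed (auto simp: spin_module_def Let_def)
qed

lemma coord_vector: "coord_module ((\<lambda>i. [i]) ` idx \<V>) (base \<V>)"
proof -
  have act: "act (base \<V>) g t = vec_arr Q e (vec_action Q g (unvec t))" if "g \<in> GV Q" "t \<in> R \<V>" for g t
    using vec_act[OF that(1), of "unvec t"] vec_arr_unvec[OF that(2)] by simp
  have un: "unvec (s + t) = unvec s + unvec t" "unvec (fscale c t) = vscale Q c (unvec t)" for s t c
    by (auto simp: unvec_def vs.scale_left_distrib sum.distrib vs.scale_sum_right)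
  show ?thesis
  proof (rule coord_moduleI)
    show "car (base \<V>) = R \<V>"
      by (simp only: R_V) (simp add: vector_module_def)
    show "act (base \<V>) \<in> extensional (GV Q)"
      by (simp add: vector_module_def)
    fix g assume g: "g \<in> GV Q"
    note P = GV_subset_Pin[OF g]
    show "act (base \<V>) g \<in> lin_maps fscale fscale (R \<V>) (R \<V>)"
    proof (rule lin_mapsI)
      show "act (base \<V>) g \<in> extensional (R \<V>)"
        using g by (simp only: R_V) (simp add: vector_module_def)
      fix s t assume s: "s \<in> R \<V>" and t: "t \<in> R \<V>"
      show "act (base \<V>) g s \<in> R \<V>"
        unfolding act[OF g s] by (rule vec_arr_in_R)
      show "act (base \<V>) g (s + t) = act (base \<V>) g s + act (base \<V>) g t"
        unfolding act[OF g s] act[OF g t] act[OF g supp_on_add[OF s t]] un vec_action_add[OF P] vec_arr_add ..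
      show "act (base \<V>) g (fscale c s) = fscale c (act (base \<V>) g s)" for c
        unfolding act[OF g s] act[OF g supp_on_scale[OF s]] un vec_action_scale[OF P] vec_arr_scale ..
    qed
  next
    fix w assume w: "w \<in> (\<lambda>i. [i]) ` idx \<V>"
    then have d: "dlt w \<in> R \<V>" by (rule supp_on_dlt)
    show "act (base \<V>) \<one>\<^bsub>Cl Q\<^esub> (dlt w) = dlt w"
      unfolding act[OF GV_one d] vec_action_one by (rule vec_arr_unvec[OF d])
    show "act (base \<V>) (g \<otimes>\<^bsub>Cl Q\<^esub> h) (dlt w) = act (base \<V>) g (act (base \<V>) h (dlt w))"
      if g: "g \<in> GV Q" and h: "h \<in> GV Q" for g h
      unfolding act[OF h d] act[OF GV_mult[OF g h] d] vec_act[OF g] vec_action_mult[OF GV_subset_Pin[OF g] GV_subset_Pin[OF h]] ..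
  next
    fix u w assume u: "u \<in> (\<lambda>i. [i]) ` idx \<V>" and w: "w \<in> (\<lambda>i. [i]) ` idx \<V>"
    then obtain k where k: "w = [IV k]" "k \<in> {1..N}" by auto
    show "regular_on_GV Q (\<lambda>g. act (base \<V>) g (dlt u) w)"
      by (rule regular_cong[OF _ regular_vec_action[of "unvec (dlt u)" "e k"]])
        (use k in \<open>simp add: act[OF _ supp_on_dlt[OF u]] vec_arr_apply vform_sym del: idx.simps base.simps\<close>)
  qed (auto simp: vector_module_def)
qed

lemma coord_base: "coord_module ((\<lambda>i. [i]) ` idx X) (base X)"
  by (cases X) (simp_all only: coord_spin coord_vector)


subsection \<open>Tensor words\<close>

definition wmod :: "sb_ob list \<Rightarrow> 'v cl gmod" where
  "wmod a = foldr (\<lambda>X. tensor_module Q (base X)) a (unit_module Q)"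

fun wds :: "sb_ob list \<Rightarrow> ix list set" where
  "wds [] = {[]}"
| "wds (X # a) = cat_words ((\<lambda>i. [i]) ` idx X) (wds a)"

lemma coord_wmod: "coord_module (wds a) (wmod a)"
  by (induction a) (auto simp: wmod_def intro: coord_unit coord_tensor coord_base)

lemma wds_single: "wds [X] = (\<lambda>i. [i]) ` idx X"
  by simp

lemma wds_append: "wds (a @ b) = cat_words (wds a) (wds b)"
  by (induction a) (auto simp: cat_words_assoc)

lemma wmod_Nil: "wmod [] = unit_module Q"
  by (simp add: wmod_def)

lemma wmod_single: "wmod [X] = base X"
  by (simp add: wmod_def tensor_unit_right[OF coord_base])

text \<open>Strict monoidality on objects: \<open>foldr\<close> brackets to the right, and
  rebracketing is an equality by \<open>tensor_assoc\<close>.\<close>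

lemma wmod_append: "wmod (a @ b) = tensor_module Q (wmod a) (wmod b)"
proof (induction a)
  case Nil
  then show ?case by (simp add: wmod_Nil tensor_unit_left[OF coord_wmod])
next
  case (Cons X a)
  have "wmod (X # c) = tensor_module Q (base X) (wmod c)" for c
    by (simp add: wmod_def)
  with Cons show ?case
    by (simp add: tensor_assoc[OF coord_base coord_wmod coord_wmod])
qed

lemma finite_wds [simp]: "finite (wds a)"
  using coord_wmod by (rule coord_finite)

lemma car_wmod [simp]: "car (wmod a) = supp_on (wds a)"
  using coord_wmod by (rule coord_car)

lemma length_wds: "w \<in> wds a \<Longrightarrow> length w = rank (wmod a)"
  using coord_wmod by (rule coord_length)

lemma act_wmod_lin: "g \<in> GV Q \<Longrightarrow> act (wmod a) g \<in> lin_maps fscale fscale (supp_on (wds a)) (supp_on (wds a))"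
  using coord_wmod by (rule coord_act_lin)

lemma act_wmod_aprod:
  "g \<in> GV Q \<Longrightarrow> s \<in> supp_on (wds a) \<Longrightarrow> t \<in> supp_on (wds b) \<Longrightarrow>
    act (wmod (a @ b)) g (s \<star> t) = act (wmod a) g s \<star> act (wmod b) g t"
  unfolding wmod_append by (rule tensor_act_aprod[OF coord_wmod coord_wmod])

end

section \<open>Terms of the spin Brauer category\<close>

primrec tsrc :: "'k sb_term \<Rightarrow> sb_ob list" where
  "tsrc (Id a) = a"
| "tsrc (Zero a b) = a"
| "tsrc (Cap X) = [X, X]"
| "tsrc (Cup X) = []"
| "tsrc (Swap X Y) = [X, Y]"
| "tsrc Mu = [\<V>, \<S>]"
| "tsrc (g \<cdot> f) = tsrc f"
| "tsrc (f \<boxtimes> g) = tsrc f @ tsrc g"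
| "tsrc (f \<boxplus> g) = tsrc f"
| "tsrc (Scale r f) = tsrc f"

primrec ttgt :: "'k sb_term \<Rightarrow> sb_ob list" where
  "ttgt (Id a) = a"
| "ttgt (Zero a b) = b"
| "ttgt (Cap X) = []"
| "ttgt (Cup X) = [X, X]"
| "ttgt (Swap X Y) = [Y, X]"
| "ttgt Mu = [\<S>]"
| "ttgt (g \<cdot> f) = ttgt g"
| "ttgt (f \<boxtimes> g) = ttgt f @ ttgt g"
| "ttgt (f \<boxplus> g) = ttgt f"
| "ttgt (Scale r f) = ttgt f"

primrec wt :: "'k sb_term \<Rightarrow> bool" where
  "wt (Id a) = True"
| "wt (Zero a b) = True"
| "wt (Cap X) = True"
| "wt (Cup X) = True"
| "wt (Swap X Y) = True"
| "wt Mu = True"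
| "wt (g \<cdot> f) = (wt f \<and> wt g \<and> tsrc g = ttgt f)"
| "wt (f \<boxtimes> g) = (wt f \<and> wt g)"
| "wt (f \<boxplus> g) = (wt f \<and> wt g \<and> tsrc f = tsrc g \<and> ttgt f = ttgt g)"
| "wt (Scale r f) = wt f"

text \<open>Replaces the inductive typing judgement by functions that compute source, target and
  well-typedness, so that typing conditions are settled by rewriting.\<close>

lemma sb_typ_iff: "sb_typ f a b \<longleftrightarrow> wt f \<and> tsrc f = a \<and> ttgt f = b"
proof
  show "sb_typ f a b \<Longrightarrow> wt f \<and> tsrc f = a \<and> ttgt f = b"
    by (induction rule: sb_typ.induct) auto
  have "wt f \<Longrightarrow> sb_typ f (tsrc f) (ttgt f)"
    by (induction f) (auto intro: sb_typ.intros)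
  then show "wt f \<and> tsrc f = a \<and> ttgt f = b \<Longrightarrow> sb_typ f a b" by auto
qed

text \<open>From here on arrays are handled as vectors; the pointwise rules would unfold them.\<close>

declare plus_fun_apply [simp del] zero_fun_apply [simp del] fscale_apply [simp del]
  sum_fun_apply [simp del] fun_diff_apply [simp del]

lemma aone_supp [simp]: "aone \<in> supp_on {[]}"
  by (simp add: aone_dlt)

declare aprod_supp [simp]

context spin_setup
begin

declare idx.simps [simp del] base.simps [simp del]

subsection \<open>Intertwiners between tensor words\<close>

definition warr :: "sb_ob list \<Rightarrow> sb_ob list \<Rightarrow> ('v cl gmod, array \<Rightarrow> array) arrow \<Rightarrow> bool" where
  "warr a b A \<longleftrightarrow> src A = wmod a \<and> tgt A = wmod b \<and>
    amap A \<in> lin_maps fscale fscale (supp_on (wds a)) (supp_on (wds b)) \<and>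
    (\<forall>g\<in>GV Q. \<forall>t\<in>supp_on (wds a). amap A (act (wmod a) g t) = act (wmod b) g (amap A t))"

lemma
  assumes "warr a b A"
  shows warr_src: "src A = wmod a" and warr_tgt: "tgt A = wmod b"
    and warr_lin: "amap A \<in> lin_maps fscale fscale (supp_on (wds a)) (supp_on (wds b))"
    and warr_act: "g \<in> GV Q \<Longrightarrow> t \<in> supp_on (wds a) \<Longrightarrow>
      amap A (act (wmod a) g t) = act (wmod b) g (amap A t)"
    and warr_in: "t \<in> supp_on (wds a) \<Longrightarrow> amap A t \<in> supp_on (wds b)"
  using assms by (auto simp: warr_def lin_maps_in)

lemma warrI:
  assumes "src A = wmod a" "tgt A = wmod b"
    and lin: "amap A \<in> lin_maps fscale fscale (supp_on (wds a)) (supp_on (wds b))"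
    and act: "\<And>g w. g \<in> GV Q \<Longrightarrow> w \<in> wds a \<Longrightarrow> amap A (act (wmod a) g (dlt w)) = act (wmod b) g (amap A (dlt w))"
  shows "warr a b A"
  unfolding warr_def
proof (intro conjI ballI assms(1-3))
  fix g t assume g: "g \<in> GV Q" and t: "t \<in> supp_on (wds a)"
  have "(\<lambda>t\<in>supp_on (wds a). amap A (act (wmod a) g t)) = (\<lambda>t\<in>supp_on (wds a). act (wmod b) g (amap A t))"
    by (rule lin_maps_eqI[OF fscale.vector_space_axioms supp_comp_lin[OF act_wmod_lin[OF g] lin]
          supp_comp_lin[OF lin act_wmod_lin[OF g]] finite_wds]) (simp add: act[OF g])
  from fun_cong[OF this, of t] t show "amap A (act (wmod a) g t) = act (wmod b) g (amap A t)"
    by simp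
qed

lemma warr_eqI:
  assumes A: "warr a b A" and B: "warr a b B" and eq: "\<And>w. w \<in> wds a \<Longrightarrow> amap A (dlt w) = amap B (dlt w)"
  shows "A = B"
proof -
  have "amap A = amap B"
    by (rule lin_maps_eqI[OF fscale.vector_space_axioms warr_lin[OF A] warr_lin[OF B] finite_wds eq])
  then show ?thesis
    using warr_src[OF A] warr_src[OF B] warr_tgt[OF A] warr_tgt[OF B] by simp
qed

lemma warr_iff_arr: "warr a b A \<longleftrightarrow> A \<in> arr (GV_mod Q) \<and> src A = wmod a \<and> tgt A = wmod b"
  by (auto simp: GV_mod_def warr_def coord_is_GV_module[OF coord_wmod])

lemma warr_sum:
  assumes "warr a b A" "\<And>i. i \<in> I \<Longrightarrow> x i \<in> supp_on (wds a)"
  shows "amap A (\<Sum>i\<in>I. x i) = (\<Sum>i\<in>I. amap A (x i))"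
  using lin_maps_sum[OF fscale.vector_space_axioms warr_lin[OF assms(1)], of I x "\<lambda>_. 1"] assms(2)
  by simp

lemma warr_scale:
  "warr a b A \<Longrightarrow> x \<in> supp_on (wds a) \<Longrightarrow> amap A (fscale c x) = fscale c (amap A x)"
  using lin_maps_scale[OF warr_lin] by blast

lemma warr_ide: "warr a a (ide (GV_mod Q) (wmod a))"
  by (auto simp: warr_def GV_mod_def restrict_id_lin lin_maps_in[OF act_wmod_lin])

lemma warr_cmp:
  assumes f: "warr a b f" and g: "warr b c g"
  shows "warr a c (cmp (GV_mod Q) g f)"
  unfolding warr_def
proof (intro conjI ballI)
  show "amap (cmp (GV_mod Q) g f) \<in> lin_maps fscale fscale (supp_on (wds a)) (supp_on (wds c))"
    using supp_comp_lin[OF warr_lin[OF f] warr_lin[OF g]] by (simp add: GV_mod_def warr_src[OF f])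
  fix h t assume h: "h \<in> GV Q" and t: "t \<in> supp_on (wds a)"
  then show "amap (cmp (GV_mod Q) g f) (act (wmod a) h t) = act (wmod c) h (amap (cmp (GV_mod Q) g f) t)"
    by (simp add: GV_mod_def warr_src[OF f] lin_maps_in[OF act_wmod_lin] warr_in[OF f]
        warr_act[OF f] warr_act[OF g])
qed (simp_all add: GV_mod_def warr_src[OF f] warr_tgt[OF g])

lemma cmp_apply: "warr a b f \<Longrightarrow> t \<in> supp_on (wds a) \<Longrightarrow> amap (cmp (GV_mod Q) g f) t = amap g (amap f t)"
  by (simp add: GV_mod_def warr_src)

lemma tenA_apply:
  assumes f: "warr a b f" and g: "warr c d g" and s: "s \<in> supp_on (wds a)" and t: "t \<in> supp_on (wds c)"
  shows "amap (tenA (GV_mod Q) f g) (s \<star> t) = amap f s \<star> amap g t"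
  using map_tensor_aprod[OF finite_wds finite_wds length_wds warr_lin[OF f] warr_lin[OF g] s t]
  by (simp add: GV_mod_def warr_src[OF f] warr_src[OF g])

lemma wds_append_cases:
  assumes "w \<in> wds (a @ b)"
  obtains u v where "u \<in> wds a" "v \<in> wds b" "dlt w = dlt u \<star> dlt v"
  using assms unfolding wds_append cat_words_def by (auto simp: dlt_aprod)

lemma warr_tenA:
  assumes f: "warr a b f" and g: "warr c d g"
  shows "warr (a @ c) (b @ d) (tenA (GV_mod Q) f g)"
proof (rule warrI)
  show "amap (tenA (GV_mod Q) f g) \<in> lin_maps fscale fscale (supp_on (wds (a @ c))) (supp_on (wds (b @ d)))"
    using map_tensor_lin[OF finite_wds finite_wds length_wds warr_lin[OF f] warr_lin[OF g]]
    by (simp add: GV_mod_def warr_src[OF f] warr_src[OF g] wds_append)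
  fix h w assume h: "h \<in> GV Q" and "w \<in> wds (a @ c)"
  then obtain u v where uv: "u \<in> wds a" "v \<in> wds c" and w: "dlt w = dlt u \<star> dlt v"
    by (rule_tac wds_append_cases)
  then show "amap (tenA (GV_mod Q) f g) (act (wmod (a @ c)) h (dlt w))
      = act (wmod (b @ d)) h (amap (tenA (GV_mod Q) f g) (dlt w))"
    using h by (simp add: act_wmod_aprod tenA_apply[OF f g] lin_maps_in[OF act_wmod_lin]
        warr_in[OF f] warr_in[OF g] warr_act[OF f] warr_act[OF g])
qed (simp_all add: GV_mod_def warr_src[OF f] warr_src[OF g] warr_tgt[OF f] warr_tgt[OF g] wmod_append)

lemma warr_addA:
  assumes f: "warr a b f" and g: "warr a b g"
  shows "warr a b (addA (GV_mod Q) f g)"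
  unfolding warr_def
proof (intro conjI ballI)
  show "amap (addA (GV_mod Q) f g) \<in> lin_maps fscale fscale (supp_on (wds a)) (supp_on (wds b))"
    by (rule lin_mapsI)
      (simp_all add: GV_mod_def warr_src[OF f] warr_in[OF f] warr_in[OF g] lin_maps_add[OF warr_lin[OF f]]
        lin_maps_add[OF warr_lin[OF g]] warr_scale[OF f] warr_scale[OF g] fscale.scale_right_distrib)
  fix h t assume h: "h \<in> GV Q" and t: "t \<in> supp_on (wds a)"
  then show "amap (addA (GV_mod Q) f g) (act (wmod a) h t) = act (wmod b) h (amap (addA (GV_mod Q) f g) t)"
    by (simp add: GV_mod_def warr_src[OF f] lin_maps_in[OF act_wmod_lin] warr_in[OF f] warr_in[OF g]
        warr_act[OF f] warr_act[OF g] lin_maps_add[OF act_wmod_lin])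
qed (simp_all add: GV_mod_def warr_src[OF f] warr_tgt[OF f])

lemma warr_sclA:
  assumes f: "warr a b f"
  shows "warr a b (sclA (GV_mod Q) c f)"
  unfolding warr_def
proof (intro conjI ballI)
  show "amap (sclA (GV_mod Q) c f) \<in> lin_maps fscale fscale (supp_on (wds a)) (supp_on (wds b))"
    by (rule lin_mapsI)
      (simp_all add: GV_mod_def warr_src[OF f] warr_in[OF f] lin_maps_add[OF warr_lin[OF f]]
        warr_scale[OF f] fscale.scale_right_distrib mult.commute)
  fix h t assume h: "h \<in> GV Q" and t: "t \<in> supp_on (wds a)"
  then show "amap (sclA (GV_mod Q) c f) (act (wmod a) h t) = act (wmod b) h (amap (sclA (GV_mod Q) c f) t)"
    by (simp add: GV_mod_def warr_src[OF f] lin_maps_in[OF act_wmod_lin] warr_in[OF f]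
        warr_act[OF f] lin_maps_scale[OF act_wmod_lin])
qed (simp_all add: GV_mod_def warr_src[OF f] warr_tgt[OF f])

subsection \<open>The two forms and their dual bases\<close>

text \<open>Both forms are monomial: \<open>\<Phi>\<^sub>U(x\<^sub>p, x\<^sub>q)\<close> is \<open>gsign p\<close> if \<open>q = dual p\<close>, and \<open>0\<close> otherwise.\<close>

fun dual :: "ix \<Rightarrow> ix" where
  "dual (IS I) = IS ({1..n} - I)"
| "dual (IV i) = IV i"

fun gsign :: "ix \<Rightarrow> complex" where
  "gsign (IS I) = form_sign N I"
| "gsign (IV i) = 1"

definition bform :: "sb_ob \<Rightarrow> array \<Rightarrow> array \<Rightarrow> complex" where
  "bform X s t = (\<Sum>p\<in>idx X. gsign p * s [p] * t [dual p])"

text \<open>Taken to be 0 off \<open>idx X\<close>, so that membership in \<open>R X\<close> holds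
  for every \<open>p\<close> and can be used inside sums without a side condition.\<close>

definition bvec :: "sb_ob \<Rightarrow> ix \<Rightarrow> array" where
  "bvec X p = (if p \<in> idx X then dlt [p] else 0)"

text \<open>The left dual basis: the vector at \<open>dual p\<close> pairs with the one at
  \<open>p\<close> to \<open>gsign (dual p)\<close>, a sign and therefore its own inverse.\<close>

definition dvec :: "sb_ob \<Rightarrow> ix \<Rightarrow> array" where
  "dvec X p = (if p \<in> idx X then fscale (gsign (dual p)) (dlt [dual p]) else 0)"

lemma dual_in: "p \<in> idx X \<Longrightarrow> dual p \<in> idx X"
  by (cases X) (auto simp: idx.simps)

lemma dual_dual: "p \<in> idx X \<Longrightarrow> dual (dual p) = p"
  by (cases X) (auto simp: idx.simps)

lemma gsign_sq: "gsign p * gsign p = 1"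
  by (cases p) auto

lemma R_expand: "t \<in> R X \<Longrightarrow> t = (\<Sum>p\<in>idx X. fscale (t [p]) (dlt [p]))"
  using supp_on_expand[of "(\<lambda>i. [i]) ` idx X" t] by (simp add: sum.reindex inj_on_def)

lemma bvec_in [simp]: "bvec X p \<in> R X"
  by (simp add: bvec_def)

lemma dvec_in [simp]: "dvec X p \<in> R X"
  using dual_in by (simp add: dvec_def)

lemma bform_linear:
  "bform X (s + s') t = bform X s t + bform X s' t"
  "bform X s (t + t') = bform X s t + bform X s t'"
  "bform X (fscale c s) t = c * bform X s t"
  "bform X s (fscale c t) = c * bform X s t"
  by (simp_all add: bform_def plus_fun_apply fscale_apply algebra_simps sum.distrib sum_distrib_left)

lemma bform_dvec: "p \<in> idx X \<Longrightarrow> bform X (dvec X p) y = y [p]"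
proof -
  assume p: "p \<in> idx X"
  have "bform X (dvec X p) y = (\<Sum>q\<in>idx X. if q = dual p then gsign (dual p) * gsign (dual p) * y [dual (dual p)] else 0)"
    unfolding bform_def dvec_def by (rule sum.cong) (use p in \<open>auto simp: fscale_apply dlt_apply\<close>)
  then show ?thesis using p dual_in[OF p] by (simp add: gsign_sq dual_dual[OF p])
qed

lemma bform_bvec: "p \<in> idx X \<Longrightarrow> bform X y (bvec X p) = gsign (dual p) * y [dual p]"
proof -
  assume p: "p \<in> idx X"
  have "bform X y (bvec X p) = (\<Sum>q\<in>idx X. if q = dual p then gsign (dual p) * y [dual p] else 0)"
    unfolding bform_def bvec_def
    by (rule sum.cong) (use p dual_dual[of _ X] in \<open>auto simp: dlt_apply\<close>)
  then show ?thesis using p dual_in[OF p] by simp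
qed

text \<open>This formula and the next are the two zigzag identities in coordinates.\<close>

lemma repro_left: "y \<in> R X \<Longrightarrow> (\<Sum>p\<in>idx X. fscale (bform X (dvec X p) y) (bvec X p)) = y"
  using R_expand[of y X] by (simp add: bform_dvec bvec_def cong: sum.cong)

lemma repro_right: "y \<in> R X \<Longrightarrow> (\<Sum>p\<in>idx X. fscale (bform X y (bvec X p)) (dvec X p)) = y"
proof -
  assume y: "y \<in> R X"
  have "(\<Sum>p\<in>idx X. fscale (bform X y (bvec X p)) (dvec X p)) = (\<Sum>p\<in>idx X. fscale (y [dual p]) (dlt [dual p]))"
  proof (rule sum.cong[OF HOL.refl])
    fix p assume p: "p \<in> idx X"
    have "gsign (dual p) * y [dual p] * gsign (dual p) = y [dual p]"
      using gsign_sq[of "dual p"] by (simp add: mult.commute mult.left_commute)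
    then show "fscale (bform X y (bvec X p)) (dvec X p) = fscale (y [dual p]) (dlt [dual p])"
      using p by (simp add: bform_bvec dvec_def)
  qed
  also have "\<dots> = (\<Sum>p\<in>idx X. fscale (y [p]) (dlt [p]))"
    by (rule sum.reindex_bij_witness[of _ dual dual]) (auto simp: dual_dual dual_in)
  finally show ?thesis using R_expand[OF y] by simp
qed

text \<open>Applied to the image of a basis under \<open>g \<in> G(V)\<close>, to the cup of an arbitrary functor, and to an
  arbitrary basis, this gives the invariance, the uniqueness and the basis independence of the cups.\<close>

lemma dual_system:
  assumes "\<And>i. i \<in> I \<Longrightarrow> c i \<in> R X"
    and sys: "\<And>y. y \<in> R X \<Longrightarrow> (\<Sum>i\<in>I. fscale (bform X (c i) y) (b i)) = y"
  shows "(\<Sum>i\<in>I. b i \<star> c i) = (\<Sum>p\<in>idx X. bvec X p \<star> dvec X p)"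
proof -
  \<comment> \<open>Each right factor is expanded in the standard dual basis. Its coefficients are
    then moved to the left factor, where \<open>sys\<close> applied to \<open>bvec X p\<close> sums
    them up.\<close>
  have "(\<Sum>i\<in>I. b i \<star> c i) = (\<Sum>i\<in>I. b i \<star> (\<Sum>p\<in>idx X. fscale (bform X (c i) (bvec X p)) (dvec X p)))"
    using repro_right assms(1) by simp
  also have "\<dots> = (\<Sum>i\<in>I. \<Sum>p\<in>idx X. fscale (bform X (c i) (bvec X p)) (b i \<star> dvec X p))"
    by (simp add: aprod_sum_right aprod_scale_right)
  also have "\<dots> = (\<Sum>p\<in>idx X. \<Sum>i\<in>I. fscale (bform X (c i) (bvec X p)) (b i \<star> dvec X p))"
    by (rule sum.swap)
  also have "\<dots> = (\<Sum>p\<in>idx X. (\<Sum>i\<in>I. fscale (bform X (c i) (bvec X p)) (b i)) \<star> dvec X p)"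
    by (simp add: aprod_sum_left aprod_scale_left)
  also have "\<dots> = (\<Sum>p\<in>idx X. bvec X p \<star> dvec X p)"
    by (simp add: sys)
  finally show ?thesis .
qed

lemma bform_S: "bform \<S> (spin_arr x) (spin_arr y) = spin_form N x y"
  by (simp add: bform_def idx.simps sum.reindex inj_on_def spin_form_eq)

lemma bform_V: "bform \<V> (vec_arr Q e p) (vec_arr Q e q) = vform Q p q"
proof -
  have "bform \<V> (vec_arr Q e p) (vec_arr Q e q) = (\<Sum>i\<in>{1..N}. vform Q (e i) p * vform Q (e i) q)"
    unfolding bform_def idx.simps by (subst sum.reindex) (auto simp: inj_on_def vec_arr_apply)
  then show ?thesis by (simp add: vform_expand[of p q])
qed

definition sw :: "sb_ob \<Rightarrow> sb_ob \<Rightarrow> complex" where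
  "sw X Y = (if X = \<S> \<and> Y = \<S> then \<sigma> else 1)"

lemma sw_sq: "sw X Y * sw Y X = 1"
  using sigma_sq by (simp add: sw_def)

lemma sw_commute: "sw X Y = sw Y X"
  by (simp add: sw_def)

lemma bform_swap:
  assumes "s \<in> R X" "t \<in> R X"
  shows "sw X X * bform X t s = bform X s t"
proof (cases X)
  case S: \<S>
  then obtain x y where "s = spin_arr x" "t = spin_arr y"
    using assms R_S by auto
  then show ?thesis
    using sigma_sq spin_form_swap[of N x y] by (simp add: S sw_def bform_S spin_form_swap[of N y x] flip: mult.assoc)
next
  case V: \<V>
  then obtain p q where "s = vec_arr Q e p" "t = vec_arr Q e q"
    using assms R_V by auto
  then show ?thesis by (simp add: V sw_def bform_V vform_sym)
qed

lemma act_in_R: "g \<in> GV Q \<Longrightarrow> t \<in> R X \<Longrightarrow> act (base X) g t \<in> R X"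
  by (rule lin_maps_in[OF coord_act_lin[OF coord_base]])

lemma bform_act:
  assumes g: "g \<in> GV Q" and "s \<in> R X" "t \<in> R X"
  shows "bform X (act (base X) g s) (act (base X) g t) = bform X s t"
proof (cases X)
  case S: \<S>
  then obtain x y where xy: "s = spin_arr x" "t = spin_arr y" "x \<in> Spinors" "y \<in> Spinors"
    using assms R_S by auto
  show ?thesis
    unfolding S xy(1,2) spin_act[OF g xy(3)] spin_act[OF g xy(4)] bform_S by (rule spin_form_GV[OF g])
next
  case V: \<V>
  then obtain p q where pq: "s = vec_arr Q e p" "t = vec_arr Q e q"
    using assms R_V by auto
  show ?thesis
    unfolding V pq vec_act[OF g] bform_V by (rule vform_vec_action[OF GV_subset_Pin[OF g]])
qed

text \<open>Serves the invariance of the cup, where an arbitrary \<open>y\<close> has to be a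
  translate. On S the inverse is the action of \<iota>(g); on V surjectivity is the condition g V
  g^(-1) = V.\<close>

lemma act_surj:
  assumes g: "g \<in> GV Q" and y: "y \<in> R X"
  obtains y' where "y' \<in> R X" "act (base X) g y' = y"
proof (cases X)
  case S: \<S>
  then obtain x where x: "y = spin_arr x" "x \<in> Spinors"
    using y R_S by auto
  have c: "rep.cl_op (cl_iota Q g) x \<in> Spinors"
    using cl_op_supp Pin_closed[OF GV_subset_Pin[OF g]] x(2) by simp
  show thesis
  proof (rule that)
    show "spin_arr (rep.cl_op (cl_iota Q g) x) \<in> R X"
      unfolding S by (rule spin_arr_in_R[OF c])
    show "act (base X) g (spin_arr (rep.cl_op (cl_iota Q g) x)) = y"
      unfolding S x(1) spin_act[OF g c] cl_op_iota_cancel[OF GV_subset_Pin[OF g]] ..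
  qed
next
  case V: \<V>
  then obtain v where v: "y = vec_arr Q e v" using y R_V by auto
  have "cl_vec Q v \<in> (\<lambda>x. g \<otimes>\<^bsub>Cl Q\<^esub> x \<otimes>\<^bsub>Cl Q\<^esub> inv\<^bsub>Cl Q\<^esub> g) ` range (cl_vec Q)"
    using GV_subset_Pin[OF g] by (simp add: Pin_def)
  then obtain u where "cl_vec Q v = cl_vec Q (vec_action Q g u)"
    using cl_vec_vec_action[OF GV_subset_Pin[OF g]] by auto
  then have u: "vec_action Q g u = v" using cl_vec_inj by metis
  show thesis
    by (rule that[of "vec_arr Q e u"]) (simp_all only: V v vec_act[OF g] u vec_arr_in_R)
qed

subsection \<open>The images of the generators\<close>

definition mu :: "array \<Rightarrow> array \<Rightarrow> array" where
  "mu s t = spin_arr (cliff (unvec s) (unspin t))"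

text \<open>Like \<open>swap_map\<close> and \<open>mu_map\<close>, given by a formula in the
  coefficients of an arbitrary tensor, which makes linearity immediate; the values on pure tensors
  are derived afterwards.\<close>

definition cap_map :: "sb_ob \<Rightarrow> array \<Rightarrow> array" where
  "cap_map X t = fscale (\<Sum>p\<in>idx X. gsign p * t [p, dual p]) aone"

definition cup_map :: "sb_ob \<Rightarrow> array \<Rightarrow> array" where
  "cup_map X t = fscale (t []) (\<Sum>p\<in>idx X. bvec X p \<star> dvec X p)"

definition swap_map :: "sb_ob \<Rightarrow> sb_ob \<Rightarrow> array \<Rightarrow> array" where
  "swap_map X Y t = (\<lambda>w. sw X Y * t (rev w))"

definition mu_map :: "array \<Rightarrow> array" where
  "mu_map t = (\<Sum>j\<in>{1..N}. spin_arr (gam N \<epsilon> j (\<lambda>I. t [IV j, IS I])))"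

lemma aprod_pair: "s \<in> R X \<Longrightarrow> (s \<star> t) [p, q] = s [p] * t [q]"
  using aprod_append[of s "[p]" t "[q]"] by (force simp: supp_on_def)

lemma wds2: "w \<in> wds [X, Y] \<longleftrightarrow> (\<exists>p\<in>idx X. \<exists>q\<in>idx Y. w = [p, q])"
proof
  show "w \<in> wds [X, Y] \<Longrightarrow> \<exists>p\<in>idx X. \<exists>q\<in>idx Y. w = [p, q]"
    by (auto elim!: cat_wordsE)
  have "[p] @ [q] \<in> wds [X, Y]" if "p \<in> idx X" "q \<in> idx Y" for p q
    using cat_wordsI[of "[p]" _ "[q]"] that by simp
  then show "\<exists>p\<in>idx X. \<exists>q\<in>idx Y. w = [p, q] \<Longrightarrow> w \<in> wds [X, Y]" by auto
qed

lemma cap_map_aprod: "s \<in> R X \<Longrightarrow> cap_map X (s \<star> t) = fscale (bform X s t) aone"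
  by (simp add: cap_map_def bform_def aprod_pair mult.assoc)

lemma swap_map_supp: "t \<in> supp_on (wds [X, Y]) \<Longrightarrow> swap_map X Y t \<in> supp_on (wds [Y, X])"
proof (rule supp_onI)
  fix w assume t: "t \<in> supp_on (wds [X, Y])" and "w \<notin> wds [Y, X]"
  then have "rev w \<notin> wds [X, Y]" unfolding wds2 by (metis rev.simps rev_rev_ident append.simps)
  with t show "swap_map X Y t w = 0" by (simp add: swap_map_def supp_onD del: wds.simps)
qed

lemma swap_map_aprod:
  assumes s: "s \<in> R X" and t: "t \<in> R Y"
  shows "swap_map X Y (s \<star> t) = fscale (sw X Y) (t \<star> s)"
proof
  fix w
  show "swap_map X Y (s \<star> t) w = fscale (sw X Y) (t \<star> s) w"
  proof (cases "w \<in> wds [Y, X]")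
    case True
    then obtain q p where "w = [q, p]" unfolding wds2 by auto
    then show ?thesis
      using aprod_pair[OF s, of t p q] aprod_pair[OF t, of s q p] by (simp add: swap_map_def fscale_apply)
  next
    case False
    have "s \<star> t \<in> supp_on (wds [X, Y])" "t \<star> s \<in> supp_on (wds [Y, X])"
      using s t by simp_all
    then have "swap_map X Y (s \<star> t) \<in> supp_on (wds [Y, X])" "t \<star> s \<in> supp_on (wds [Y, X])"
      by (simp_all only: swap_map_supp)
    from this[THEN supp_onD, OF False] show ?thesis by (simp add: fscale_apply)
  qed
qed

lemma mu_map_aprod:
  assumes s: "s \<in> R \<V>" and t: "t \<in> R \<S>"
  shows "mu_map (s \<star> t) = mu s t"
proof -
  have "(\<lambda>I. (s \<star> t) [IV j, IS I]) = fscale (s [IV j]) (unspin t)" for j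
    by (simp add: fun_eq_iff aprod_pair[OF s] fscale_apply unspin_def)
  moreover have "vform Q (e j) (unvec s) = s [IV j]" if "j \<in> {1..N}" for j
    using that vec_arr_unvec[OF s] vec_arr_apply[of "unvec s" j] by simp
  ultimately show ?thesis
    by (simp add: mu_map_def mu_def cliff_def gam_scale spin_arr_sum spin_arr_scale)
qed

lemma mu_in: "t \<in> R \<S> \<Longrightarrow> mu s t \<in> R \<S>"
  unfolding mu_def by (intro spin_arr_in_R cliff_supp unspin_Spinors)

lemma mu_act:
  assumes g: "g \<in> GV Q" and s: "s \<in> R \<V>" and t: "t \<in> R \<S>"
  shows "mu (act (base \<V>) g s) (act (base \<S>) g t) = act (base \<S>) g (mu s t)"
proof -
  obtain p where p: "s = vec_arr Q e p" using s R_V by auto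
  obtain x where x: "t = spin_arr x" "x \<in> Spinors" using t R_S by auto
  show ?thesis
    unfolding p x mu_def vec_act[OF g] spin_act[OF g x(2)] unvec_vec_arr unspin_spin_arr
      spin_act[OF g cliff_supp[OF x(2)]] cliff_vec_action'[OF GV_subset_Pin[OF g]] ..
qed

lemma bform_mu:
  assumes "x \<in> R \<S>" "y \<in> R \<S>"
  shows "bform \<S> (mu v x) y = \<kappa> * bform \<S> x (mu v y)"
proof -
  obtain x' y' where "x = spin_arr x'" "y = spin_arr y'" using assms R_S by auto
  then show ?thesis by (simp add: mu_def bform_S spin_form_cliff[of _ x'])
qed

lemma mu_clifford:
  assumes "v \<in> R \<V>" "w \<in> R \<V>" "x \<in> R \<S>"
  shows "mu v (mu w x) + mu w (mu v x) = fscale (2 * bform \<V> v w) x"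
proof -
  obtain p q where "v = vec_arr Q e p" "w = vec_arr Q e q" using assms R_V by auto
  moreover obtain x' where "x = spin_arr x'" using assms R_S by auto
  ultimately show ?thesis
    by (simp add: mu_def bform_V rep.T_clifford flip: spin_arr_add spin_arr_scale)
qed

definition gen_arr :: "sb_ob list \<Rightarrow> sb_ob list \<Rightarrow> (array \<Rightarrow> array) \<Rightarrow> ('v cl gmod, array \<Rightarrow> array) arrow" where
  "gen_arr a b f = \<lparr>src = wmod a, tgt = wmod b, amap = restrict f (supp_on (wds a))\<rparr>"

lemma act_single: "act (wmod [X]) = act (base X)"
  by (simp add: wmod_single)

lemma act_pair:
  "g \<in> GV Q \<Longrightarrow> s \<in> R X \<Longrightarrow> t \<in> R Y \<Longrightarrow> act (wmod [X, Y]) g (s \<star> t) = act (base X) g s \<star> act (base Y) g t"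
  using act_wmod_aprod[of g s "[X]" t "[Y]"] by (simp add: act_single)

lemma act_nil: "g \<in> GV Q \<Longrightarrow> act (wmod []) g aone = aone"
  by (simp add: wmod_Nil unit_act)

lemma act_nil_scale: "g \<in> GV Q \<Longrightarrow> act (wmod []) g (fscale c aone) = fscale c aone"
  using lin_maps_scale[OF act_wmod_lin[of g "[]"], of aone c] act_nil by simp

lemma gen_arr_pairI:
  assumes add: "\<And>x y. f (x + y) = f x + f y" and scale: "\<And>c x. f (fscale c x) = fscale c (f x)"
    and supp: "\<And>t. t \<in> supp_on (wds [X, Y]) \<Longrightarrow> f t \<in> supp_on (wds b)"
    and act: "\<And>g s t. g \<in> GV Q \<Longrightarrow> s \<in> R X \<Longrightarrow> t \<in> R Y \<Longrightarrow>
      f (act (base X) g s \<star> act (base Y) g t) = act (wmod b) g (f (s \<star> t))"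
  shows "warr [X, Y] b (gen_arr [X, Y] b f)"
proof (rule warrI)
  show "amap (gen_arr [X, Y] b f) \<in> lin_maps fscale fscale (supp_on (wds [X, Y])) (supp_on (wds b))"
    unfolding gen_arr_def arrow.simps
    by (rule lin_mapsI) (simp_all add: add scale supp del: wds.simps)
  fix g w assume g: "g \<in> GV Q" and "w \<in> wds [X, Y]"
  then obtain p q where p: "p \<in> idx X" and q: "q \<in> idx Y" and w: "w = [p] @ [q]"
    unfolding wds2 by auto
  have d: "dlt w = dlt [p] \<star> dlt [q]" unfolding w dlt_aprod ..
  have R: "dlt [p] \<in> R X" "dlt [q] \<in> R Y" using p q by auto
  show "amap (gen_arr [X, Y] b f) (act (wmod [X, Y]) g (dlt w))
      = act (wmod b) g (amap (gen_arr [X, Y] b f) (dlt w))"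
    unfolding d act_pair[OF g R] using act[OF g R] act_in_R[OF g R(1)] act_in_R[OF g R(2)] R
    by (simp add: gen_arr_def)
qed (simp_all add: gen_arr_def)

lemma warr_cap: "warr [X, X] [] (gen_arr [X, X] [] (cap_map X))"
proof (rule gen_arr_pairI)
  fix x y :: array and c
  show "cap_map X (x + y) = cap_map X x + cap_map X y"
    unfolding cap_map_def fscale.scale_left_distrib[symmetric]
    by (simp add: plus_fun_apply distrib_left sum.distrib)
  show "cap_map X (fscale c x) = fscale c (cap_map X x)"
    by (simp add: cap_map_def fscale_apply sum_distrib_left mult.left_commute)
  show "cap_map X x \<in> supp_on (wds [])"
    by (simp add: cap_map_def)
next
  fix g s t assume g: "g \<in> GV Q" and s: "s \<in> R X" and t: "t \<in> R X"
  show "cap_map X (act (base X) g s \<star> act (base X) g t) = act (wmod []) g (cap_map X (s \<star> t))"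
    unfolding cap_map_aprod[OF act_in_R[OF g s]] cap_map_aprod[OF s] bform_act[OF g s t] act_nil_scale[OF g] ..
qed

lemma warr_swap: "warr [X, Y] [Y, X] (gen_arr [X, Y] [Y, X] (swap_map X Y))"
proof (rule gen_arr_pairI)
  fix g s t assume g: "g \<in> GV Q" and s: "s \<in> R X" and t: "t \<in> R Y"
  have "t \<star> s \<in> supp_on (wds [Y, X])" using s t by simp
  from lin_maps_scale[OF act_wmod_lin[OF g] this]
  show "swap_map X Y (act (base X) g s \<star> act (base Y) g t) = act (wmod [Y, X]) g (swap_map X Y (s \<star> t))"
    by (simp add: swap_map_aprod act_in_R g s t act_pair[OF g t s] del: wds.simps)
qed (rule swap_map_supp, assumption | simp add: swap_map_def fun_eq_iff plus_fun_apply fscale_apply algebra_simps)+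

lemma warr_mu: "warr [\<V>, \<S>] [\<S>] (gen_arr [\<V>, \<S>] [\<S>] mu_map)"
proof (rule gen_arr_pairI)
  fix x y :: array and c
  have "(\<lambda>I. (x + y) [IV j, IS I]) = (\<lambda>I. x [IV j, IS I]) + (\<lambda>I. y [IV j, IS I])"
    "(\<lambda>I. fscale c x [IV j, IS I]) = fscale c (\<lambda>I. x [IV j, IS I])" for j
    by (auto simp: plus_fun_apply fscale_apply)
  then show "mu_map (x + y) = mu_map x + mu_map y" "mu_map (fscale c x) = fscale c (mu_map x)"
    by (simp_all add: mu_map_def gam_add gam_scale spin_arr_add spin_arr_scale sum.distrib fscale.scale_sum_right)
next
  fix t assume t: "t \<in> supp_on (wds [\<V>, \<S>])"
  have "(\<lambda>I. t [IV j, IS I]) \<in> Spinors" if "j \<in> {1..N}" for j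
  proof (rule supp_onI)
    fix I assume "I \<notin> Pow {1..n}"
    then have "[IV j, IS I] \<notin> wds [\<V>, \<S>]" unfolding wds2 by (auto simp: idx.simps)
    with t show "t [IV j, IS I] = 0" by (rule supp_onD)
  qed
  then show "mu_map t \<in> supp_on (wds [\<S>])"
    unfolding mu_map_def wds_single by (intro supp_on_sum spin_arr_in_R gam_supp)
next
  fix g s t assume g: "g \<in> GV Q" and s: "s \<in> R \<V>" and t: "t \<in> R \<S>"
  then show "mu_map (act (base \<V>) g s \<star> act (base \<S>) g t) = act (wmod [\<S>]) g (mu_map (s \<star> t))"
    by (simp add: mu_map_aprod act_in_R act_single mu_act)
qed

lemma warr_cup: "warr [] [X, X] (gen_arr [] [X, X] (cup_map X))"
proof (rule warrI)
  let ?c = "\<Sum>p\<in>idx X. bvec X p \<star> dvec X p"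
  have c: "?c \<in> supp_on (wds [X, X])" by (rule supp_on_sum) simp
  show "amap (gen_arr [] [X, X] (cup_map X)) \<in> lin_maps fscale fscale (supp_on (wds [])) (supp_on (wds [X, X]))"
    unfolding gen_arr_def arrow.simps
    by (rule lin_mapsI)
      (simp_all add: cup_map_def plus_fun_apply fscale_apply fscale.scale_left_distrib supp_on_scale[OF c] del: wds.simps)
  fix g w assume g: "g \<in> GV Q" and "w \<in> wds []"
  then have w: "dlt w = aone" by (simp add: aone_dlt)
  have "aone \<in> supp_on (wds [])" by simp
  then have cup: "amap (gen_arr [] [X, X] (cup_map X)) aone = ?c"
    by (simp add: gen_arr_def cup_map_def aone_def)
  have "act (wmod [X, X]) g ?c = (\<Sum>p\<in>idx X. act (wmod [X, X]) g (bvec X p \<star> dvec X p))"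
    using lin_maps_sum[OF fscale.vector_space_axioms act_wmod_lin[OF g, of "[X, X]"], of "idx X" "\<lambda>p. bvec X p \<star> dvec X p" "\<lambda>_. 1"]
    by simp
  also have "\<dots> = (\<Sum>p\<in>idx X. act (base X) g (bvec X p) \<star> act (base X) g (dvec X p))"
    by (simp add: act_pair[OF g])
  also have "\<dots> = ?c"
  proof (rule dual_system)
    show "act (base X) g (dvec X p) \<in> R X" for p by (simp add: act_in_R g)
    fix y assume "y \<in> R X"
    then obtain z where z: "z \<in> R X" "act (base X) g z = y" by (rule act_surj[OF g])
    \<comment> \<open>With \<open>y\<close> written as the translate of \<open>z\<close>, invariance
      of the form turns these coefficients into those of \<open>z\<close> in the untranslated
      basis.\<close>
    have "(\<Sum>p\<in>idx X. fscale (bform X (act (base X) g (dvec X p)) y) (act (base X) g (bvec X p)))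
        = (\<Sum>p\<in>idx X. fscale (bform X (dvec X p) z) (act (base X) g (bvec X p)))"
      by (simp add: z(2)[symmetric] bform_act[OF g] z(1))
    also have "\<dots> = act (base X) g (\<Sum>p\<in>idx X. fscale (bform X (dvec X p) z) (bvec X p))"
      by (rule lin_maps_sum[OF fscale.vector_space_axioms coord_act_lin[OF coord_base g], symmetric]) simp
    also have "\<dots> = y" using z repro_left by simp
    finally show "(\<Sum>p\<in>idx X. fscale (bform X (act (base X) g (dvec X p)) y) (act (base X) g (bvec X p))) = y" .
  qed
  finally show "amap (gen_arr [] [X, X] (cup_map X)) (act (wmod []) g (dlt w))
      = act (wmod [X, X]) g (amap (gen_arr [] [X, X] (cup_map X)) (dlt w))"
    by (simp add: w act_nil[OF g] cup del: wds.simps)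
qed (simp_all add: gen_arr_def)

lemma warr_zero: "warr a b (gen_arr a b (\<lambda>_. 0))"
proof (rule warrI)
  show "amap (gen_arr a b (\<lambda>_. 0)) \<in> lin_maps fscale fscale (supp_on (wds a)) (supp_on (wds b))"
    unfolding gen_arr_def arrow.simps by (rule lin_mapsI) simp_all
  fix g w assume g: "g \<in> GV Q" and w: "w \<in> wds a"
  have "act (wmod b) g 0 = 0"
    by (rule lin_maps_zero[OF fscale.vector_space_axioms act_wmod_lin[OF g]])
  then show "amap (gen_arr a b (\<lambda>_. 0)) (act (wmod a) g (dlt w)) = act (wmod b) g (amap (gen_arr a b (\<lambda>_. 0)) (dlt w))"
    using w lin_maps_in[OF act_wmod_lin[OF g], of "dlt w" a] by (simp add: gen_arr_def)
qed (simp_all add: gen_arr_def)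

subsection \<open>Interpretation of terms\<close>

primrec interp :: "complex sb_term \<Rightarrow> ('v cl gmod, array \<Rightarrow> array) arrow" where
  "interp (Id a) = ide (GV_mod Q) (wmod a)"
| "interp (Zero a b) = gen_arr a b (\<lambda>_. 0)"
| "interp (Cap X) = gen_arr [X, X] [] (cap_map X)"
| "interp (Cup X) = gen_arr [] [X, X] (cup_map X)"
| "interp (Swap X Y) = gen_arr [X, Y] [Y, X] (swap_map X Y)"
| "interp Mu = gen_arr [\<V>, \<S>] [\<S>] mu_map"
| "interp (g \<cdot> f) = cmp (GV_mod Q) (interp g) (interp f)"
| "interp (f \<boxtimes> g) = tenA (GV_mod Q) (interp f) (interp g)"
| "interp (f \<boxplus> g) = addA (GV_mod Q) (interp f) (interp g)"
| "interp (Scale r f) = sclA (GV_mod Q) r (interp f)"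

lemma warr_interp: "wt f \<Longrightarrow> warr (tsrc f) (ttgt f) (interp f)"
proof (induction f)
  case (Comp f1 f2)
  then show ?case by (auto intro: warr_cmp)
next
  case (Plus f1 f2)
  then show ?case using warr_addA[of "tsrc f1" "ttgt f1"] by auto
qed (simp_all add: warr_ide warr_zero warr_cap warr_cup warr_swap warr_mu warr_tenA warr_sclA del: wds.simps)

abbreviation "app f \<equiv> amap (interp f)"

section \<open>Evaluation rules for terms on pure tensors\<close>

lemma app_Id [simp]: "t \<in> supp_on (wds a) \<Longrightarrow> app (Id a) t = t"
  by (simp add: GV_mod_def)

lemma app_Zero [simp]: "t \<in> supp_on (wds a) \<Longrightarrow> app (Zero a b) t = 0"
  by (simp add: gen_arr_def)

lemma app_Cap [simp]: "s \<in> R X \<Longrightarrow> t \<in> R X \<Longrightarrow> app (Cap X) (s \<star> t) = fscale (bform X s t) aone"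
  by (simp add: gen_arr_def cap_map_aprod)

lemma app_Cup [simp]: "app (Cup X) aone = (\<Sum>p\<in>idx X. bvec X p \<star> dvec X p)"
proof -
  have "aone [] = 1" by (simp add: aone_def)
  then show ?thesis by (simp add: gen_arr_def cup_map_def)
qed

lemma app_Swap [simp]: "s \<in> R X \<Longrightarrow> t \<in> R Y \<Longrightarrow> app (Swap X Y) (s \<star> t) = fscale (sw X Y) (t \<star> s)"
  by (simp add: gen_arr_def swap_map_aprod)

lemma app_Mu [simp]: "s \<in> R \<V> \<Longrightarrow> t \<in> R \<S> \<Longrightarrow> app Mu (s \<star> t) = mu s t"
  by (simp add: gen_arr_def mu_map_aprod)

lemma app_Comp [simp]:
  "wt f \<Longrightarrow> t \<in> supp_on (wds (tsrc f)) \<Longrightarrow> app (g \<cdot> f) t = app g (app f t)"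
  by (simp add: cmp_apply[OF warr_interp])

lemma app_Plus [simp]:
  "wt f \<Longrightarrow> t \<in> supp_on (wds (tsrc f)) \<Longrightarrow> app (f \<boxplus> g) t = app f t + app g t"
  using warr_src[OF warr_interp[of f]] by (simp add: GV_mod_def)

lemma app_Scale [simp]:
  "wt f \<Longrightarrow> t \<in> supp_on (wds (tsrc f)) \<Longrightarrow> app (Scale r f) t = fscale r (app f t)"
  using warr_src[OF warr_interp[of f]] by (simp add: GV_mod_def)

lemma app_in [simp]: "wt f \<Longrightarrow> t \<in> supp_on (wds (tsrc f)) \<Longrightarrow> app f t \<in> supp_on (wds (ttgt f))"
  by (rule warr_in[OF warr_interp])

lemma app_Tens [simp]:
  "wt f \<Longrightarrow> wt g \<Longrightarrow> s \<in> supp_on (wds (tsrc f)) \<Longrightarrow> t \<in> supp_on (wds (tsrc g)) \<Longrightarrow>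
    app (f \<boxtimes> g) (s \<star> t) = app f s \<star> app g t"
  by (simp add: tenA_apply[OF warr_interp warr_interp])

text \<open>Pure tensors are kept bracketed to the right; this rule regroups them when
  \<open>f\<close> consumes two factors. The membership premises decide which of the two rules
  applies.\<close>

lemma app_Tens2 [simp]:
  "wt f \<Longrightarrow> wt g \<Longrightarrow> r \<star> s \<in> supp_on (wds (tsrc f)) \<Longrightarrow> t \<in> supp_on (wds (tsrc g)) \<Longrightarrow>
    app (f \<boxtimes> g) (r \<star> (s \<star> t)) = app f (r \<star> s) \<star> app g t"
  unfolding aprod_assoc[symmetric] by (rule app_Tens)

text \<open>A cup has empty source, so the argument shows no left factor to match; the unit
  \<open>aone\<close> is inserted. The next three rules treat the other cases of an empty
  source.\<close>

lemma app_Cup_Tens [simp]: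
  "wt g \<Longrightarrow> t \<in> supp_on (wds (tsrc g)) \<Longrightarrow> app (Cup X \<boxtimes> g) t = app (Cup X) aone \<star> app g t"
  using app_Tens[of "Cup X" g aone t] by (simp del: interp.simps app_Tens)

lemma app_Tens_Cup [simp]:
  "wt f \<Longrightarrow> t \<in> supp_on (wds (tsrc f)) \<Longrightarrow> app (f \<boxtimes> Cup X) t = app f t \<star> app (Cup X) aone"
  using app_Tens[of f "Cup X" t aone] by (simp del: interp.simps app_Tens)

lemma app_unit_Tens [simp]:
  "wt g \<Longrightarrow> t \<in> supp_on (wds (tsrc g)) \<Longrightarrow> app (Id [] \<boxtimes> g) t = app g t"
  using app_Tens[of "Id []" g aone t] by (simp del: interp.simps app_Tens)

lemma app_Tens_unit [simp]:
  "wt f \<Longrightarrow> t \<in> supp_on (wds (tsrc f)) \<Longrightarrow> app (f \<boxtimes> Id []) t = app f t"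
  using app_Tens[of f "Id []" t aone] by (simp del: interp.simps app_Tens)

lemma app_sum [simp]:
  "wt f \<Longrightarrow> (\<And>i. i \<in> I \<Longrightarrow> x i \<in> supp_on (wds (tsrc f))) \<Longrightarrow> app f (\<Sum>i\<in>I. x i) = (\<Sum>i\<in>I. app f (x i))"
  by (rule warr_sum[OF warr_interp])

lemma app_scale [simp]:
  "wt f \<Longrightarrow> x \<in> supp_on (wds (tsrc f)) \<Longrightarrow> app f (fscale c x) = fscale c (app f x)"
  by (rule warr_scale[OF warr_interp])

lemma app_add [simp]:
  "wt f \<Longrightarrow> x \<in> supp_on (wds (tsrc f)) \<Longrightarrow> y \<in> supp_on (wds (tsrc f)) \<Longrightarrow> app f (x + y) = app f x + app f y"
  by (rule lin_maps_add[OF warr_lin[OF warr_interp]])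

declare interp.simps [simp del]

lemma interp_eqI:
  assumes "wt f" "wt g" "tsrc f = tsrc g" "ttgt f = ttgt g"
    and "\<And>w. w \<in> wds (tsrc f) \<Longrightarrow> app f (dlt w) = app g (dlt w)"
  shows "interp f = interp g"
  using warr_eqI[OF warr_interp[OF assms(1)]] warr_interp[OF assms(2)] assms(3-5) by simp

lemma interp_eq1:
  assumes "wt f" "wt g" "tsrc f = [X]" "tsrc g = [X]" "ttgt f = ttgt g"
    and eq: "\<And>s. s \<in> R X \<Longrightarrow> app f s = app g s"
  shows "interp f = interp g"
  by (rule interp_eqI) (use assms in auto)

lemma wds_Cons_cases:
  assumes "w \<in> wds (X # a)"
  obtains p v where "p \<in> idx X" "v \<in> wds a" "dlt w = dlt [p] \<star> dlt v"
  using assms by (auto simp: dlt_aprod elim!: cat_wordsE)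

lemma interp_eq2:
  assumes "wt f" "wt g" "tsrc f = [X, Y]" "tsrc g = [X, Y]" "ttgt f = ttgt g"
    and eq: "\<And>s t. s \<in> R X \<Longrightarrow> t \<in> R Y \<Longrightarrow> app f (s \<star> t) = app g (s \<star> t)"
  shows "interp f = interp g"
proof (rule interp_eqI)
  fix w assume "w \<in> wds (tsrc f)"
  then have "w \<in> wds [X, Y]" using assms by simp
  then obtain p v where "p \<in> idx X" "v \<in> wds [Y]" and w: "dlt w = dlt [p] \<star> dlt v"
    by (rule wds_Cons_cases)
  then show "app f (dlt w) = app g (dlt w)" unfolding w by (intro eq) auto
qed (use assms in auto)

lemma interp_eq3:
  assumes "wt f" "wt g" "tsrc f = [X, Y, Z]" "tsrc g = [X, Y, Z]" "ttgt f = ttgt g"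
    and eq: "\<And>s t u. s \<in> R X \<Longrightarrow> t \<in> R Y \<Longrightarrow> u \<in> R Z \<Longrightarrow> app f (s \<star> (t \<star> u)) = app g (s \<star> (t \<star> u))"
  shows "interp f = interp g"
proof (rule interp_eqI)
  fix w assume "w \<in> wds (tsrc f)"
  then have "w \<in> wds [X, Y, Z]" using assms by simp
  then obtain p v where p: "p \<in> idx X" and v: "v \<in> wds [Y, Z]" and w: "dlt w = dlt [p] \<star> dlt v"
    by (rule wds_Cons_cases)
  from v obtain q u where q: "q \<in> idx Y" and u: "u \<in> wds [Z]" and v': "dlt v = dlt [q] \<star> dlt u"
    by (rule wds_Cons_cases)
  show "app f (dlt w) = app g (dlt w)" unfolding w v' using p q u by (intro eq) auto
qed (use assms in auto)

section \<open>The defining relations on pure tensors\<close>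

lemmas aprod_simps = aprod_assoc aprod_sum_left aprod_sum_right aprod_scale_left aprod_scale_right
  bform_linear

text \<open>Bending \<mu> around S with a cap and a cup replaces the operator by its adjoint, which
  is \<kappa> times itself.\<close>

lemma mu_rotate_left: "s \<in> R \<S> \<Longrightarrow> (\<Sum>p\<in>idx \<S>. fscale (bform \<S> s (mu v (bvec \<S> p))) (dvec \<S> p)) = fscale \<kappa> (mu v s)"
proof -
  assume s: "s \<in> R \<S>"
  have "bform \<S> s (mu v (bvec \<S> p)) = \<kappa> * bform \<S> (mu v s) (bvec \<S> p)" for p
    using bform_mu[OF s bvec_in, of v p] kappa_sq by (simp flip: mult.assoc)
  then have "(\<Sum>p\<in>idx \<S>. fscale (bform \<S> s (mu v (bvec \<S> p))) (dvec \<S> p))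
      = fscale \<kappa> (\<Sum>p\<in>idx \<S>. fscale (bform \<S> (mu v s) (bvec \<S> p)) (dvec \<S> p))"
    by (simp add: fscale.scale_sum_right)
  then show ?thesis using repro_right[OF mu_in[OF s]] by simp
qed

lemma mu_rotate_right: "s \<in> R \<S> \<Longrightarrow> (\<Sum>p\<in>idx \<S>. fscale (bform \<S> (mu v (dvec \<S> p)) s) (bvec \<S> p)) = fscale \<kappa> (mu v s)"
proof -
  assume s: "s \<in> R \<S>"
  have "(\<Sum>p\<in>idx \<S>. fscale (bform \<S> (mu v (dvec \<S> p)) s) (bvec \<S> p))
      = fscale \<kappa> (\<Sum>p\<in>idx \<S>. fscale (bform \<S> (dvec \<S> p) (mu v s)) (bvec \<S> p))"
    by (simp add: fscale.scale_sum_right bform_mu s)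
  then show ?thesis using repro_left[OF mu_in[OF s]] by simp
qed

text \<open>An orthonormal basis is its own dual, so the copairing of V is symmetric. In
  \<open>mu_rotate\<close> the two sides use its legs in opposite roles.\<close>

lemma cup_V: "(\<Sum>p\<in>idx \<V>. f (bvec \<V> p) (dvec \<V> p)) = (\<Sum>p\<in>idx \<V>. f (dvec \<V> p) (bvec \<V> p))"
  by (rule sum.cong) (auto simp: bvec_def dvec_def idx.simps)

text \<open>The dual basis is a left dual, so pairing in the other order costs the symmetry sign.
  For S this is where the \<sigma> in the loop value \<sigma> 2^n comes from.\<close>

lemma bform_bvec_dvec: "p \<in> idx X \<Longrightarrow> bform X (bvec X p) (dvec X p) = sw X X"
  using bform_swap[of "bvec X p" X "dvec X p", symmetric] by (simp add: bform_dvec bvec_def dlt_apply)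

lemma card_idx: "card (idx \<S>) = 2 ^ n" "card (idx \<V>) = N"
  by (simp_all add: idx.simps card_image inj_on_def card_Pow)

lemma bubble: "(\<Sum>p\<in>idx X. fscale (bform X (bvec X p) (dvec X p)) aone) = fscale (sw X X * of_nat (card (idx X))) aone"
proof -
  have "(\<Sum>p\<in>idx X. bform X (bvec X p) (dvec X p)) = sw X X * of_nat (card (idx X))"
    by (simp add: bform_bvec_dvec)
  then show ?thesis by (simp only: fscale.scale_sum_left[symmetric])
qed

text \<open>Evaluated on pure tensors, the zigzags become the reproducing formulas, the symmetry of
  the cap becomes \<open>bform_swap\<close>, and the Clifford relation becomes
  \<open>mu_clifford\<close>. The relations among swaps only compare products of the scalars
  \<open>sw\<close>.\<close>

lemma interp_rel:
  assumes "sb_rel (of_nat N) (\<sigma> * 2 ^ n) \<kappa> a b f g"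
  shows "interp f = interp g"
  using assms
proof (cases rule: sb_rel.cases)
  case (swap_swap X Y)
  show ?thesis unfolding swap_swap
    by (rule interp_eq2[of _ _ X Y]) (simp_all add: aprod_simps sw_sq)
next
  case (braid X Y Z)
  show ?thesis unfolding braid
    by (rule interp_eq3[of _ _ X Y Z]) (simp_all add: aprod_simps mult_ac)
next
  case (zigzag1 X)
  show ?thesis unfolding zigzag1
    by (rule interp_eq1[of _ _ X]) (simp_all add: aprod_simps repro_left)
next
  case (zigzag2 X)
  show ?thesis unfolding zigzag2
    by (rule interp_eq1[of _ _ X]) (simp_all add: aprod_simps repro_right)
next
  case (cap_swap X)
  show ?thesis unfolding cap_swap
    by (rule interp_eq2[of _ _ X X]) (simp_all add: aprod_simps bform_swap)
next
  case (cap_slide X Y)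
  show ?thesis unfolding cap_slide
    by (rule interp_eq3[of _ _ X Y X]) (simp_all add: aprod_simps sw_commute[of X Y] mult.commute)
next
  case (mu_slide X)
  have [simp]: "sw \<V> X = 1" by (simp add: sw_def)
  show ?thesis unfolding mu_slide
    by (rule interp_eq3[of _ _ \<V> \<S> X]) (simp_all add: aprod_simps mu_in)
next
  case mu_rotate
  \<comment> \<open>Both sides are the sum of \<kappa> v_i s \<otimes> v_i over the orthonormal
    basis: rotating \<mu> to either side gives the same \<kappa>, and \<open>cup_V\<close> exchanges
    the legs in V. Evaluation nests the two sums in opposite orders.\<close>
  have eq: "(\<Sum>i\<in>idx \<V>. \<Sum>p\<in>idx \<S>. fscale (bform \<S> s (mu (bvec \<V> i) (bvec \<S> p))) (dvec \<S> p \<star> dvec \<V> i))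
      = (\<Sum>p\<in>idx \<S>. \<Sum>i\<in>idx \<V>. fscale (bform \<S> (mu (dvec \<V> i) (dvec \<S> p)) s) (bvec \<S> p \<star> bvec \<V> i))"
    if s: "s \<in> R \<S>" for s
  proof -
    have "(\<Sum>i\<in>idx \<V>. \<Sum>p\<in>idx \<S>. fscale (bform \<S> s (mu (bvec \<V> i) (bvec \<S> p))) (dvec \<S> p \<star> dvec \<V> i))
        = (\<Sum>i\<in>idx \<V>. fscale \<kappa> (mu (bvec \<V> i) s) \<star> dvec \<V> i)"
      by (simp only: mu_rotate_left[OF s, symmetric] aprod_sum_left aprod_scale_left)
    also have "\<dots> = (\<Sum>i\<in>idx \<V>. fscale \<kappa> (mu (dvec \<V> i) s) \<star> bvec \<V> i)"
      by (rule cup_V)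
    also have "\<dots> = (\<Sum>i\<in>idx \<V>. \<Sum>p\<in>idx \<S>. fscale (bform \<S> (mu (dvec \<V> i) (dvec \<S> p)) s) (bvec \<S> p \<star> bvec \<V> i))"
      by (simp only: mu_rotate_right[OF s, symmetric] aprod_sum_left aprod_scale_left)
    also have "\<dots> = (\<Sum>p\<in>idx \<S>. \<Sum>i\<in>idx \<V>. fscale (bform \<S> (mu (dvec \<V> i) (dvec \<S> p)) s) (bvec \<S> p \<star> bvec \<V> i))"
      by (rule sum.swap)
    finally show ?thesis .
  qed
  show ?thesis unfolding mu_rotate
    by (rule interp_eq1[of _ _ \<S>]) (simp_all add: aprod_simps mu_in supp_on_sum eq)
next
  case mu_swap
  have [simp]: "sw \<S> \<V> = 1" by (simp add: sw_def)
  \<comment> \<open>The \<kappa> from the rotation cancels against the scalar of the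
    relation.\<close>
  show ?thesis unfolding mu_swap
    by (rule interp_eq2[of _ _ \<S> \<V>]) (simp_all add: aprod_simps mu_in mu_rotate_left kappa_sq)
next
  case clifford
  have [simp]: "sw \<V> \<V> = 1" by (simp add: sw_def)
  show ?thesis unfolding clifford
    by (rule interp_eq3[of _ _ \<V> \<V> \<S>]) (simp_all add: aprod_simps mu_in mu_clifford)
next
  case loop_V
  show ?thesis unfolding loop_V
    by (rule interp_eqI) (simp_all add: bubble card_idx sw_def flip: aone_dlt)
next
  case loop_S
  show ?thesis unfolding loop_S
    by (rule interp_eqI) (simp_all add: bubble card_idx sw_def flip: aone_dlt)
qed

section \<open>Soundness for the axioms of a strict linear monoidal category\<close>

lemma interp_eqT:
  assumes "wt f" "wt g" "tsrc f = a @ b" "tsrc g = a @ b" "ttgt f = ttgt g"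
    and eq: "\<And>s t. s \<in> supp_on (wds a) \<Longrightarrow> t \<in> supp_on (wds b) \<Longrightarrow> app f (s \<star> t) = app g (s \<star> t)"
  shows "interp f = interp g"
proof (rule interp_eqI)
  fix w assume "w \<in> wds (tsrc f)"
  then have "w \<in> wds (a @ b)" using assms by simp
  then obtain u v where "u \<in> wds a" "v \<in> wds b" and w: "dlt w = dlt u \<star> dlt v"
    by (rule wds_append_cases)
  then show "app f (dlt w) = app g (dlt w)" unfolding w by (intro eq) auto
qed (use assms in auto)

lemma interp_sound:
  assumes "sb_eq (of_nat N) (\<sigma> * 2 ^ n) \<kappa> a b f g"
  shows "interp f = interp g"
  using assms
proof (induction rule: sb_eq.induct)
  case (rel a b f g)
  then show ?case by (rule interp_rel)
next
  case (tens_assoc f a b g a' b' h a'' b'')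
  note ty = tens_assoc[unfolded sb_typ_iff]
  show ?case
  proof (rule interp_eqT[of _ _ a "a' @ a''"])
    fix s t assume s: "s \<in> supp_on (wds a)" and t: "t \<in> supp_on (wds (a' @ a''))"
    let ?l = "(f \<boxtimes> g) \<boxtimes> h" and ?r = "f \<boxtimes> (g \<boxtimes> h)"
    \<comment> \<open>A tensor that is pure for the splitting \<open>a @ (a' @ a'')\<close> may
      still be mixed in the last two factors, so \<open>t\<close> is expanded into delta arrays,
      which are pure.\<close>
    have eq: "app ?l (s \<star> dlt w) = app ?r (s \<star> dlt w)" if w0: "w \<in> wds (a' @ a'')" for w
    proof -
      obtain u v where uv: "u \<in> wds a'" "v \<in> wds a''" and w: "dlt w = dlt u \<star> dlt v"
        by (rule wds_append_cases[OF w0])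
      have "app ?l ((s \<star> dlt u) \<star> dlt v) = (app f s \<star> app g (dlt u)) \<star> app h (dlt v)"
        using ty s uv by (simp add: wds_append)
      moreover have "app ?r (s \<star> (dlt u \<star> dlt v)) = app f s \<star> (app g (dlt u) \<star> app h (dlt v))"
        using ty s uv by (simp add: wds_append del: app_Tens2)
      ultimately show ?thesis unfolding w by (simp only: aprod_assoc)
    qed
    have "t = (\<Sum>w\<in>wds (a' @ a''). fscale (t w) (dlt w))"
      by (rule supp_on_expand[OF finite_wds t])
    then have st: "s \<star> t = (\<Sum>w\<in>wds (a' @ a''). fscale (t w) (s \<star> dlt w))"
      by (metis (no_types, lifting) aprod_scale_right aprod_sum_right sum.cong)
    have "app k (s \<star> t) = (\<Sum>w\<in>wds (a' @ a''). fscale (t w) (app k (s \<star> dlt w)))"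
      if "wt k" "tsrc k = a @ (a' @ a'')" for k
    proof -
      have "s \<star> dlt w \<in> supp_on (wds (tsrc k))" if "w \<in> wds (a' @ a'')" for w
        using s that \<open>tsrc k = _\<close> by (simp add: wds_append[of a "a' @ a''"])
      then show ?thesis unfolding st using that(1) by simp
    qed
    then show "app ?l (s \<star> t) = app ?r (s \<star> t)"
      using ty eq by simp
  qed (use ty in auto)
next
  case (tens_id a b)
  show ?case
    by (rule interp_eqT[of _ _ a b]) (simp_all add: wds_append del: app_Tens2)
next
  case (interchange f a b g c f' a' b' g' c')
  then show ?case
    by (intro interp_eqT[of _ _ a a']) (auto simp: sb_typ_iff wds_append)
next
  case (plus_tens f a b g h a' b')
  then show ?case
    by (intro interp_eqT[of _ _ a a']) (auto simp: sb_typ_iff wds_append aprod_add_left)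
next
  case (tens_plus h a b f a' b' g)
  then show ?case
    by (intro interp_eqT[of _ _ a a']) (auto simp: sb_typ_iff wds_append aprod_add_right)
next
  case (scale_tens f a b g a' b' r)
  then show ?case
    by (intro interp_eqT[of _ _ a a']) (auto simp: sb_typ_iff wds_append aprod_scale_left)
next
  case (tens_scale f a b g a' b' r)
  then show ?case
    by (intro interp_eqT[of _ _ a a']) (auto simp: sb_typ_iff wds_append aprod_scale_right)
next
  case (plus_neg f a b)
  then show ?case
    by (intro interp_eqI) (auto simp: sb_typ_iff)
next
  case (scale_add f a b r s)
  then show ?case
    by (intro interp_eqI) (auto simp: sb_typ_iff fscale.scale_left_distrib)
next
  case (scale_plus f a b g r)
  then show ?case
    by (intro interp_eqI) (auto simp: sb_typ_iff fscale.scale_right_distrib)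
next
  case (comp_plus f a b g h c)
  note ty = comp_plus[unfolded sb_typ_iff]
  show ?case
  proof (rule interp_eqI)
    fix w assume w: "w \<in> wds (tsrc (h \<cdot> (f \<boxplus> g)))"
    have "app f (dlt w) \<in> supp_on (wds (tsrc h))" "app g (dlt w) \<in> supp_on (wds (tsrc h))"
      using ty w app_in[of f "dlt w"] app_in[of g "dlt w"] by auto
    with ty w show "app (h \<cdot> (f \<boxplus> g)) (dlt w) = app (h \<cdot> f \<boxplus> h \<cdot> g) (dlt w)" by simp
  qed (use ty in auto)
qed ((simp add: interp.simps; fail) | (intro interp_eqI; (auto simp: sb_typ_iff add_ac; fail)))+

end

section \<open>Arrows of the spin Brauer category\<close>

lemma sb_arrow_simps [simp]:
  "src (sb_arrow d D \<kappa> a b f) = a" "tgt (sb_arrow d D \<kappa> a b f) = b"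
  "g \<in> amap (sb_arrow d D \<kappa> a b f) \<longleftrightarrow> sb_eq d D \<kappa> a b f g"
  by (simp_all add: sb_arrow_def)

lemma sb_arrow_cong: "sb_eq d D \<kappa> a b f g \<Longrightarrow> sb_arrow d D \<kappa> a b f = sb_arrow d D \<kappa> a b g"
proof -
  assume eq: "sb_eq d D \<kappa> a b f g"
  have "sb_eq d D \<kappa> a b f h \<longleftrightarrow> sb_eq d D \<kappa> a b g h" for h
    using sb_eq.trans[OF sb_eq.sym[OF eq], of h] sb_eq.trans[OF eq, of h] by blast
  then show ?thesis by (simp add: sb_arrow_def)
qed

lemma spin_brauer_simps [simp]:
  "obj (spin_brauer d D \<kappa>) = UNIV" "unt (spin_brauer d D \<kappa>) = []" "tenO (spin_brauer d D \<kappa>) = (@)"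
  "ide (spin_brauer d D \<kappa>) a = sb_arrow d D \<kappa> a a (Id a)"
  by (simp_all add: spin_brauer_def)

lemma arr_spin_brauer: "arr (spin_brauer d D \<kappa>) = {sb_arrow d D \<kappa> a b f | a b f. sb_typ f a b}"
  by (simp add: spin_brauer_def)

lemma arr_spin_brauerE:
  assumes "A \<in> arr (spin_brauer d D \<kappa>)"
  obtains a b f where "sb_typ f a b" "A = sb_arrow d D \<kappa> a b f"
  using assms by (auto simp: arr_spin_brauer)

lemma sb_arrow_in_arr: "sb_typ f a b \<Longrightarrow> sb_arrow d D \<kappa> a b f \<in> arr (spin_brauer d D \<kappa>)"
  by (auto simp: arr_spin_brauer)

text \<open>Composition collects the composites of all representatives; the congruence rules show
  that these fill exactly one class. The other operations are treated alike.\<close>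

lemma cmp_sb_arrow:
  assumes "sb_typ f a b" "sb_typ g b c"
  shows "cmp (spin_brauer d D \<kappa>) (sb_arrow d D \<kappa> b c g) (sb_arrow d D \<kappa> a b f) = sb_arrow d D \<kappa> a c (g \<cdot> f)"
proof -
  have "(\<exists>u. sb_eq d D \<kappa> b c g u \<and> (\<exists>t. sb_eq d D \<kappa> a b f t \<and> sb_eq d D \<kappa> a c (u \<cdot> t) h))
      \<longleftrightarrow> sb_eq d D \<kappa> a c (g \<cdot> f) h" for h
  proof (intro iffI; (elim exE conjE)?)
    fix u t assume "sb_eq d D \<kappa> b c g u" "sb_eq d D \<kappa> a b f t" and *: "sb_eq d D \<kappa> a c (u \<cdot> t) h"
    then show "sb_eq d D \<kappa> a c (g \<cdot> f) h"
      by (intro sb_eq.trans[OF _ *] sb_eq.cong_comp)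
  qed (use sb_eq.refl[OF assms(1)] sb_eq.refl[OF assms(2)] in blast)
  then show ?thesis by (simp add: spin_brauer_def sb_arrow_def Bex_def)
qed

lemma tenA_sb_arrow:
  assumes "sb_typ f a b" "sb_typ g a' b'"
  shows "tenA (spin_brauer d D \<kappa>) (sb_arrow d D \<kappa> a b f) (sb_arrow d D \<kappa> a' b' g)
    = sb_arrow d D \<kappa> (a @ a') (b @ b') (f \<boxtimes> g)"
proof -
  have "(\<exists>t. sb_eq d D \<kappa> a b f t \<and> (\<exists>u. sb_eq d D \<kappa> a' b' g u \<and> sb_eq d D \<kappa> (a @ a') (b @ b') (t \<boxtimes> u) h))
      \<longleftrightarrow> sb_eq d D \<kappa> (a @ a') (b @ b') (f \<boxtimes> g) h" for h
  proof (intro iffI; (elim exE conjE)?)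
    fix u t assume "sb_eq d D \<kappa> a b f u" "sb_eq d D \<kappa> a' b' g t" and *: "sb_eq d D \<kappa> (a @ a') (b @ b') (u \<boxtimes> t) h"
    then show "sb_eq d D \<kappa> (a @ a') (b @ b') (f \<boxtimes> g) h"
      by (intro sb_eq.trans[OF _ *] sb_eq.cong_tens)
  qed (use sb_eq.refl[OF assms(1)] sb_eq.refl[OF assms(2)] in blast)
  then show ?thesis by (simp add: spin_brauer_def sb_arrow_def Bex_def)
qed

lemma addA_sb_arrow:
  assumes "sb_typ f a b" "sb_typ g a b"
  shows "addA (spin_brauer d D \<kappa>) (sb_arrow d D \<kappa> a b f) (sb_arrow d D \<kappa> a b g) = sb_arrow d D \<kappa> a b (f \<boxplus> g)"
proof -
  have "(\<exists>t. sb_eq d D \<kappa> a b f t \<and> (\<exists>u. sb_eq d D \<kappa> a b g u \<and> sb_eq d D \<kappa> a b (t \<boxplus> u) h))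
      \<longleftrightarrow> sb_eq d D \<kappa> a b (f \<boxplus> g) h" for h
  proof (intro iffI; (elim exE conjE)?)
    fix u t assume "sb_eq d D \<kappa> a b f u" "sb_eq d D \<kappa> a b g t" and *: "sb_eq d D \<kappa> a b (u \<boxplus> t) h"
    then show "sb_eq d D \<kappa> a b (f \<boxplus> g) h"
      by (intro sb_eq.trans[OF _ *] sb_eq.cong_plus)
  qed (use sb_eq.refl[OF assms(1)] sb_eq.refl[OF assms(2)] in blast)
  then show ?thesis by (simp add: spin_brauer_def sb_arrow_def Bex_def)
qed

lemma sclA_sb_arrow:
  assumes "sb_typ f a b"
  shows "sclA (spin_brauer d D \<kappa>) r (sb_arrow d D \<kappa> a b f) = sb_arrow d D \<kappa> a b (Scale r f)"
proof -
  have "(\<exists>t. sb_eq d D \<kappa> a b f t \<and> sb_eq d D \<kappa> a b (Scale r t) h) \<longleftrightarrow> sb_eq d D \<kappa> a b (Scale r f) h" for h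
  proof (intro iffI; (elim exE conjE)?)
    fix t assume "sb_eq d D \<kappa> a b f t" and *: "sb_eq d D \<kappa> a b (Scale r t) h"
    then show "sb_eq d D \<kappa> a b (Scale r f) h"
      by (intro sb_eq.trans[OF _ *] sb_eq.cong_scale)
  qed (use sb_eq.refl[OF assms] in blast)
  then show ?thesis by (simp add: spin_brauer_def sb_arrow_def Bex_def)
qed

section \<open>The functor\<close>

lemma lm_functorD:
  assumes "lm_functor C D F"
  shows "fobj F \<in> obj C \<rightarrow>\<^sub>E obj D" and "fmor F \<in> arr C \<rightarrow>\<^sub>E arr D"
    and "f \<in> arr C \<Longrightarrow> src (fmor F f) = fobj F (src f)"
    and "f \<in> arr C \<Longrightarrow> tgt (fmor F f) = fobj F (tgt f)"
    and "a \<in> obj C \<Longrightarrow> fmor F (ide C a) = ide D (fobj F a)"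
    and "f \<in> arr C \<Longrightarrow> g \<in> arr C \<Longrightarrow> tgt f = src g \<Longrightarrow>
      fmor F (cmp C g f) = cmp D (fmor F g) (fmor F f)"
    and "fobj F (unt C) = unt D"
    and "a \<in> obj C \<Longrightarrow> b \<in> obj C \<Longrightarrow> fobj F (tenO C a b) = tenO D (fobj F a) (fobj F b)"
    and "f \<in> arr C \<Longrightarrow> g \<in> arr C \<Longrightarrow> fmor F (tenA C f g) = tenA D (fmor F f) (fmor F g)"
    and "f \<in> arr C \<Longrightarrow> g \<in> arr C \<Longrightarrow> src f = src g \<Longrightarrow> tgt f = tgt g \<Longrightarrow>
      fmor F (addA C f g) = addA D (fmor F f) (fmor F g)"
    and "f \<in> arr C \<Longrightarrow> fmor F (sclA C c f) = sclA D c (fmor F f)"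
  using assms unfolding lm_functor_def by simp_all

context spin_setup
begin

abbreviation "SB \<equiv> spin_brauer (of_nat N) (\<sigma> * 2 ^ n) \<kappa>"
abbreviation "ar \<equiv> sb_arrow (of_nat N) (\<sigma> * 2 ^ n) \<kappa>"

text \<open>A class is evaluated at an arbitrary representative; by \<open>interp_sound\<close> the
  choice does not affect the value.\<close>

definition spin_functor :: "(sb_ob list, complex sb_term set, 'v cl gmod, array \<Rightarrow> array) functor_data" where
  "spin_functor = \<lparr>fobj = wmod, fmor = (\<lambda>A\<in>arr SB. interp (SOME t. t \<in> amap A))\<rparr>"

lemma fmor_spin_functor:
  assumes "sb_typ f a b"
  shows "fmor spin_functor (ar a b f) = interp f"
proof -
  have "(SOME t. t \<in> amap (ar a b f)) \<in> amap (ar a b f)"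
    by (rule someI[of _ f]) (simp add: sb_eq.refl[OF assms])
  then have "interp f = interp (SOME t. t \<in> amap (ar a b f))"
    by (intro interp_sound) simp
  then show ?thesis
    using sb_arrow_in_arr[OF assms] by (simp add: spin_functor_def)
qed

lemma interp_arr: "sb_typ f a b \<Longrightarrow> warr a b (interp f)"
  using warr_interp by (auto simp: sb_typ_iff)

lemma GV_mod_simps:
  "obj (GV_mod Q) = {M. is_GV_module Q M}" "unt (GV_mod Q) = unit_module Q" "tenO (GV_mod Q) = tensor_module Q"
  by (simp_all add: GV_mod_def)

lemma lm_functor_spin_functor: "lm_functor SB (GV_mod Q) spin_functor"
proof -
  have fobj: "fobj spin_functor = wmod" by (simp add: spin_functor_def)
  note ty = sb_typ.intros
  show ?thesis
    unfolding lm_functor_def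
  proof (intro conjI ballI allI impI)
    show "fobj spin_functor \<in> obj SB \<rightarrow>\<^sub>E obj (GV_mod Q)"
      by (auto simp: fobj GV_mod_simps coord_is_GV_module[OF coord_wmod])
    show "fmor spin_functor \<in> arr SB \<rightarrow>\<^sub>E arr (GV_mod Q)"
    proof (rule PiE_I)
      fix A assume "A \<in> arr SB"
      then obtain a b f where f: "sb_typ f a b" "A = ar a b f" by (rule arr_spin_brauerE)
      then show "fmor spin_functor A \<in> arr (GV_mod Q)"
        using interp_arr[OF f(1)] by (simp add: fmor_spin_functor warr_iff_arr)
    qed (simp add: spin_functor_def)
  next
    fix A assume "A \<in> arr SB"
    then obtain a b f where f: "sb_typ f a b" "A = ar a b f" by (rule arr_spin_brauerE)
    then show "src (fmor spin_functor A) = fobj spin_functor (src A)"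
      "tgt (fmor spin_functor A) = fobj spin_functor (tgt A)"
      using interp_arr[OF f(1)] by (simp_all add: fmor_spin_functor warr_iff_arr fobj)
    show "fmor spin_functor (sclA SB c A) = sclA (GV_mod Q) c (fmor spin_functor A)" for c
      using f by (simp add: sclA_sb_arrow fmor_spin_functor ty interp.simps)
    fix B assume "B \<in> arr SB"
    then obtain a' b' g where g: "sb_typ g a' b'" "B = ar a' b' g" by (rule arr_spin_brauerE)
    show "fmor spin_functor (cmp SB B A) = cmp (GV_mod Q) (fmor spin_functor B) (fmor spin_functor A)"
      if "tgt A = src B"
      using f g that by (simp add: cmp_sb_arrow fmor_spin_functor ty(7) interp.simps)
    show "fmor spin_functor (tenA SB A B) = tenA (GV_mod Q) (fmor spin_functor A) (fmor spin_functor B)"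
      using f g by (simp add: tenA_sb_arrow fmor_spin_functor ty interp.simps)
    show "fmor spin_functor (addA SB A B) = addA (GV_mod Q) (fmor spin_functor A) (fmor spin_functor B)"
      if "src A = src B" "tgt A = tgt B"
      using f g that by (simp add: addA_sb_arrow fmor_spin_functor ty interp.simps)
  next
    show "fmor spin_functor (ide SB a) = ide (GV_mod Q) (fobj spin_functor a)" for a
      by (simp add: fmor_spin_functor ty fobj interp.simps)
    show "fobj spin_functor (unt SB) = unt (GV_mod Q)"
      by (simp add: fobj GV_mod_simps wmod_Nil)
    show "fobj spin_functor (tenO SB a b) = tenO (GV_mod Q) (fobj spin_functor a) (fobj spin_functor b)" for a b
      by (simp add: fobj GV_mod_simps wmod_append)
  qed
qed

section \<open>Values on the generators and uniqueness of the functor\<close>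

lemma all_sb_ob: "(\<forall>X. P X) \<longleftrightarrow> P \<S> \<and> P \<V>"
  by (metis sb_ob.exhaust)

lemma mu_vec_spin: "x \<in> Spinors \<Longrightarrow> mu (vec_arr Q e p) (spin_arr x) = spin_arr (spin_action Q e \<epsilon> (cl_vec Q p) x)"
  by (simp add: mu_def spin_action_eq rep.cl_op_vec)

text \<open>Puts the prescriptions for S and V into one form, uniform in the generating objects and
  stated on arrays, so that caps and swaps are handled once for all objects.\<close>

lemma generator_values_iff:
  "generator_values Q e \<epsilon> gen F \<longleftrightarrow> (\<forall>X. fobj F [X] = base X) \<and>
    (\<forall>X. \<forall>s\<in>R X. \<forall>t\<in>R X. amap (fmor F (gen [X, X] [] (Cap X))) (s \<star> t) = fscale (bform X s t) aone) \<and>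
    (\<forall>s\<in>R \<V>. \<forall>t\<in>R \<S>. amap (fmor F (gen [\<V>, \<S>] [\<S>] Mu)) (s \<star> t) = mu s t) \<and>
    (\<forall>X Y. \<forall>s\<in>R X. \<forall>t\<in>R Y. amap (fmor F (gen [X, Y] [Y, X] (Swap X Y))) (s \<star> t) = fscale (sw X Y) (t \<star> s))"
  unfolding generator_values_def Let_def all_sb_ob R_S R_V ball_simps spin_space_supp base.simps
  by (auto simp: bform_S bform_V mu_vec_spin sw_def)

lemma generator_values_spin_functor: "generator_values Q e \<epsilon> ar spin_functor"
proof -
  have "fobj spin_functor [X] = base X" for X
    by (simp add: spin_functor_def wmod_single)
  then show ?thesis
    unfolding generator_values_iff by (simp add: fmor_spin_functor sb_typ.intros)
qed

lemma warr_pair_eqI: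
  assumes A: "warr [X, Y] b A" and B: "warr [X, Y] b B"
    and eq: "\<And>s t. s \<in> R X \<Longrightarrow> t \<in> R Y \<Longrightarrow> amap A (s \<star> t) = amap B (s \<star> t)"
  shows "A = B"
proof (rule warr_eqI[OF A B])
  fix w assume "w \<in> wds [X, Y]"
  then obtain p v where "p \<in> idx X" "v \<in> wds [Y]" and w: "dlt w = dlt [p] \<star> dlt v"
    by (rule wds_Cons_cases)
  then show "amap A (dlt w) = amap B (dlt w)" unfolding w by (intro eq) auto
qed

text \<open>Written as a sum of \<open>bvec X p \<star> k p\<close>, the copairing turns the zigzag
  into the reproducing property of the vectors \<open>k p\<close>, which is the hypothesis of
  \<open>dual_system\<close>.\<close>

lemma copairing_unique:
  assumes c: "c \<in> supp_on (wds [X, X])" and A: "warr [] [X, X] A" "amap A aone = c"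
    and zigzag: "cmp (GV_mod Q) (tenA (GV_mod Q) (ide (GV_mod Q) (wmod [X])) (interp (Cap X)))
      (tenA (GV_mod Q) A (ide (GV_mod Q) (wmod [X]))) = ide (GV_mod Q) (wmod [X])"
  shows "c = (\<Sum>p\<in>idx X. bvec X p \<star> dvec X p)"
proof -
  \<comment> \<open>The p-th row of the coefficient matrix of \<open>c\<close>, so that
    \<open>c\<close> becomes a sum of pure tensors with standard left factors.\<close>
  define k where "k p = (\<Sum>q\<in>idx X. fscale (c [p, q]) (dlt [q]))" for p
  have k: "k p \<in> R X" for p unfolding k_def by (intro supp_on_sum) auto
  have inj: "inj_on (\<lambda>(p, q). [p, q]) (idx X \<times> idx X)" by (auto simp: inj_on_def)
  have wds: "wds [X, X] = (\<lambda>(p, q). [p, q]) ` (idx X \<times> idx X)"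
    by (rule Set.set_eqI, unfold wds2, auto)
  have "c = (\<Sum>w\<in>wds [X, X]. fscale (c w) (dlt w))"
    by (rule supp_on_expand[OF finite_wds c])
  also have "\<dots> = (\<Sum>p\<in>idx X. \<Sum>q\<in>idx X. fscale (c [p, q]) (dlt [p] \<star> dlt [q]))"
    unfolding wds sum.reindex[OF inj] sum.cartesian_product
    by (rule sum.cong) (auto simp: dlt_aprod)
  also have "\<dots> = (\<Sum>p\<in>idx X. bvec X p \<star> k p)"
    by (rule sum.cong) (simp_all add: k_def bvec_def aprod_sum_right aprod_scale_right)
  finally have ck: "c = (\<Sum>p\<in>idx X. bvec X p \<star> k p)" .
  have I: "warr [X] [X] (ide (GV_mod Q) (wmod [X]))" by (rule warr_ide)
  have cap: "warr [X, X] [] (interp (Cap X))" using warr_interp[of "Cap X"] by simp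
  have T: "warr ([] @ [X]) ([X, X] @ [X]) (tenA (GV_mod Q) A (ide (GV_mod Q) (wmod [X])))"
    by (rule warr_tenA[OF A(1) I])
  have U: "warr ([X] @ [X, X]) ([X] @ []) (tenA (GV_mod Q) (ide (GV_mod Q) (wmod [X])) (interp (Cap X)))"
    by (rule warr_tenA[OF I cap])
  have ide: "amap (ide (GV_mod Q) (wmod [X])) y = y" if "y \<in> R X" for y
    using that by (simp add: GV_mod_def)
  have "(\<Sum>p\<in>idx X. fscale (bform X (k p) y) (bvec X p)) = y" if y: "y \<in> R X" for y
  proof -
    have "y = amap (cmp (GV_mod Q) (tenA (GV_mod Q) (ide (GV_mod Q) (wmod [X])) (interp (Cap X)))
        (tenA (GV_mod Q) A (ide (GV_mod Q) (wmod [X])))) y"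
      by (simp only: zigzag ide[OF y])
    also have "\<dots> = amap (tenA (GV_mod Q) (ide (GV_mod Q) (wmod [X])) (interp (Cap X)))
        (amap (tenA (GV_mod Q) A (ide (GV_mod Q) (wmod [X]))) y)"
      by (rule cmp_apply[OF T]) (simp add: y)
    also have "amap (tenA (GV_mod Q) A (ide (GV_mod Q) (wmod [X]))) y = c \<star> y"
      using tenA_apply[OF A(1) I, of aone y] y by (simp add: A(2) ide)
    also have "c \<star> y = (\<Sum>p\<in>idx X. bvec X p \<star> (k p \<star> y))"
      by (simp add: ck aprod_sum_left aprod_assoc)
    also have "amap (tenA (GV_mod Q) (ide (GV_mod Q) (wmod [X])) (interp (Cap X))) \<dots>
        = (\<Sum>p\<in>idx X. amap (tenA (GV_mod Q) (ide (GV_mod Q) (wmod [X])) (interp (Cap X))) (bvec X p \<star> (k p \<star> y)))"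
      by (rule warr_sum[OF U]) (simp add: k y)
    also have "\<dots> = (\<Sum>p\<in>idx X. fscale (bform X (k p) y) (bvec X p))"
      by (rule sum.cong[OF HOL.refl])
        (simp add: tenA_apply[OF I cap] k y ide aprod_scale_right)
    finally show ?thesis ..
  qed
  then show ?thesis
    unfolding ck by (intro dual_system k)
qed

text \<open>Induction on terms. The real cases are the zero arrows and the cups: the other
  generators are prescribed, and identities and the operations are preserved by
  functoriality.\<close>

lemma spin_functor_unique:
  assumes F: "lm_functor SB (GV_mod Q) F" and gen: "generator_values Q e \<epsilon> ar F"
  shows "F = spin_functor"
proof -
  note gen' = gen[unfolded generator_values_iff] and FD = lm_functorD[OF F]
  have Fide: "fmor F (ar a a (Id a)) = ide (GV_mod Q) (fobj F a)" for a
    using FD(5)[of a] by simp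
  have Fcmp: "fmor F (ar a c (g \<cdot> f)) = cmp (GV_mod Q) (fmor F (ar b c g)) (fmor F (ar a b f))"
    if "sb_typ f a b" "sb_typ g b c" for a b c f g
    using FD(6)[OF sb_arrow_in_arr[OF that(1)] sb_arrow_in_arr[OF that(2)]] by (simp add: cmp_sb_arrow[OF that])
  have Ften: "fmor F (ar (a @ a') (b @ b') (f \<boxtimes> g)) = tenA (GV_mod Q) (fmor F (ar a b f)) (fmor F (ar a' b' g))"
    if "sb_typ f a b" "sb_typ g a' b'" for a b a' b' f g
    using FD(9)[OF sb_arrow_in_arr[OF that(1)] sb_arrow_in_arr[OF that(2)]] by (simp add: tenA_sb_arrow[OF that])
  have Fadd: "fmor F (ar a b (f \<boxplus> g)) = addA (GV_mod Q) (fmor F (ar a b f)) (fmor F (ar a b g))"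
    if "sb_typ f a b" "sb_typ g a b" for a b f g
    using FD(10)[OF sb_arrow_in_arr[OF that(1)] sb_arrow_in_arr[OF that(2)]] by (simp add: addA_sb_arrow[OF that])
  have Fscl: "fmor F (ar a b (Scale r f)) = sclA (GV_mod Q) r (fmor F (ar a b f))"
    if "sb_typ f a b" for a b f r
    using FD(11)[OF sb_arrow_in_arr[OF that]] by (simp add: sclA_sb_arrow[OF that])
  have fobj: "fobj F a = wmod a" for a
  proof (induction a)
    case Nil
    show ?case using FD(7) by (simp add: wmod_Nil GV_mod_simps)
  next
    case (Cons X a)
    have "fobj F ([X] @ a) = tensor_module Q (fobj F [X]) (fobj F a)"
      using FD(8)[of "[X]" a] by (simp add: GV_mod_simps)
    then show ?case using Cons gen' wmod_append[of "[X]" a] by (simp add: wmod_single)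
  qed
  have W: "warr a b (fmor F (ar a b f))" if "sb_typ f a b" for a b f
    unfolding warr_iff_arr using FD(3,4)[OF sb_arrow_in_arr[OF that]]
      PiE_mem[OF FD(2) sb_arrow_in_arr[OF that]] by (simp add: fobj)
  note ty = sb_typ.intros
  have mor: "fmor F (ar a b f) = interp f" if "sb_typ f a b" for a b f
    using that
  proof (induction rule: sb_typ.induct)
    case (1 a)
    then show ?case by (simp add: Fide fobj interp.simps)
  next
    case (2 a b)
    let ?Z = "Zero a b" and ?A = "fmor F (ar a b (Zero a b))"
    \<comment> \<open>Preservation of zero is derived: the image of a zero arrow equals its sum with
      its own negative, hence vanishes.\<close>
    have "ar a b (?Z \<boxplus> Scale (- 1) ?Z) = ar a b ?Z"
      by (intro sb_arrow_cong sb_eq.plus_neg ty)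
    then have eq: "addA (GV_mod Q) ?A (sclA (GV_mod Q) (- 1) ?A) = ?A"
      by (simp only: Fadd[OF ty(2) ty(10)[OF ty(2)], symmetric] Fscl[OF ty(2), symmetric])
    have "amap (addA (GV_mod Q) ?A (sclA (GV_mod Q) (- 1) ?A)) (dlt w) = 0" if "w \<in> wds a" for w
      using that warr_src[OF W[OF ty(2)]] by (simp add: GV_mod_def)
    then have "amap ?A (dlt w) = 0" if "w \<in> wds a" for w
      using that unfolding eq .
    then show ?case
      by (intro warr_eqI[OF W[OF ty(2)] interp_arr[OF ty(2)]]) simp
  next
    case (3 X)
    show ?case
      by (rule warr_pair_eqI[OF W[OF ty(3)] interp_arr[OF ty(3)]]) (use gen' in simp)
  next
    case (4 X)
    let ?A = "fmor F (ar [] [X, X] (Cup X))"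
    have cap: "fmor F (ar [X, X] [] (Cap X)) = interp (Cap X)"
      by (rule warr_pair_eqI[OF W[OF ty(3)] interp_arr[OF ty(3)]]) (use gen' in simp)
    have A: "warr [] [X, X] ?A" by (rule W[OF ty(4)])
    have t1: "sb_typ (Cup X \<boxtimes> Id [X]) [X] [X, X, X]" and t2: "sb_typ (Id [X] \<boxtimes> Cap X) [X, X, X] [X]"
      by (simp_all add: sb_typ_iff)
    \<comment> \<open>The image of the first zigzag relation is the hypothesis that
      \<open>copairing_unique\<close> asks of the image of the cup.\<close>
    have "ar [X] [X] ((Id [X] \<boxtimes> Cap X) \<cdot> (Cup X \<boxtimes> Id [X])) = ar [X] [X] (Id [X])"
      by (intro sb_arrow_cong sb_eq.rel sb_rel.zigzag1)
    then have "cmp (GV_mod Q) (fmor F (ar [X, X, X] [X] (Id [X] \<boxtimes> Cap X))) (fmor F (ar [X] [X, X, X] (Cup X \<boxtimes> Id [X])))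
        = ide (GV_mod Q) (wmod [X])"
      using Fcmp[OF t1 t2] Fide[of "[X]"] by (simp add: fobj)
    moreover have "fmor F (ar [X, X, X] [X] (Id [X] \<boxtimes> Cap X)) = tenA (GV_mod Q) (ide (GV_mod Q) (wmod [X])) (interp (Cap X))"
      using Ften[OF ty(1)[of "[X]"] ty(3)[of X]] by (simp add: Fide fobj cap)
    moreover have "fmor F (ar [X] [X, X, X] (Cup X \<boxtimes> Id [X])) = tenA (GV_mod Q) ?A (ide (GV_mod Q) (wmod [X]))"
      using Ften[OF ty(4)[of X] ty(1)[of "[X]"]] by (simp add: Fide fobj)
    ultimately have "cmp (GV_mod Q) (tenA (GV_mod Q) (ide (GV_mod Q) (wmod [X])) (interp (Cap X)))
      (tenA (GV_mod Q) ?A (ide (GV_mod Q) (wmod [X]))) = ide (GV_mod Q) (wmod [X])" by simp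
    from copairing_unique[OF _ A HOL.refl this]
    have "amap ?A aone = (\<Sum>p\<in>idx X. bvec X p \<star> dvec X p)"
      using warr_in[OF A, of aone] by (simp del: wds.simps(2))
    then have "amap ?A aone = app (Cup X) aone" by simp
    then show ?case
      by (intro warr_eqI[OF A interp_arr[OF ty(4)]]) (simp flip: aone_dlt)
  next
    case (5 X Y)
    show ?case
      by (rule warr_pair_eqI[OF W[OF ty(5)] interp_arr[OF ty(5)]]) (use gen' in simp)
  next
    case 6
    show ?case
      by (rule warr_pair_eqI[OF W[OF ty(6)] interp_arr[OF ty(6)]]) (use gen' in simp)
  next
    case (7 f a b g c)
    then show ?case by (simp only: Fcmp[OF 7(1,2)] interp.simps)
  next
    case (8 f a b g c d)
    then show ?case by (simp only: Ften[OF 8(1,2)] interp.simps)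
  next
    case (9 f a b g)
    then show ?case by (simp only: Fadd[OF 9(1,2)] interp.simps)
  next
    case (10 f a b r)
    then show ?case by (simp only: Fscl[OF 10(1)] interp.simps)
  qed
  have "fmor F = fmor spin_functor"
  proof (rule extensionalityI[of _ "arr SB"])
    fix A assume "A \<in> arr SB"
    then obtain a b f where "sb_typ f a b" "A = ar a b f" by (rule arr_spin_brauerE)
    then show "fmor F A = fmor spin_functor A" by (simp add: mor fmor_spin_functor)
  qed (use FD(2) in \<open>auto simp: PiE_def spin_functor_def\<close>)
  moreover have "fobj F = fobj spin_functor"
    using fobj by (auto simp: spin_functor_def)
  ultimately show ?thesis by (simp add: functor_data.equality)
qed

subsection \<open>Coevaluation in an arbitrary basis\<close>

text \<open>Stated for an abstract space embedded onto \<open>R X\<close>, so as to serve S and V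
  alike. Since \<open>left_dual\<close> is a definite description, the dual basis must first be
  shown to exist and to be unique; together with \<open>B\<close> it then satisfies the reproducing
  property of \<open>dual_system\<close>.\<close>

lemma coevaluation_basis:
  fixes sc :: "complex \<Rightarrow> 'b::ab_group_add \<Rightarrow> 'b" and emb :: "'b \<Rightarrow> array"
  assumes vs: "vector_space sc" and B: "basis_of sc U B" and fin: "finite B"
    and add: "\<And>x y. emb (x + y) = emb x + emb y" and scale: "\<And>c x. emb (sc c x) = fscale c (emb x)"
    and im: "emb ` U = R X" and inj: "inj_on emb U"
    and \<phi>: "\<And>x y. x \<in> U \<Longrightarrow> y \<in> U \<Longrightarrow> \<phi> x y = bform X (emb x) (emb y)"
  shows "(\<Sum>x\<in>B. emb x \<star> emb (left_dual \<phi> U B x)) = (\<Sum>p\<in>idx X. bvec X p \<star> dvec X p)"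
proof -
  interpret vector_space sc by (fact vs)
  have ind: "independent B" and span: "span B = U"
    using B by (auto simp: basis_of_def)
  have BU: "x \<in> U" if "x \<in> B" for x using span_base[OF that] span by simp
  have scU: "sc k u \<in> U" if "u \<in> U" for k u
    using span_scale[of u B k] that by (simp add: span)
  have embR: "emb x \<in> R X" if "x \<in> U" for x using im that by blast
  have zero: "emb 0 = 0" using scale[of 0 0] by simp
  have sum: "emb (\<Sum>i\<in>I. sc (k i) (x i)) = (\<Sum>i\<in>I. fscale (k i) (emb (x i)))" for I :: "'i set" and k x
    by (induction I rule: infinite_finite_induct) (simp_all add: zero add scale)
  have bsum: "bform X s (\<Sum>i\<in>I. fscale (k i) (t i)) = (\<Sum>i\<in>I. k i * bform X s (t i))"
    and bsum': "bform X (\<Sum>i\<in>I. fscale (k i) (t i)) s = (\<Sum>i\<in>I. k i * bform X (t i) s)"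
    for I :: "'i set" and s k t
    by (induction I rule: infinite_finite_induct)
      (simp_all add: bform_linear, simp_all add: bform_def zero_fun_apply)
  have expand: "(\<Sum>x\<in>B. sc (representation B u x) x) = u" if "u \<in> U" for u
    by (rule sum_representation_eq[OF ind _ fin]) (use that span in auto)
  have nondeg: "x = y" if x: "x \<in> U" and y: "y \<in> U" and eq: "\<And>z. z \<in> B \<Longrightarrow> \<phi> x z = \<phi> y z" for x y
  proof -
    have eqB: "bform X (emb x) (emb z) = bform X (emb y) (emb z)" if "z \<in> B" for z
      using eq[OF that] \<phi>[OF x BU[OF that]] \<phi>[OF y BU[OF that]] by (simp only:)
    have eqR: "bform X (emb x) w = bform X (emb y) w" if w: "w \<in> R X" for w
    proof -
      obtain u where u: "w = emb u" "u \<in> U" by (rule imageE[OF w[folded im]])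
      have ex: "emb u = (\<Sum>z\<in>B. fscale (representation B u z) (emb z))"
        using sum[of "representation B u" "\<lambda>z. z" B] unfolding expand[OF u(2)] .
      show ?thesis
        unfolding u(1) ex bsum by (rule sum.cong) (simp_all only: eqB)
    qed
    have "emb x = (\<Sum>p\<in>idx X. fscale (bform X (emb x) (bvec X p)) (dvec X p))"
      by (rule repro_right[OF embR[OF x], symmetric])
    also have "\<dots> = emb y"
      by (simp only: eqR[OF bvec_in] repro_right[OF embR[OF y]])
    finally have "emb x = emb y" .
    then show ?thesis by (rule inj_onD[OF inj _ x y])
  qed
  have dual: "left_dual \<phi> U B x \<in> U \<and> (\<forall>y\<in>B. \<phi> (left_dual \<phi> U B x) y = (if x = y then 1 else 0))"
    if x: "x \<in> B" for x
  proof -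
    define pre where "pre = inv_into U emb"
    have pre: "emb (pre t) = t" "pre t \<in> U" if "t \<in> R X" for t
      unfolding pre_def using f_inv_into_f[of t emb U] inv_into_into[of t emb U] that by (simp_all add: im)
    \<comment> \<open>The vector representing the coordinate functional of \<open>x\<close> through
      the form: each dual vector is weighted by the value of the functional on the matching standard
      basis vector.\<close>
    define c where "c = (\<Sum>p\<in>idx X. fscale (representation B (pre (bvec X p)) x) (dvec X p))"
    have c: "c \<in> R X" unfolding c_def by (intro supp_on_sum supp_on_scale dvec_in)
    have "\<phi> (pre c) y = (if x = y then 1 else 0)" if y: "y \<in> B" for y
    proof -
      \<comment> \<open>The reproducing formula, pulled back to \<open>U\<close>. Taking the
        coordinate at \<open>x\<close> on both sides evaluates the form at \<open>c\<close>.\<close>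
      have "y = (\<Sum>p\<in>idx X. sc (bform X (dvec X p) (emb y)) (pre (bvec X p)))"
      proof (rule inj_onD[OF inj])
        show "emb y = emb (\<Sum>p\<in>idx X. sc (bform X (dvec X p) (emb y)) (pre (bvec X p)))"
          unfolding sum using repro_left[OF embR[OF BU[OF y]]] by (simp add: pre)
        show "(\<Sum>p\<in>idx X. sc (bform X (dvec X p) (emb y)) (pre (bvec X p))) \<in> U"
          unfolding span[symmetric] by (intro span_sum span_scale) (simp add: span pre)
      qed (rule BU[OF y])
      then have "representation B y x
          = representation B (\<Sum>p\<in>idx X. sc (bform X (dvec X p) (emb y)) (pre (bvec X p))) x"
        by (rule arg_cong)
      also have "\<dots> = (\<Sum>p\<in>idx X. bform X (dvec X p) (emb y) * representation B (pre (bvec X p)) x)"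
        using ind span pre scU
        by (subst representation_sum) (simp_all add: representation_scale sum_fun_apply)
      also have "\<dots> = \<phi> (pre c) y"
        using y c pre[OF c] by (simp add: \<phi> BU c_def bsum' mult.commute)
      finally show ?thesis
        using representation_basis[OF ind y] by auto
    qed
    then have ex: "pre c \<in> U \<and> (\<forall>y\<in>B. \<phi> (pre c) y = (if x = y then 1 else 0))"
      using pre c by simp
    show ?thesis
      unfolding left_dual_def
    proof (rule theI, rule ex)
      fix x' assume x': "x' \<in> U \<and> (\<forall>y\<in>B. \<phi> x' y = (if x = y then 1 else 0))"
      show "x' = pre c" by (rule nondeg) (use x' ex in simp_all)
    qed
  qed
  show ?thesis
  proof (rule dual_system)
    show "emb (left_dual \<phi> U B x) \<in> R X" if "x \<in> B" for x
      using dual[OF that] embR by blast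
    fix y assume "y \<in> R X"
    then obtain u where u: "u \<in> U" "y = emb u" using im by blast
    have y: "y = (\<Sum>z\<in>B. fscale (representation B u z) (emb z))"
      using sum[of "representation B u" "\<lambda>z. z" B] unfolding expand[OF u(1)] u(2) .
    have "bform X (emb (left_dual \<phi> U B x)) y = representation B u x" if x: "x \<in> B" for x
    proof -
      have "bform X (emb (left_dual \<phi> U B x)) y = (\<Sum>z\<in>B. representation B u z * \<phi> (left_dual \<phi> U B x) z)"
        unfolding y bsum using dual[OF x] by (intro sum.cong) (simp_all add: \<phi> BU)
      also have "\<dots> = (\<Sum>z\<in>B. if x = z then representation B u z else 0)"
        using dual[OF x] by (intro sum.cong) auto
      finally show ?thesis using fin x by simp
    qed
    then have "(\<Sum>x\<in>B. fscale (bform X (emb (left_dual \<phi> U B x)) y) (emb x))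
        = (\<Sum>x\<in>B. fscale (representation B u x) (emb x))"
      by (intro sum.cong) simp_all
    also have "\<dots> = y" by (rule y[symmetric])
    finally show "(\<Sum>x\<in>B. fscale (bform X (emb (left_dual \<phi> U B x)) y) (emb x)) = y" .
  qed
qed

text \<open>The basis is given only as an independent spanning set; its finiteness comes from the
  finite spanning set of delta functions.\<close>

lemma cup_spin:
  assumes "basis_of fscale (spin_space n) B"
  shows "app (Cup \<S>) aone = (\<Sum>x\<in>B. spin_arr x \<star> spin_arr (left_dual (spin_form N) (spin_space n) B x))"
proof -
  have B: "fscale.independent B" "fscale.span B = Spinors"
    using assms by (auto simp: basis_of_def spin_space_supp)
  have "B \<subseteq> fscale.span (dlt ` Pow {1..n})"
    using B fscale.span_superset[of B] by (simp add: span_dlt)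
  then have "finite B"
    using fscale.independent_span_bound[of "dlt ` Pow {1..n}" B] B(1) by simp
  moreover have "inj_on spin_arr (spin_space n)" by (rule inj_on_inverseI[where g = unspin]) simp
  ultimately show ?thesis
    using coevaluation_basis[OF fscale.vector_space_axioms assms, of spin_arr \<S> "spin_form N"]
    by (simp add: spin_arr_add spin_arr_scale bform_S R_S spin_space_supp)
qed

lemma cup_vector:
  assumes "basis_of (vscale Q) UNIV B"
  shows "app (Cup \<V>) aone = (\<Sum>v\<in>B. vec_arr Q e v \<star> vec_arr Q e (left_dual (vform Q) UNIV B v))"
proof -
  have "vs.independent B" using assms by (auto simp: basis_of_def)
  then have "finite B"
    using vs.independent_span_bound[of "e ` {1..N}" B] span_e by simp
  moreover have "inj (vec_arr Q e)" by (rule inj_on_inverseI[where g = unvec]) simp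
  ultimately show ?thesis
    using coevaluation_basis[OF vs.vector_space_axioms assms, of "vec_arr Q e" \<V> "vform Q"]
    by (simp add: vec_arr_add vec_arr_scale bform_V R_V)
qed

end

theorem theorem6p1:
  fixes Q :: "'v::ab_group_add quad_space" and e :: "nat \<Rightarrow> 'v" and \<epsilon> :: complex
    and N n :: nat and \<sigma> \<kappa> d D :: complex
  assumes "quadratic_space Q" and "orthonormal_basis Q e" and "\<epsilon> \<in> {1, - 1}"
    and "N = qdim Q" and "n = N div 2"
    and "\<sigma> = (- 1) ^ ((n choose 2) + n * N)" and "\<kappa> = (- 1) ^ (n * N)"
    and "d = of_nat N" and "D = \<sigma> * 2 ^ n"
  shows "(\<exists>!F. lm_functor (spin_brauer d D \<kappa>) (GV_mod Q) F \<and>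
        generator_values Q e \<epsilon> (sb_arrow d D \<kappa>) F) \<and>
    (\<forall>F. lm_functor (spin_brauer d D \<kappa>) (GV_mod Q) F \<and>
        generator_values Q e \<epsilon> (sb_arrow d D \<kappa>) F \<longrightarrow>
      (\<forall>B. basis_of fscale (spin_space n) B \<longrightarrow>
         amap (fmor F (sb_arrow d D \<kappa> [] [\<S>, \<S>] (Cup \<S>))) aone =
           (\<Sum>x\<in>B. spin_arr x \<star> spin_arr (left_dual (spin_form N) (spin_space n) B x))) \<and>
      (\<forall>B. basis_of (vscale Q) UNIV B \<longrightarrow>
         amap (fmor F (sb_arrow d D \<kappa> [] [\<V>, \<V>] (Cup \<V>))) aone =
           (\<Sum>v\<in>B. vec_arr Q e v \<star> vec_arr Q e (left_dual (vform Q) UNIV B v))))"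
proof -
  interpret s: spin_setup Q e \<epsilon>
    using assms(1-3) by unfold_locales
  note eqs = assms(4-9)
  show ?thesis
    unfolding eqs
  proof (intro conjI ex1I allI impI)
    show "lm_functor s.SB (GV_mod Q) s.spin_functor"
      by (rule s.lm_functor_spin_functor)
    show "generator_values Q e \<epsilon> s.ar s.spin_functor"
      by (rule s.generator_values_spin_functor)
  next
    \<comment> \<open>Uniqueness is proved first; it reduces the statements about the cups of an
      arbitrary such functor to the one constructed above.\<close>
    fix F assume "lm_functor s.SB (GV_mod Q) F \<and> generator_values Q e \<epsilon> s.ar F"
    then show F: "F = s.spin_functor"
      using s.spin_functor_unique by blast
    have cup: "fmor F (s.ar [] [X, X] (Cup X)) = s.interp (Cup X)" for X
      unfolding F by (rule s.fmor_spin_functor) (rule sb_typ.intros)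
    show "amap (fmor F (s.ar [] [\<S>, \<S>] (Cup \<S>))) aone =
        (\<Sum>x\<in>B. spin_arr x \<star> spin_arr (left_dual (spin_form (qdim Q)) (spin_space (qdim Q div 2)) B x))"
      if "basis_of fscale (spin_space (qdim Q div 2)) B" for B
      unfolding cup by (rule s.cup_spin[OF that])
    show "amap (fmor F (s.ar [] [\<V>, \<V>] (Cup \<V>))) aone =
        (\<Sum>v\<in>B. vec_arr Q e v \<star> vec_arr Q e (left_dual (vform Q) UNIV B v))"
      if "basis_of (vscale Q) UNIV B" for B
      unfolding cup by (rule s.cup_vector[OF that])
  qed
qed

end
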